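(* A countable discrete group $\Gamma$ is exact if and only if $\overline{\mathrm{FIRE}}_\Gamma=\mathrm{AIRE}_\Gamma$, where $\mathrm{FIRE}_\Gamma$ and $\mathrm{AIRE}_\Gamma$ are the sets of finite, respectively amenable, invariant random equivalence relations on $\Gamma$ and the closure is taken in the weak topology.
   Context: Let $\Gamma$ be a countable discrete group. $\operatorname{Prob}(\Gamma)$ is the set of probability measures on $\Gamma$ with the topology (and Borel structure) inherited from $\ell^1(\Gamma)$; $\Gamma$ acts on it by $(g.\eta)(h)=\eta(g^{-1}h)$. Exactness: an action of $\Gamma$ by homeomorphisms on a topological space $X$ is topologically amenable if there are continuous maps $\eta_n\colon X\to \operatorname{Prob}(\Gamma)$, $x\mapsto \eta_n^x$ ($n\in\mathbb N$), such that for each $g\in\Gamma$, $\sup_{x\in X}\|g.\eta_n^x-\eta_n^{g.x}\|_1\to 0$ as $n\to\infty$. $\Gamma$ is exact if it admits a topologically amenable action on a (nonempty) compact metrizable space. Invariant random equivalence relations: $\mathcal E$ is the set of equivalence relations on $\Gamma$, with the topology inherited from $\{0,1\}^{\Gamma\times\Gamma}$ (a compact metrizable space). $\Gamma$ acts on $\mathcal E$ by left shift: $(h,h')\in g.r$ iff $(g^{-1}h,g^{-1}h')\in r$. For $r\in\mathcal E$, $[g]_r$ is the $r$-class of $g$; $e$ is the identity. An invariant random equivalence relation (IRE) on $\Gamma$ is a $\Gamma$-invariant Borel probability measure on $\mathcal E$; the set $\mathrm{IRE}_\Gamma$ of all IREs carries the weak topology of $\operatorname{Prob}(\mathcal E)$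 (testing against continuous functions on $\mathcal E$). An IRE $\rho$ is finite if $\rho$-almost every $r$ has only finite classes. An IRE $\rho$ is amenable if there are Borel maps $\lambda_n\colon\mathcal E\to\operatorname{Prob}(\Gamma)$, $r\mapsto\lambda_n^r$ ($n\in\mathbb N$), such that for $\rho$-almost every $r\in\mathcal E$ and every $g\in[e]_r$, $\|g^{-1}.\lambda_n^r-\lambda_n^{g^{-1}.r}\|_1\to0$ as $n\to\infty$. *)

theory Defs
  imports "HOL-Analysis.Analysis" "HOL-Probability.Probability"
begin

text \<open>
  A countable discrete group is a type of class \<open>{group_add, countable}\<close>. The class \<open>group_add\<close>
  does not assume commutativity; the product of \<open>g\<close> and \<open>h\<close> is written \<open>g + h\<close>, the inverse of
  \<open>g\<close> is \<open>- g\<close> and the identity is \<open>0\<close>. The class \<open>countable\<close> includes the finite types.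
\<close>


section \<open>Probability measures on the group\<close>

definition l1_dist :: "'a pmf \<Rightarrow> 'a pmf \<Rightarrow> real" where
  "l1_dist p q = (\<Sum>\<^sub>\<infinity>h. \<bar>pmf p h - pmf q h\<bar>)"

definition Prob_topology :: "'a pmf topology" where
  "Prob_topology = Metric_space.mtopology UNIV l1_dist"

definition Prob_borel :: "'a pmf measure" where
  "Prob_borel = sigma UNIV {U. openin Prob_topology U}"

definition translate :: "'a::group_add \<Rightarrow> 'a pmf \<Rightarrow> 'a pmf" where
  "translate g p = map_pmf (\<lambda>h. g + h) p"

lemma pmf_translate: "pmf (translate g p) h = pmf p (- g + h)"
proof -
  have "pmf (map_pmf (\<lambda>h. g + h) p) (g + (- g + h)) = pmf p (- g + h)"
    by (rule pmf_map_inj') (simp add: inj_def)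
  then show ?thesis
    by (simp add: translate_def add.assoc [symmetric])
qed

lemma pmf_summable_on: "pmf p summable_on A"
proof -
  have "Infinite_Set_Sum.abs_summable_on (pmf p) UNIV"
    unfolding Infinite_Set_Sum.abs_summable_on_def by (rule integrable_pmf)
  then have "pmf p summable_on UNIV"
    using abs_summable_equivalent abs_summable_summable by blast
  then show ?thesis
    by (rule summable_on_subset_banach) simp
qed

lemma l1_summable_on: "(\<lambda>h. \<bar>pmf p h - pmf q h\<bar>) summable_on A"
proof (rule summable_on_comparison_test)
  show "(\<lambda>h. pmf p h + pmf q h) summable_on A"
    by (intro summable_on_add pmf_summable_on)
  show "\<bar>pmf p h - pmf q h\<bar> \<le> pmf p h + pmf q h" for h
    using pmf_nonneg [of p h] pmf_nonneg [of q h] by linarith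
qed auto

lemma Metric_space_l1_dist: "Metric_space UNIV l1_dist"
proof
  fix p q r :: "'a pmf"
  show "0 \<le> l1_dist p q"
    unfolding l1_dist_def by (rule infsum_nonneg) simp
  show "l1_dist p q = l1_dist q p"
    unfolding l1_dist_def by (simp add: abs_minus_commute)
  show "l1_dist p q = 0 \<longleftrightarrow> p = q"
  proof
    assume "l1_dist p q = 0"
    then have "\<bar>pmf p h - pmf q h\<bar> = 0" for h
      unfolding l1_dist_def by (rule nonneg_infsum_le_0D [OF eq_refl]) (auto intro: l1_summable_on)
    then show "p = q"
      by (intro pmf_eqI) simp
  qed (simp add: l1_dist_def)
  have "l1_dist p r \<le> (\<Sum>\<^sub>\<infinity>h. \<bar>pmf p h - pmf q h\<bar> + \<bar>pmf q h - pmf r h\<bar>)"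
    unfolding l1_dist_def by (intro infsum_mono l1_summable_on summable_on_add) linarith
  also have "\<dots> = l1_dist p q + l1_dist q r"
    unfolding l1_dist_def by (intro infsum_add l1_summable_on)
  finally show "l1_dist p r \<le> l1_dist p q + l1_dist q r" .
qed


section \<open>Exactness\<close>

definition homeo_action :: "('a::group_add \<Rightarrow> 'x \<Rightarrow> 'x) \<Rightarrow> 'x topology \<Rightarrow> bool" where
  "homeo_action act X \<longleftrightarrow>
     (\<forall>g. homeomorphic_map X X (act g)) \<and>
     (\<forall>x\<in>topspace X. act 0 x = x) \<and>
     (\<forall>g h. \<forall>x\<in>topspace X. act (g + h) x = act g (act h x))"

text \<open>The supremum below is that of a set of reals bounded by \<open>2\<close>; it is only meaningful for a
  nonempty space, which is the only case in which the notion is used.\<close>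

definition topologically_amenable :: "('a::group_add \<Rightarrow> 'x \<Rightarrow> 'x) \<Rightarrow> 'x topology \<Rightarrow> bool" where
  "topologically_amenable act X \<longleftrightarrow>
     (\<exists>\<eta> :: nat \<Rightarrow> 'x \<Rightarrow> 'a pmf.
        (\<forall>n. continuous_map X Prob_topology (\<eta> n)) \<and>
        (\<forall>g. (\<lambda>n. SUP x\<in>topspace X. l1_dist (translate g (\<eta> n x)) (\<eta> n (act g x)))
               \<longlonglongrightarrow> 0))"

text \<open>
  The underlying set of a compact metrizable space has at most the cardinality of the continuum, so
  every such space is homeomorphic to one whose points are taken from the type \<open>nat \<Rightarrow> real\<close>
  (with an arbitrary topology on an arbitrary subset of that type). The theorem \<open>exact_groupI\<close>
  below confirms that spaces over any other type give the same notion.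
\<close>

definition exact_group :: "'a::{group_add, countable} itself \<Rightarrow> bool" where
  "exact_group _ \<longleftrightarrow>
     (\<exists>(X :: (nat \<Rightarrow> real) topology) (act :: 'a \<Rightarrow> (nat \<Rightarrow> real) \<Rightarrow> (nat \<Rightarrow> real)).
        compact_space X \<and> metrizable_space X \<and> topspace X \<noteq> {} \<and>
        homeo_action act X \<and> topologically_amenable act X)"

lemma compact_metrizable_inj:
  assumes "compact_space X" "metrizable_space X"
  shows "\<exists>j :: 'x \<Rightarrow> nat \<Rightarrow> real. inj_on j (topspace X)"
proof -
  obtain M d where M: "Metric_space M d" and X: "X = Metric_space.mtopology M d"
    using assms(2) unfolding metrizable_space_def by blast
  interpret Metric_space M d by (rule M)
  have "mtotally_bounded M"
    using assms(1) unfolding X by (simp add: compact_space_eq_mcomplete_mtotally_bounded)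
  then have "\<forall>n::nat. \<exists>K. finite K \<and> K \<subseteq> M \<and> M \<subseteq> (\<Union>x\<in>K. mball x (1 / Suc n))"
    unfolding mtotally_bounded_def by simp
  then obtain K where K: "\<And>n. finite (K n)" "\<And>n. K n \<subseteq> M"
      "\<And>n. M \<subseteq> (\<Union>x\<in>K n. mball x (1 / Suc n))"
    by metis
  define C where "C = (\<Union>n. K n)"
  have C: "countable C"
    unfolding C_def using K(1) by (auto intro: countable_finite)
  have "inj_on (\<lambda>x n. d x (from_nat_into C n)) M"
  proof (rule inj_onI, rule ccontr)
    fix x y assume xy: "x \<in> M" "y \<in> M" "x \<noteq> y"
      and eq: "(\<lambda>n. d x (from_nat_into C n)) = (\<lambda>n. d y (from_nat_into C n))"
    from xy have "d x y / 2 > 0" by simp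
    then obtain n where n: "1 / real (Suc n) < d x y / 2"
      using nat_approx_posE by blast
    obtain c where c: "c \<in> K n" "d c x < 1 / Suc n"
      using K(3) [of n] xy(1) by auto
    then have "c \<in> C" "c \<in> M" using K(2) by (auto simp: C_def)
    then obtain m where "from_nat_into C m = c"
      using C from_nat_into_surj by metis
    then have "d x c = d y c" using eq by metis
    moreover have "d x y \<le> d x c + d c y"
      using xy \<open>c \<in> M\<close> by (intro triangle)
    ultimately show False
      using c n commute [of c x] commute [of c y] by linarith
  qed
  then show ?thesis unfolding X by auto
qed

theorem exact_groupI:
  fixes X :: "'x topology" and act :: "'a::{group_add, countable} \<Rightarrow> 'x \<Rightarrow> 'x"
  assumes "compact_space X" "metrizable_space X" "topspace X \<noteq> {}"
    and act: "homeo_action act X" and amenable: "topologically_amenable act X"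
  shows "exact_group TYPE('a)"
proof -
  let ?S = "topspace X"
  obtain j :: "'x \<Rightarrow> nat \<Rightarrow> real" where j: "inj_on j ?S"
    using compact_metrizable_inj [OF assms(1,2)] by blast
  define i where "i = inv_into ?S j"
  define Y where "Y = pullback_topology (j ` ?S) i X"
  have ij [simp]: "i (j x) = x" if "x \<in> ?S" for x
    using j that by (simp add: i_def)
  have SY: "topspace Y = j ` ?S"
    unfolding Y_def topspace_pullback_topology by auto
  have "continuous_map X Y j"
    unfolding Y_def
  proof (rule continuous_map_pullback')
    show "continuous_map X X (i \<circ> j)"
      by (rule continuous_map_eq [where f = "\<lambda>x. x"]) auto
  qed auto
  moreover have "continuous_map Y X i"
    using continuous_map_pullback [where g = id and f = i and A = "j ` ?S", OF continuous_map_id]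
    by (simp add: Y_def)
  ultimately have hom: "homeomorphic_maps X Y j i"
    unfolding homeomorphic_maps_def SY by auto
  then have j_hom: "homeomorphic_map X Y j" and i_hom: "homeomorphic_map Y X i"
    by (auto simp: homeomorphic_maps_map)
  have homXY: "X homeomorphic_space Y"
    using hom homeomorphic_space_def by blast
  define act' where "act' = (\<lambda>g y. j (act g (i y)))"
  have act_in: "act g x \<in> ?S" if "x \<in> ?S" for g x
  proof -
    have "homeomorphic_map X X (act g)"
      using act unfolding homeo_action_def by blast
    then show ?thesis
      using that homeomorphic_imp_surjective_map by blast
  qed
  have "homeomorphic_map Y Y (act' g)" for g
  proof -
    have "homeomorphic_map Y Y (j \<circ> (act g \<circ> i))"
      using act unfolding homeo_action_def
      by (intro homeomorphic_map_compose [OF homeomorphic_map_compose [OF i_hom] j_hom]) blast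
    then show ?thesis by (simp add: act'_def o_def)
  qed
  then have 1: "homeo_action act' Y"
    using act act_in unfolding homeo_action_def SY by (simp add: act'_def)
  obtain \<eta> where \<eta>: "\<And>n. continuous_map X Prob_topology (\<eta> n)"
      "\<And>g. (\<lambda>n. SUP x\<in>?S. l1_dist (translate g (\<eta> n x)) (\<eta> n (act g x))) \<longlonglongrightarrow> 0"
    using amenable unfolding topologically_amenable_def by blast
  have "continuous_map Y Prob_topology (\<eta> n \<circ> i)" for n
    by (rule continuous_map_compose [OF homeomorphic_imp_continuous_map [OF i_hom] \<eta>(1)])
  moreover have "(\<lambda>n. SUP y\<in>topspace Y. l1_dist (translate g ((\<eta> n \<circ> i) y)) ((\<eta> n \<circ> i) (act' g y)))
      \<longlonglongrightarrow> 0" for g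
  proof -
    have "(SUP y\<in>topspace Y. l1_dist (translate g ((\<eta> n \<circ> i) y)) ((\<eta> n \<circ> i) (act' g y))) =
        (SUP x\<in>?S. l1_dist (translate g (\<eta> n x)) (\<eta> n (act g x)))" for n
      unfolding SY image_image
      by (intro arg_cong [where f = Sup] image_cong) (auto simp: act'_def act_in)
    then show ?thesis using \<eta>(2) by simp
  qed
  ultimately have 2: "topologically_amenable act' Y"
    unfolding topologically_amenable_def by (intro exI [of _ "\<lambda>n. \<eta> n \<circ> i"] conjI allI)
  have "compact_space Y" "metrizable_space Y" "topspace Y \<noteq> {}"
    using assms homXY homeomorphic_compact_space homeomorphic_metrizable_space SY by auto
  with 1 2 show ?thesis
    unfolding exact_group_def by blast
qed


section \<open>Invariant random equivalence relations\<close>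

text \<open>A relation on \<open>'a\<close> is a curried function \<open>'a \<Rightarrow> 'a \<Rightarrow> bool\<close>. The topology of that type is the
  iterated product topology with discrete factors \<open>bool\<close>, and \<open>borel\<close> is its Borel structure.\<close>

definition Eqrel :: "('a \<Rightarrow> 'a \<Rightarrow> bool) set" where
  "Eqrel = {r. equivp r}"

definition Eqrel_borel :: "('a \<Rightarrow> 'a \<Rightarrow> bool) measure" where
  "Eqrel_borel = restrict_space borel Eqrel"

definition shift :: "'a::group_add \<Rightarrow> ('a \<Rightarrow> 'a \<Rightarrow> bool) \<Rightarrow> ('a \<Rightarrow> 'a \<Rightarrow> bool)" where
  "shift g r = (\<lambda>h h'. r (- g + h) (- g + h'))"

lemma shift_measurable: "shift (g :: 'a::group_add) \<in> measurable Eqrel_borel Eqrel_borel"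
proof -
  have "continuous_on UNIV (shift g)"
    unfolding shift_def
  proof (rule continuous_on_coordinatewise_then_product, rule continuous_on_coordinatewise_then_product)
    fix h h'
    have "continuous_on UNIV (\<lambda>r :: 'a \<Rightarrow> 'a \<Rightarrow> bool. r (- g + h))"
      by (rule continuous_on_product_coordinates)
    then show "continuous_on UNIV (\<lambda>r :: 'a \<Rightarrow> 'a \<Rightarrow> bool. r (- g + h) (- g + h'))"
      by (rule continuous_on_product_then_coordinatewise)
  qed
  then have "shift g \<in> borel_measurable borel"
    by (rule borel_measurable_continuous_onI)
  moreover have "shift g r \<in> Eqrel" if "r \<in> Eqrel" for r
    using that unfolding Eqrel_def mem_Collect_eq equivp_reflp_symp_transp shift_def
    by (intro conjI reflpI sympI transpI) (blast dest: reflpD sympD transpD)+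
  ultimately show ?thesis
    unfolding Eqrel_borel_def
    by (intro measurable_restrict_space2 measurable_restrict_space1)
      (auto simp: space_restrict_space)
qed

definition eqclass :: "('a \<Rightarrow> 'a \<Rightarrow> bool) \<Rightarrow> 'a \<Rightarrow> 'a set" where
  "eqclass r g = {h. r g h}"

definition Prob_Eqrel :: "('a \<Rightarrow> 'a \<Rightarrow> bool) measure set" where
  "Prob_Eqrel = {\<rho>. sets \<rho> = sets Eqrel_borel \<and> prob_space \<rho>}"

definition weak_topology :: "('a \<Rightarrow> 'a \<Rightarrow> bool) measure topology" where
  "weak_topology = topology_generated_by
     {{\<rho> \<in> Prob_Eqrel. (\<integral>r. f r \<partial>\<rho>) \<in> U} | (f :: _ \<Rightarrow> real) U. continuous_on Eqrel f \<and> open U}"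

lemma topspace_weak_topology: "topspace weak_topology = Prob_Eqrel"
proof -
  have "Prob_Eqrel \<in> {{\<rho> \<in> Prob_Eqrel. (\<integral>r. f r \<partial>\<rho>) \<in> U} | (f :: _ \<Rightarrow> real) U.
      continuous_on Eqrel f \<and> open U}"
    by (rule CollectI, rule exI [of _ "\<lambda>_. 0"], rule exI [of _ UNIV]) simp
  then show ?thesis
    unfolding weak_topology_def topology_generated_by_topspace by blast
qed

definition IRE :: "('a::{group_add, countable} \<Rightarrow> 'a \<Rightarrow> bool) measure set" where
  "IRE = {\<rho> \<in> Prob_Eqrel. \<forall>g. distr \<rho> \<rho> (shift g) = \<rho>}"

definition IRE_topology :: "('a::{group_add, countable} \<Rightarrow> 'a \<Rightarrow> bool) measure topology" where
  "IRE_topology = subtopology weak_topology IRE"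

definition FIRE :: "('a::{group_add, countable} \<Rightarrow> 'a \<Rightarrow> bool) measure set" where
  "FIRE = {\<rho> \<in> IRE. AE r in \<rho>. \<forall>g. finite (eqclass r g)}"

definition AIRE :: "('a::{group_add, countable} \<Rightarrow> 'a \<Rightarrow> bool) measure set" where
  "AIRE = {\<rho> \<in> IRE. \<exists>lam :: nat \<Rightarrow> ('a \<Rightarrow> 'a \<Rightarrow> bool) \<Rightarrow> 'a pmf.
     (\<forall>n. lam n \<in> measurable Eqrel_borel Prob_borel) \<and>
     (AE r in \<rho>. \<forall>g\<in>eqclass r 0.
        (\<lambda>n. l1_dist (translate (- g) (lam n r)) (lam n (shift (- g) r))) \<longlonglongrightarrow> 0)}"

end

theory Submission
  imports Defs
begin

text \<open>
  \<open>AIRE \<subseteq> closure FIRE\<close>, for every group: an amenable IRE yields equivariant measures \<open>\<lambda>\<^sub>h\<close> on the group,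
  almost constant on classes. Give each group element \<open>k\<close> an independent uniform label \<open>U\<^sub>k\<close>, and cut
  the classes according to the random sets \<open>{k. U\<^sub>k \<le> N \<lambda>\<^sub>h(k)}\<close>. Related points rarely get different sets,
  and by mass transport each \<open>k\<close> lies in finitely many of them, so the pieces are finite.

  If the group is exact, any function \<open>h \<mapsto> \<eta>(h x\<^sub>0)\<close> along an orbit can be averaged over the finite
  classes of a finite IRE. The averages, as densities, have limits along a weakly convergent sequence of
  finite IREs, and the limit densities witness amenability.

  Conversely, suppose that property A fails. By a minimax argument, and by cutting weighted graphs into
  layers of comparable weight, there are \<open>\<epsilon> > 0\<close> and, for each finite \<open>B\<close>, a finite set \<open>V\<close> on which no
  function into the probability measures on \<open>B\<close> is \<open>\<epsilon>\<close>-almost invariant on average. Sparse random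
  translates of \<open>V\<close>, with the overlaps discarded, give finite IREs in which a fixed proportion \<open>\<delta>\<close> of the
  points lies in almost complete copies of \<open>V\<close>. An amenable limit as \<open>B\<close> exhausts the group would give,
  after approximating its measures by locally determined ones, almost invariant functions on such copies.
\<close>

subsection \<open>The \<open>l1\<close> distance\<close>

text \<open>Weak convergence controls only integrals of continuous functions on
  \<open>Eqrel\<close>, while kernels \<open>r \<mapsto> lam r\<close> are merely measurable. This
  obstacle shapes both arguments about limits. Class averages need not be continuous in
  \<open>r\<close>, so for exact groups they pass to the limit only through their integrals over
  cylinders. Almost invariance survives because, once signs are fixed, it is a countable family of
  linear inequalities between densities; compactness of the space acted on gives uniform tightness,
  which prevents the limit from losing mass. In the converse the witnesses of amenability must
  become local before the small asymmetry of the limit says anything about the approximating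
  relations. Counting measure on \<open>V\<close> is forced: by invariance the identity is equally
  likely to occupy each position of a random translate. Minimax, however, produces arbitrary weights
  on edges, and the layers bridge the two. The proportion \<open>\<delta>\<close> is a trade-off:
  copies of \<open>V\<close> yield asymmetry of first order, \<open>\<delta> * \<epsilon>\<close>,
  whereas overlaps destroy at most a second-order amount,
  \<open>4 * card S * \<delta> * \<delta>\<close>.\<close>

lemma l1_dist_nonneg [simp]: "0 \<le> l1_dist p q"
  using Metric_space.nonneg [OF Metric_space_l1_dist] .

lemma l1_dist_commute: "l1_dist p q = l1_dist q p"
  using Metric_space.commute [OF Metric_space_l1_dist] .

lemma l1_dist_triangle: "l1_dist p r \<le> l1_dist p q + l1_dist q r"
  using Metric_space.triangle [OF Metric_space_l1_dist] by blast

lemma l1_dist_self [simp]: "l1_dist p p = 0"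
  by (simp add: l1_dist_def)

lemma sum_le_l1_dist: "finite K \<Longrightarrow> (\<Sum>k\<in>K. \<bar>pmf p k - pmf q k\<bar>) \<le> l1_dist p q"
  unfolding l1_dist_def by (rule finite_sum_le_infsum) (auto intro: l1_summable_on)

lemma abs_pmf_diff_le_l1_dist: "\<bar>pmf p k - pmf q k\<bar> \<le> l1_dist p q"
  using sum_le_l1_dist [of "{k}" p q] by simp

lemma l1_dist_leI:
  assumes "\<And>K. finite K \<Longrightarrow> (\<Sum>k\<in>K. \<bar>pmf p k - pmf q k\<bar>) \<le> c"
  shows "l1_dist p q \<le> c"
  unfolding l1_dist_def by (rule infsum_le_finite_sums) (use assms in \<open>auto intro: l1_summable_on\<close>)

lemma l1_dist_finite_support:
  assumes "finite B" "set_pmf p \<subseteq> B" "set_pmf q \<subseteq> B"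
  shows "l1_dist p q = (\<Sum>k\<in>B. \<bar>pmf p k - pmf q k\<bar>)"
proof -
  have "l1_dist p q = infsum (\<lambda>k. \<bar>pmf p k - pmf q k\<bar>) B"
    unfolding l1_dist_def
  proof (rule infsum_cong_neutral)
    fix x assume "x \<in> UNIV - B"
    then have "x \<notin> set_pmf p" "x \<notin> set_pmf q" using assms(2,3) by auto
    then show "\<bar>pmf p x - pmf q x\<bar> = 0" by (simp add: set_pmf_iff)
  qed auto
  then show ?thesis using assms(1) by simp
qed

lemma sum_pmf_le_1: "finite K \<Longrightarrow> (\<Sum>k\<in>K. pmf p k) \<le> 1"
  by (simp flip: measure_measure_pmf_finite)

text \<open>Both tails outside \<open>F\<close> are controlled by data on \<open>F\<close>: the mass
  that \<open>q\<close> leaves outside \<open>F\<close> exceeds that of \<open>p\<close> by at most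
  the sum of the differences on \<open>F\<close>. This is the quantitative core of every reduction
  to finitely many coordinates.\<close>

lemma l1_dist_le_truncated:
  assumes F: "finite F"
  shows "l1_dist p q \<le> 2 * (\<Sum>k\<in>F. \<bar>pmf p k - pmf q k\<bar>) + 2 * (1 - (\<Sum>k\<in>F. pmf p k))"
proof (rule l1_dist_leI)
  fix K :: "'a set" assume K: "finite K"
  let ?d = "\<lambda>k. \<bar>pmf p k - pmf q k\<bar>"
  have tail: "(\<Sum>k\<in>K - F. pmf r k) + (\<Sum>k\<in>F. pmf r k) \<le> 1" for r
    using sum_pmf_le_1 [of "(K - F) \<union> F" r] K F by (subst sum.union_disjoint [symmetric]) auto
  have "sum ?d K = sum ?d (K \<inter> F) + sum ?d (K - F)"
    using K by (rule sum.Int_Diff)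
  also have "sum ?d (K \<inter> F) \<le> sum ?d F"
    by (rule sum_mono2) (use F in auto)
  also have "sum ?d (K - F) \<le> (\<Sum>k\<in>K - F. pmf p k) + (\<Sum>k\<in>K - F. pmf q k)"
    unfolding sum.distrib [symmetric]
  proof (rule sum_mono)
    show "?d k \<le> pmf p k + pmf q k" for k
      using pmf_nonneg [of p k] pmf_nonneg [of q k] by linarith
  qed
  moreover have "(\<Sum>k\<in>F. pmf p k) - (\<Sum>k\<in>F. pmf q k) \<le> sum ?d F"
    unfolding sum_subtractf [symmetric] by (rule sum_mono) simp
  ultimately show "sum ?d K \<le> 2 * sum ?d F + 2 * (1 - (\<Sum>k\<in>F. pmf p k))"
    using tail [of p] tail [of q] by simp
qed

lemma l1_dist_le_2: "l1_dist p q \<le> 2"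
  using l1_dist_le_truncated [of "{}" p q] by simp

lemma has_sum_pmf: "(pmf p has_sum 1) UNIV"
proof -
  have "Infinite_Set_Sum.abs_summable_on (pmf p) UNIV"
    unfolding Infinite_Set_Sum.abs_summable_on_def by (rule integrable_pmf)
  then have "infsum (pmf p) UNIV = 1"
    using infsetsum_infsum infsetsum_pmf_eq_1 by (metis subset_UNIV)
  with pmf_summable_on show ?thesis by (metis has_sum_infsum)
qed

lemma pmf_finite_mass:
  assumes "\<epsilon> > (0::real)"
  obtains F where "finite F" "1 - \<epsilon> < (\<Sum>k\<in>F. pmf p k)"
proof -
  have "\<exists>F. finite F \<and> 1 - \<epsilon> < (\<Sum>k\<in>F. pmf p k)"
  proof (rule ccontr)
    assume "\<not> ?thesis"
    then have "infsum (pmf p) UNIV \<le> 1 - \<epsilon>"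
      by (intro infsum_le_finite_sums pmf_summable_on) force
    with has_sum_pmf [of p] assms show False by (simp add: infsumI)
  qed
  then show ?thesis using that by blast
qed

lemma bij_plus_left: "bij ((+) (g :: 'a::group_add))"
proof (rule o_bij)
  show "(+) (- g) \<circ> (+) g = id" "(+) g \<circ> (+) (- g) = id"
    by (auto simp: fun_eq_iff simp flip: add.assoc)
qed

lemma l1_dist_translate: "l1_dist (translate g p) (translate g q) = l1_dist p q"
  unfolding l1_dist_def pmf_translate
  using infsum_reindex_bij_betw [OF bij_plus_left [of "- g"], of "\<lambda>h. \<bar>pmf p h - pmf q h\<bar>"] .

lemma translate_translate: "translate g (translate h p) = translate (g + h) p"
  by (simp add: translate_def pmf.map_comp o_def add.assoc)

lemma translate_0 [simp]: "translate 0 p = p"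
  by (simp add: translate_def)

lemma l1_dist_translate_left: "l1_dist (translate g p) q = l1_dist p (translate (- g) q)"
  using l1_dist_translate [of "- g" "translate g p" q] by (simp add: translate_translate)

lemma set_pmf_translate: "set_pmf (translate g p) = (+) g ` set_pmf p"
  by (simp add: translate_def)

text \<open>Scheffe's lemma: on \<open>Prob\<close> the \<open>l1\<close> topology is the topology of pointwise convergence.\<close>

lemma openin_Prob_topology_pmf:
  fixes U :: "'a::countable pmf set"
  assumes U: "openin Prob_topology U"
  obtains V where "open V" "U = pmf -` V"
proof
  interpret Metric_space UNIV "l1_dist :: 'a pmf \<Rightarrow> _" by (rule Metric_space_l1_dist)
  \<comment> \<open>The largest open candidate, so that only a neighbourhood of each single point of
    \<open>U\<close> has to be found.\<close>
  define V where "V = \<Union>{W. open W \<and> pmf -` W \<subseteq> U}"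
  show "open V" unfolding V_def by auto
  have "p \<in> pmf -` V" if p: "p \<in> U" for p
  proof -
    obtain \<epsilon> where \<epsilon>: "\<epsilon> > 0" "mball p \<epsilon> \<subseteq> U"
      using U p unfolding Prob_topology_def openin_mtopology by blast
    \<comment> \<open>The two factors 2 in \<open>l1_dist_le_truncated\<close> turn a bound
      \<open>\<epsilon>/4\<close> on the sum over \<open>F\<close> and on the mass outside
      \<open>F\<close> into \<open>\<epsilon>\<close>.\<close>
    obtain F where F: "finite F" "1 - \<epsilon>/4 < (\<Sum>k\<in>F. pmf p k)"
      using pmf_finite_mass [of "\<epsilon>/4" p] \<epsilon> by auto
    define W where "W = {f. (\<Sum>k\<in>F. \<bar>pmf p k - f k\<bar>) < \<epsilon>/4}"
    have "continuous_on UNIV (\<lambda>f::'a \<Rightarrow> real. (\<Sum>k\<in>F. \<bar>pmf p k - f k\<bar>))"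
      by (intro continuous_intros continuous_on_product_coordinates)
    then have "open W" unfolding W_def
      by (rule open_Collect_less [OF _ continuous_on_const])
    moreover have "q \<in> U" if "pmf q \<in> W" for q
    proof -
      have "l1_dist p q < \<epsilon>"
        using l1_dist_le_truncated [OF F(1), of p q] F(2) that by (simp add: W_def)
      then show ?thesis using \<epsilon>(2) by auto
    qed
    moreover have "pmf p \<in> W" using \<epsilon> by (simp add: W_def)
    ultimately show ?thesis unfolding V_def by blast
  qed
  then show "U = pmf -` V" unfolding V_def by blast
qed

lemma openin_Prob_topology_coordinate:
  assumes "open W"
  shows "openin Prob_topology {p. pmf p k \<in> W}"
proof -
  interpret Metric_space UNIV "l1_dist :: 'a pmf \<Rightarrow> _" by (rule Metric_space_l1_dist)
  show ?thesis
    unfolding Prob_topology_def openin_mtopology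
  proof (intro conjI allI impI)
    fix p :: "'a pmf" assume "p \<in> {p. pmf p k \<in> W}"
    then obtain e where "e > 0" "\<And>y. dist y (pmf p k) < e \<Longrightarrow> y \<in> W"
      using assms unfolding open_dist by auto
    then show "\<exists>r>0. mball p r \<subseteq> {p. pmf p k \<in> W}"
      using le_less_trans [OF abs_pmf_diff_le_l1_dist [of p k]]
      by (intro exI [of _ e]) (auto simp: dist_real_def abs_minus_commute)
  qed auto
qed

lemma topspace_Prob_topology [simp]: "topspace Prob_topology = UNIV"
  unfolding Prob_topology_def by (simp add: Metric_space.topspace_mtopology [OF Metric_space_l1_dist])

lemma continuous_map_Prob_topology:
  fixes f :: "'x \<Rightarrow> 'a::countable pmf"
  shows "continuous_map X Prob_topology f \<longleftrightarrow> (\<forall>k. continuous_map X euclideanreal (\<lambda>x. pmf (f x) k))"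
proof safe
  fix k assume f: "continuous_map X Prob_topology f"
  have "continuous_map Prob_topology euclideanreal (\<lambda>p :: 'a pmf. pmf p k)"
    unfolding continuous_map using openin_Prob_topology_coordinate [of _ k]
    by (auto simp flip: open_openin)
  from continuous_map_compose [OF f this]
  show "continuous_map X euclideanreal (\<lambda>x. pmf (f x) k)" by (simp add: o_def)
next
  assume "\<forall>k. continuous_map X euclideanreal (\<lambda>x. pmf (f x) k)"
  then have *: "continuous_map X euclidean (\<lambda>x. pmf (f x))"
    unfolding euclidean_product_topology [symmetric] continuous_map_componentwise_UNIV by blast
  have "openin X {x \<in> topspace X. f x \<in> U}" if U: "openin Prob_topology U" for U
  proof -
    obtain V where V: "open V" "U = pmf -` V" using U openin_Prob_topology_pmf by blast
    then have "openin X {x \<in> topspace X. pmf (f x) \<in> V}"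
      using * by (intro openin_continuous_map_preimage) (auto simp flip: open_openin)
    then show ?thesis using V(2) by simp
  qed
  then show "continuous_map X Prob_topology f"
    unfolding continuous_map by auto
qed

lemma space_Prob_borel [simp]: "space Prob_borel = UNIV"
  by (simp add: Prob_borel_def space_measure_of_conv)

lemma measurable_Prob_borel_iff:
  fixes f :: "'x \<Rightarrow> 'a::countable pmf"
  shows "f \<in> measurable M Prob_borel \<longleftrightarrow> (\<forall>k. (\<lambda>x. pmf (f x) k) \<in> borel_measurable M)"
proof safe
  fix k assume f: "f \<in> measurable M Prob_borel"
  show "(\<lambda>x. pmf (f x) k) \<in> borel_measurable M"
  proof (rule borel_measurableI)
    fix S :: "real set" assume "open S"
    then have "{p. pmf p k \<in> S} \<in> sets Prob_borel"
      unfolding Prob_borel_def using openin_Prob_topology_coordinate [of S k] by auto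
    with f have "f -` {p. pmf p k \<in> S} \<inter> space M \<in> sets M"
      by (rule measurable_sets)
    then show "(\<lambda>x. pmf (f x) k) -` S \<inter> space M \<in> sets M" by (simp add: vimage_def)
  qed
next
  assume "\<forall>k. (\<lambda>x. pmf (f x) k) \<in> borel_measurable M"
  then have *: "(\<lambda>x. pmf (f x)) \<in> borel_measurable M"
    by (intro measurable_coordinatewise_then_product) auto
  show "f \<in> measurable M Prob_borel"
    unfolding Prob_borel_def
  proof (rule measurable_measure_of)
    fix U assume "U \<in> {U. openin Prob_topology (U :: 'a pmf set)}"
    then obtain V where V: "open V" "U = pmf -` V" using openin_Prob_topology_pmf by blast
    then have "(\<lambda>x. pmf (f x)) -` V \<inter> space M \<in> sets M"
      using * by (intro measurable_sets [OF *]) auto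
    then show "f -` U \<inter> space M \<in> sets M" using V by (simp add: vimage_def)
  qed auto
qed

text \<open>The distance is the supremum of its finite partial sums, and a countable type has only
  countably many finite subsets, so each sublevel set is a countable intersection.\<close>

lemma borel_measurable_l1_dist [measurable]:
  fixes f g :: "'x \<Rightarrow> 'a::countable pmf"
  assumes "f \<in> measurable M Prob_borel" "g \<in> measurable M Prob_borel"
  shows "(\<lambda>x. l1_dist (f x) (g x)) \<in> borel_measurable M"
proof -
  have [measurable]: "(\<lambda>x. pmf (f x) k) \<in> borel_measurable M" "(\<lambda>x. pmf (g x) k) \<in> borel_measurable M" for k
    using assms by (auto simp: measurable_Prob_borel_iff)
  have "{x \<in> space M. l1_dist (f x) (g x) \<le> a} =
      {x \<in> space M. \<forall>K\<in>Collect finite. (\<Sum>k\<in>K. \<bar>pmf (f x) k - pmf (g x) k\<bar>) \<le> a}" for a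
    by (auto intro: l1_dist_leI order_trans [OF sum_le_l1_dist])
  moreover have "{x \<in> space M. \<forall>K\<in>Collect finite. (\<Sum>k\<in>K. \<bar>pmf (f x) k - pmf (g x) k\<bar>) \<le> a}
      \<in> sets M" for a
  proof -
    have "countable (Collect finite :: 'a set set)" by (rule countable_Collect_finite)
    then have "Measurable.pred M (\<lambda>x. \<forall>K\<in>Collect finite. (\<Sum>k\<in>K. \<bar>pmf (f x) k - pmf (g x) k\<bar>) \<le> a)"
      by measurable
    then show ?thesis by (simp add: pred_def)
  qed
  ultimately show ?thesis by (simp add: borel_measurable_iff_le)
qed

lemma measurable_translate [measurable]:
  fixes f :: "'x \<Rightarrow> 'a::{countable, group_add} pmf"
  assumes "f \<in> measurable M Prob_borel"
  shows "(\<lambda>x. translate g (f x)) \<in> measurable M Prob_borel"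
  using assms by (auto simp: measurable_Prob_borel_iff pmf_translate)

definition to_pmf :: "('a \<Rightarrow> real) \<Rightarrow> 'a pmf" where
  "to_pmf f = (SOME p. pmf p = f)"

lemma pmf_to_pmf:
  assumes "\<And>k. 0 \<le> f k" "(f has_sum 1) UNIV"
  shows "pmf (to_pmf f) = f"
proof -
  have "integrable (count_space UNIV) f"
    using assms unfolding Infinite_Set_Sum.abs_summable_on_def [symmetric] abs_summable_equivalent [symmetric]
    by (auto intro: has_sum_imp_summable)
  then have "(\<integral>\<^sup>+x. ennreal (f x) \<partial>count_space UNIV) = ennreal (infsum f UNIV)"
    using assms(1) by (subst nn_integral_conv_infsetsum)
      (auto simp: infsetsum_infsum Infinite_Set_Sum.abs_summable_on_def)
  also have "\<dots> = 1" using assms(2) by (simp add: infsumI)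
  finally have "pmf (embed_pmf f) = f"
    using assms(1) by (intro ext pmf_embed_pmf)
  then show ?thesis unfolding to_pmf_def by (rule someI)
qed

lemma pmf_to_pmf_finite:
  assumes "\<And>k. 0 \<le> f k" "finite B" "\<And>k. k \<notin> B \<Longrightarrow> f k = 0" "(\<Sum>k\<in>B. f k) = 1"
  shows "pmf (to_pmf f) = f" "set_pmf (to_pmf f) \<subseteq> B"
proof -
  have "(f has_sum 1) B"
    using assms(2,4) by (metis has_sum_finite)
  then have "(f has_sum 1) UNIV"
    by (rule has_sum_cong_neutral [THEN iffD1, rotated -1]) (use assms(3) in auto)
  then show *: "pmf (to_pmf f) = f" using assms(1) by (intro pmf_to_pmf)
  then show "set_pmf (to_pmf f) \<subseteq> B" using assms(3) by (auto simp: set_pmf_eq)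
qed

subsection \<open>Cylinder sets of equivalence relations\<close>

text \<open>The restriction of \<open>r\<close> to \<open>F\<close> is coded by the set of related
  pairs, so the possible patterns form the finite set \<open>Pow F\<close> when \<open>F\<close> is
  finite.\<close>

definition window :: "('a \<times> 'a) set \<Rightarrow> ('a \<Rightarrow> 'a \<Rightarrow> bool) \<Rightarrow> ('a \<times> 'a) set" where
  "window F r = {x \<in> F. r (fst x) (snd x)}"

text \<open>For finite \<open>F\<close> these are the locally constant functions on the compact
  space \<open>Eqrel\<close>; they are the test functions for all limits below.\<close>

definition local_on :: "('a \<times> 'a) set \<Rightarrow> (('a \<Rightarrow> 'a \<Rightarrow> bool) \<Rightarrow> 'b) \<Rightarrow> bool" where
  "local_on F f \<longleftrightarrow> (\<forall>r\<in>Eqrel. \<forall>r'\<in>Eqrel. window F r = window F r' \<longrightarrow> f r = f r')"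

definition cylinders :: "('a \<Rightarrow> 'a \<Rightarrow> bool) set set" where
  "cylinders = {A. A \<subseteq> Eqrel \<and> (\<exists>F. finite F \<and> local_on F (\<lambda>r. r \<in> A))}"

lemma window_eq_iff: "window F r = window F r' \<longleftrightarrow> (\<forall>(a, b)\<in>F. r a b = r' a b)"
  by (auto simp: window_def set_eq_iff)

lemma local_on_mono: "local_on F f \<Longrightarrow> F \<subseteq> G \<Longrightarrow> local_on G f"
  unfolding local_on_def window_eq_iff by blast

lemma local_onD: "local_on F f \<Longrightarrow> r \<in> Eqrel \<Longrightarrow> r' \<in> Eqrel \<Longrightarrow> window F r = window F r' \<Longrightarrow> f r = f r'"
  unfolding local_on_def by blast

lemma local_on_comp: "local_on F f \<Longrightarrow> local_on F (\<lambda>r. g (f r))"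
  unfolding local_on_def by metis

lemma local_on_comp2: "local_on F f \<Longrightarrow> local_on G g \<Longrightarrow> local_on (F \<union> G) (\<lambda>r. h (f r) (g r))"
  using local_onD [OF local_on_mono [of F f "F \<union> G"]] local_onD [OF local_on_mono [of G g "F \<union> G"]]
  unfolding local_on_def by (metis Un_upper1 Un_upper2)

lemma local_on_const: "local_on F (\<lambda>r. c)"
  by (simp add: local_on_def)

lemma local_on_coordinate: "local_on {(a, b)} (\<lambda>r. r a b)"
  by (simp add: local_on_def window_eq_iff)

lemma local_on_sum:
  fixes f :: "'i \<Rightarrow> ('c \<Rightarrow> 'c \<Rightarrow> bool) \<Rightarrow> 'b::comm_monoid_add"
  assumes "\<And>i. i \<in> I \<Longrightarrow> local_on F (f i)"
  shows "local_on F (\<lambda>r. \<Sum>i\<in>I. f i r)"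
  unfolding local_on_def
proof (intro ballI impI)
  fix r r' :: "'c \<Rightarrow> 'c \<Rightarrow> bool"
  assume r: "r \<in> Eqrel" "r' \<in> Eqrel" "window F r = window F r'"
  show "(\<Sum>i\<in>I. f i r) = (\<Sum>i\<in>I. f i r')"
  proof (rule sum.cong)
    fix i assume "i \<in> I"
    from local_onD [OF assms [OF this] r] show "f i r = f i r'" .
  qed simp
qed

lemma local_on_shift:
  assumes "local_on F f"
  shows "local_on ((\<lambda>(a, b). (- g + a, - g + b)) ` F) (\<lambda>r. f (shift (g :: 'a::group_add) r))"
proof -
  have "shift g r \<in> Eqrel" if "r \<in> Eqrel" for r
    using measurable_space [OF shift_measurable, of r g] that
    by (simp add: Eqrel_borel_def space_restrict_space)
  moreover have "window F (shift g r) = window F (shift g r')"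
    if "window ((\<lambda>(a, b). (- g + a, - g + b)) ` F) r = window ((\<lambda>(a, b). (- g + a, - g + b)) ` F) r'" for r r'
    using that unfolding window_eq_iff shift_def ball_simps by (simp add: case_prod_beta)
  ultimately show ?thesis
    unfolding local_on_def by (intro ballI impI local_onD [OF assms])
qed

lemma local_on_finite_image:
  assumes "finite F" "local_on F f"
  shows "finite (f ` Eqrel)"
proof -
  define g where "g w = f (SOME r. r \<in> Eqrel \<and> window F r = w)" for w
  have "f r = g (window F r)" if "r \<in> Eqrel" for r
  proof -
    have "(SOME r'. r' \<in> Eqrel \<and> window F r' = window F r) \<in> Eqrel \<and>
      window F (SOME r'. r' \<in> Eqrel \<and> window F r' = window F r) = window F r"
      by (rule someI [of _ r]) (use that in auto)
    then show ?thesis unfolding g_def using that by (intro local_onD [OF assms(2)]) auto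
  qed
  moreover have "window F r \<in> Pow F" for r by (auto simp: window_def)
  ultimately have "f ` Eqrel \<subseteq> g ` Pow F" by blast
  then show ?thesis using assms(1) finite_subset by blast
qed

lemma cylindersI: "finite F \<Longrightarrow> local_on F P \<Longrightarrow> {r \<in> Eqrel. P r} \<in> cylinders"
proof -
  assume F: "finite F" "local_on F P"
  have "local_on F (\<lambda>r. r \<in> {r \<in> Eqrel. P r})"
    unfolding local_on_def
  proof (intro ballI impI)
    fix r r' :: "'a \<Rightarrow> 'a \<Rightarrow> bool"
    assume r: "r \<in> Eqrel" "r' \<in> Eqrel" "window F r = window F r'"
    with local_onD [OF F(2) r] show "(r \<in> {r \<in> Eqrel. P r}) = (r' \<in> {r \<in> Eqrel. P r})" by blast
  qed
  with F(1) show ?thesis unfolding cylinders_def by blast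
qed

lemma cylindersE:
  assumes "A \<in> cylinders"
  obtains F where "finite F" "local_on F (\<lambda>r. r \<in> A)" "A \<subseteq> Eqrel"
  using assms unfolding cylinders_def by blast

lemma coordinate_cylinder: "{r \<in> Eqrel. r a b} \<in> cylinders"
  by (rule cylindersI [where F = "{(a, b)}" and P = "\<lambda>r. r a b"]) (simp_all add: local_on_coordinate)

lemma algebra_cylinders: "algebra Eqrel cylinders"
proof (rule algebra_iff_Un [THEN iffD2], intro conjI ballI)
  show "cylinders \<subseteq> Pow Eqrel" by (auto simp: cylinders_def)
  show "{} \<in> cylinders" using cylindersI [of "{}" "\<lambda>_. False"] by (simp add: local_on_const)
  fix A :: "('a \<Rightarrow> 'a \<Rightarrow> bool) set" assume A: "A \<in> cylinders"
  then obtain F where F: "finite F" "local_on F (\<lambda>r. r \<in> A)" "A \<subseteq> Eqrel" by (rule cylindersE)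
  show "Eqrel - A \<in> cylinders"
    using cylindersI [OF F(1) local_on_comp [OF F(2), of Not]] by (simp add: set_diff_eq)
  fix B :: "('a \<Rightarrow> 'a \<Rightarrow> bool) set" assume B: "B \<in> cylinders"
  then obtain G where G: "finite G" "local_on G (\<lambda>r. r \<in> B)" "B \<subseteq> Eqrel" by (rule cylindersE)
  have "A \<union> B = {r \<in> Eqrel. r \<in> A \<or> r \<in> B}" using F G by auto
  then show "A \<union> B \<in> cylinders"
    using cylindersI [OF _ local_on_comp2 [OF F(2) G(2), of "(\<or>)"]] F(1) G(1) by simp
qed

interpretation cyl: algebra Eqrel "cylinders :: ('a \<Rightarrow> 'a \<Rightarrow> bool) set set"
  by (rule algebra_cylinders)

text \<open>A cylinder is coded by a finite window and a set of patterns on it. Countability lets a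
  single subsequence converge on all cylinders at once.\<close>

lemma countable_cylinders: "countable (cylinders :: ('a::countable \<Rightarrow> 'a \<Rightarrow> bool) set set)"
proof -
  let ?f = "\<lambda>(F :: ('a \<times> 'a) set, W). {r \<in> Eqrel. window F r \<in> W}"
  let ?D = "Sigma (Collect finite) (\<lambda>F :: ('a \<times> 'a) set. Pow (Pow F))"
  have "A \<in> ?f ` ?D" if A: "A \<in> cylinders" for A
  proof -
    obtain F where F: "finite F" "local_on F (\<lambda>r. r \<in> A)" "A \<subseteq> Eqrel" using A by (rule cylindersE)
    then have "A = ?f (F, window F ` A)"
      by (auto simp: local_on_def)
    moreover have "(F, window F ` A) \<in> ?D" using F(1) by (auto simp: window_def)
    ultimately show ?thesis by blast
  qed
  moreover have "countable ?D"
    by (intro countable_SIGMA countable_Collect_finite) (auto intro: countable_finite)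
  ultimately show ?thesis
    by (meson countable_image countable_subset subsetI)
qed

lemma space_Eqrel_borel [simp]: "space Eqrel_borel = Eqrel"
  by (simp add: Eqrel_borel_def space_restrict_space)

lemma shift_vimage_cylinder:
  assumes "C \<in> cylinders"
  shows "shift (g :: 'a::group_add) -` C \<inter> Eqrel \<in> cylinders"
proof -
  obtain F where F: "finite F" "local_on F (\<lambda>r. r \<in> C)" using assms by (rule cylindersE)
  have "{r \<in> Eqrel. shift g r \<in> C} \<in> cylinders"
    by (rule cylindersI [OF _ local_on_shift [OF F(2)]]) (use F(1) in auto)
  also have "{r \<in> Eqrel. shift g r \<in> C} = shift g -` C \<inter> Eqrel" by auto
  finally show ?thesis .
qed

section \<open>Topology of the space of equivalence relations\<close>

lemma continuous_on_relation_coordinate: "continuous_on UNIV (\<lambda>r :: 'a \<Rightarrow> 'a \<Rightarrow> bool. r a b)"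
  by (rule continuous_on_product_then_coordinatewise [OF continuous_on_product_coordinates])

lemma open_relation_coordinate: "open {r :: 'a \<Rightarrow> 'a \<Rightarrow> bool. r a b = c}"
proof -
  have "open ((\<lambda>r :: 'a \<Rightarrow> 'a \<Rightarrow> bool. r a b) -` {c})"
    by (intro open_vimage continuous_on_relation_coordinate) (rule Topological_Spaces.open_discrete)
  then show ?thesis by (simp add: vimage_def)
qed

lemma open_window: 
  assumes "finite F" shows "open {r :: 'a \<Rightarrow> 'a \<Rightarrow> bool. window F r = W}"
proof (cases "W \<subseteq> F")
  case True
  have "{r. window F r = W} = (\<Inter>x\<in>F. {r. r (fst x) (snd x) = (x \<in> W)})"
    using True by (auto simp: window_def)
  then show ?thesis using assms by (simp add: open_INT open_relation_coordinate)
next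
  case False
  then have "{r. window F r = W} = {}" by (auto simp: window_def)
  then show ?thesis by simp
qed

lemma local_on_openin:
  assumes "finite F" "local_on F P"
  shows "openin (top_of_set Eqrel) {r \<in> Eqrel. P r}"
proof -
  have "{r \<in> Eqrel. P r} = Eqrel \<inter> (\<Union>s\<in>{s \<in> Eqrel. P s}. {r. window F r = window F s})"
    using assms(2) by (auto simp: local_on_def)
  also have "openin (top_of_set Eqrel) \<dots>"
    by (intro openin_open_Int open_UN ballI open_window assms(1))
  finally show ?thesis .
qed

lemma local_on_continuous:
  fixes f :: "('a \<Rightarrow> 'a \<Rightarrow> bool) \<Rightarrow> 'b::topological_space"
  assumes "finite F" "local_on F f"
  shows "continuous_on Eqrel f"
proof (subst continuous_on_open_gen [where T = UNIV])
  have "openin (top_of_set Eqrel) (Eqrel \<inter> f -` U)" for U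
    using local_on_openin [OF assms(1) local_on_comp [OF assms(2), of "\<lambda>y. y \<in> U"]]
    by (simp add: Int_def)
  then show "\<forall>U. openin (top_of_set UNIV) U \<longrightarrow> openin (top_of_set Eqrel) (Eqrel \<inter> f -` U)"
    by blast
qed auto

lemma closed_Eqrel: "closed (Eqrel :: ('a \<Rightarrow> 'a \<Rightarrow> bool) set)"
proof -
  have cl: "closed {r :: 'a \<Rightarrow> 'a \<Rightarrow> bool. r a b}" and op: "open {r :: 'a \<Rightarrow> 'a \<Rightarrow> bool. r a b}" for a b
    using open_relation_coordinate [of a b True] open_relation_coordinate [of a b False]
    by (simp_all add: closed_def Collect_neg_eq [symmetric])
  have "Eqrel = {r :: 'a \<Rightarrow> 'a \<Rightarrow> bool. (\<forall>x. r x x) \<and> (\<forall>x y. r x y \<longrightarrow> r y x) \<and>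
      (\<forall>x y z. r x y \<longrightarrow> r y z \<longrightarrow> r x z)}"
    unfolding Eqrel_def equivp_reflp_symp_transp reflp_def symp_def transp_def by blast
  also have "closed \<dots>"
    by (intro closed_Collect_conj closed_Collect_all closed_Collect_imp cl op)
  finally show ?thesis .
qed

lemma compact_Eqrel: "compact (Eqrel :: ('a \<Rightarrow> 'a \<Rightarrow> bool) set)"
proof -
  have "compact (UNIV :: bool set)" by (rule finite_imp_compact) simp
  then have "compact_space (euclidean :: bool topology)"
    unfolding compact_space_def by simp
  then have "compact_space (product_topology (\<lambda>_ :: 'a. euclidean :: bool topology) UNIV)"
    unfolding compact_space_product_topology by blast
  then have "compact_space (euclidean :: ('a \<Rightarrow> bool) topology)"
    by (simp add: euclidean_product_topology)
  then have "compact_space (product_topology (\<lambda>_ :: 'a. euclidean :: ('a \<Rightarrow> bool) topology) UNIV)"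
    unfolding compact_space_product_topology by blast
  then have "compact (UNIV :: ('a \<Rightarrow> 'a \<Rightarrow> bool) set)"
    unfolding euclidean_product_topology by (simp add: compact_space_def)
  then show ?thesis using closed_Eqrel compact_Int_closed by fastforce
qed

text \<open>The complements are relatively open and cover the compact space \<open>Eqrel\<close>.
  Finitely many of them suffice, and the member of the decreasing sequence with the largest of these
  indices avoids them all.\<close>

lemma decseq_cylinders_empty:
  assumes A: "range A \<subseteq> cylinders" "decseq A" "(\<Inter>i. A i) = {}"
  obtains n where "A n = {}"
proof -
  have op: "openin (top_of_set Eqrel) (Eqrel - A n)" for n
  proof -
    have "Eqrel - A n \<in> cylinders" using A(1) by blast
    then obtain F where F: "finite F" "local_on F (\<lambda>r. r \<in> Eqrel - A n)" by (rule cylindersE)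
    show ?thesis using local_on_openin [OF F] by (simp add: set_diff_eq)
  qed
  have "\<exists>T. open T \<and> Eqrel - A n = Eqrel \<inter> T" for n
    using op [of n] unfolding openin_open by blast
  then obtain T where T: "\<And>n. open (T n)" "\<And>n. Eqrel - A n = Eqrel \<inter> T n" by metis
  have "Eqrel \<subseteq> (\<Union>n\<in>UNIV. T n)"
  proof
    fix r :: "'a \<Rightarrow> 'a \<Rightarrow> bool" assume "r \<in> Eqrel"
    moreover obtain n where "r \<notin> A n" using A(3) by fastforce
    ultimately have "r \<in> Eqrel \<inter> T n" unfolding T(2) [symmetric] by simp
    then show "r \<in> (\<Union>n\<in>UNIV. T n)" by blast
  qed
  then obtain C where C: "finite C" "Eqrel \<subseteq> (\<Union>n\<in>C. T n)"
    using compactE_image [OF compact_Eqrel, of UNIV T] T(1) by metis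
  define N where "N = Max (insert 0 C)"
  have "A N \<subseteq> A n" if "n \<in> C" for n
    using A(2) by (rule decseqD) (use C(1) that in \<open>simp add: N_def\<close>)
  moreover have "A N \<subseteq> Eqrel" using A(1) unfolding cylinders_def by blast
  moreover have "A n \<inter> T n \<inter> Eqrel = {}" for n using T(2) [of n] by blast
  ultimately have "A N = {}" using C(2) by blast
  then show ?thesis by (rule that)
qed

section \<open>Borel sets and measures determined by cylinders\<close>

text \<open>Second countability of the factors makes measurability into a countable product a
  coordinatewise condition.\<close>

instance bool :: second_countable_topology
proof
  show "\<exists>B::bool set set. countable B \<and> open = generate_topology B"
    using open_bool_def by (metis (no_types) countable_finite finite)
qed

lemma measurable_Eqrel_borelI:
  fixes f :: "'x \<Rightarrow> 'a::countable \<Rightarrow> 'a \<Rightarrow> bool"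
  assumes "\<And>x. x \<in> space M \<Longrightarrow> f x \<in> Eqrel" and f: "\<And>a b. Measurable.pred M (\<lambda>x. f x a b)"
  shows "f \<in> measurable M Eqrel_borel"
proof -
  have bool: "(\<lambda>x. f x a b) \<in> borel_measurable M" for a b
  proof (rule borel_measurableI)
    fix S :: "bool set"
    show "(\<lambda>x. f x a b) -` S \<inter> space M \<in> sets M"
      using measurable_sets [OF f] by simp
  qed
  have "f \<in> borel_measurable M"
    by (rule measurable_coordinatewise_then_product, rule measurable_coordinatewise_then_product, rule bool)
  then show ?thesis
    unfolding Eqrel_borel_def using assms(1) by (intro measurable_restrict_space2) auto
qed

lemma cylinders_subset_sets: "cylinders \<subseteq> sets Eqrel_borel"
proof
  fix A :: "('a \<Rightarrow> 'a \<Rightarrow> bool) set" assume "A \<in> cylinders"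
  then obtain F where F: "finite F" "local_on F (\<lambda>r. r \<in> A)" "A \<subseteq> Eqrel" by (rule cylindersE)
  obtain T where T: "open T" "{r \<in> Eqrel. r \<in> A} = Eqrel \<inter> T"
    using local_on_openin [OF F(1,2)] unfolding openin_open by blast
  then have "A = Eqrel \<inter> T" using F(3) by auto
  then show "A \<in> sets Eqrel_borel"
    unfolding Eqrel_borel_def sets_restrict_space using borel_open [OF T(1)] by (rule image_eqI)
qed

text \<open>The substantial inclusion is measurability of the identity map from the generated
  sigma-algebra to the Borel one, which only has to be tested on single coordinates.\<close>

lemma sets_Eqrel_borel:
  "sets (Eqrel_borel :: ('a::countable \<Rightarrow> 'a \<Rightarrow> bool) measure) = sigma_sets Eqrel cylinders"
proof
  let ?M = "sigma Eqrel (cylinders :: ('a \<Rightarrow> 'a \<Rightarrow> bool) set set)"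
  have sp: "space ?M = Eqrel" and st: "sets ?M = sigma_sets Eqrel cylinders"
    by (simp_all add: space_measure_of_conv sets_measure_of [OF cyl.space_closed])
  have "(\<lambda>r. r) \<in> measurable ?M (Eqrel_borel :: ('a \<Rightarrow> 'a \<Rightarrow> bool) measure)"
  proof (rule measurable_Eqrel_borelI)
    show "Measurable.pred ?M (\<lambda>r. r a b)" for a b
      unfolding pred_def sp st by (rule sigma_sets.Basic) (rule coordinate_cylinder)
  qed (simp only: sp)
  then have "A \<in> sigma_sets Eqrel cylinders" if "A \<in> sets Eqrel_borel" for A :: "('a \<Rightarrow> 'a \<Rightarrow> bool) set"
    using measurable_sets [OF _ that, of "\<lambda>r. r" ?M] sets.sets_into_space [OF that]
    by (simp add: sp st vimage_def Int_absorb2)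
  then show "sets Eqrel_borel \<subseteq> sigma_sets Eqrel (cylinders :: ('a \<Rightarrow> 'a \<Rightarrow> bool) set set)" by blast
  show "sigma_sets Eqrel cylinders \<subseteq> sets (Eqrel_borel :: ('a \<Rightarrow> 'a \<Rightarrow> bool) measure)"
    using sets.sigma_sets_subset [OF cylinders_subset_sets] by simp
qed

lemma Eqrel_measure_eqI:
  fixes \<mu> \<nu> :: "('a::countable \<Rightarrow> 'a \<Rightarrow> bool) measure"
  assumes "sets \<mu> = sets Eqrel_borel" "sets \<nu> = sets Eqrel_borel" "finite_measure \<mu>"
    and "\<And>C. C \<in> cylinders \<Longrightarrow> emeasure \<mu> C = emeasure \<nu> C"
  shows "\<mu> = \<nu>"
proof (rule measure_eqI_generator_eq)
  show "Int_stable (cylinders :: ('a \<Rightarrow> 'a \<Rightarrow> bool) set set)"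
    unfolding Int_stable_def by (intro ballI cyl.Int)
  show "cylinders \<subseteq> Pow (Eqrel :: ('a \<Rightarrow> 'a \<Rightarrow> bool) set)" by (rule cyl.space_closed)
  show "sets \<mu> = sigma_sets Eqrel cylinders" "sets \<nu> = sigma_sets Eqrel cylinders"
    unfolding assms(1,2) by (fact sets_Eqrel_borel)+
  show "emeasure \<mu> ((\<lambda>_. Eqrel) i) \<noteq> \<infinity>" for i :: nat
    using assms(3) by (simp add: finite_measure.emeasure_finite)
  show "range (\<lambda>_. Eqrel) \<subseteq> cylinders" using cyl.top by (rule image_subsetI)
  show "emeasure \<mu> C = emeasure \<nu> C" if "C \<in> cylinders" for C using that by (rule assms(4))
qed simp

text \<open>Countable additivity is automatic because a decreasing sequence of nonempty cylinders has
  nonempty intersection, by compactness.\<close>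

lemma Eqrel_measure_extension:
  fixes \<psi> :: "('a::countable \<Rightarrow> 'a \<Rightarrow> bool) set \<Rightarrow> real"
  assumes nonneg: "\<And>C. C \<in> cylinders \<Longrightarrow> 0 \<le> \<psi> C"
    and add: "\<And>C D. C \<in> cylinders \<Longrightarrow> D \<in> cylinders \<Longrightarrow> C \<inter> D = {} \<Longrightarrow> \<psi> (C \<union> D) = \<psi> C + \<psi> D"
  obtains \<mu> where "finite_measure \<mu>" "sets \<mu> = sets Eqrel_borel" "\<And>C. C \<in> cylinders \<Longrightarrow> measure \<mu> C = \<psi> C"
proof -
  let ?f = "\<lambda>C. ennreal (\<psi> C)"
  have psi0: "\<psi> {} = 0" using add [of "{}" "{}"] cyl.empty_sets by simp
  have "\<exists>\<mu>. (\<forall>C\<in>cylinders. \<mu> C = ?f C) \<and> measure_space Eqrel (sigma_sets Eqrel cylinders) \<mu>"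
  proof (intro cyl.caratheodory_empty_continuous)
    show "positive cylinders ?f" using psi0 by (simp add: positive_def)
    show "additive cylinders ?f"
      unfolding additive_def using add nonneg by (simp add: ennreal_plus)
    fix A :: "nat \<Rightarrow> ('a \<Rightarrow> 'a \<Rightarrow> bool) set"
    assume A: "range A \<subseteq> cylinders" "decseq A" "(\<Inter>i. A i) = {}"
    then obtain n where "A n = {}" by (rule decseq_cylinders_empty)
    then have "?f (A m) = 0" if "m \<ge> n" for m
      using decseqD [OF A(2) that] psi0 by simp
    then show "(\<lambda>i. ?f (A i)) \<longlonglongrightarrow> 0"
      by (intro tendsto_eventually) (auto simp: eventually_sequentially)
  qed simp
  then obtain \<mu> where \<mu>: "\<And>C. C \<in> cylinders \<Longrightarrow> \<mu> C = ?f C"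
    and ms: "measure_space Eqrel (sigma_sets Eqrel cylinders) \<mu>" by blast
  define M where "M = measure_of Eqrel cylinders \<mu>"
  have sp: "space M = Eqrel" and st: "sets M = sets Eqrel_borel"
    by (simp_all add: M_def sets_Eqrel_borel space_measure_of_conv sets_measure_of [OF cyl.space_closed])
  have em: "emeasure M C = ?f C" if "C \<in> cylinders" for C
  proof -
    have "C \<in> sets M" using that cylinders_subset_sets st by blast
    moreover have "positive (sets M) \<mu>" "countably_additive (sets M) \<mu>"
      using ms unfolding st sets_Eqrel_borel measure_space_def by blast+
    ultimately have "emeasure M C = \<mu> C"
      by (intro emeasure_measure_of [OF M_def cyl.space_closed])
    with \<mu> that show ?thesis by simp
  qed
  have "finite_measure M"
    by (rule finite_measureI) (simp add: sp em)
  moreover have "measure M C = \<psi> C" if "C \<in> cylinders" for C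
    using em [OF that] nonneg [OF that] by (simp add: measure_def)
  ultimately show ?thesis using that st by blast
qed

text \<open>The sets that cylinders approximate form a sigma-algebra. Two measures are treated
  simultaneously so that they can be compared on one and the same cylinder.\<close>

lemma Eqrel_measure_approx:
  fixes \<mu> \<nu> :: "('a::countable \<Rightarrow> 'a \<Rightarrow> bool) measure"
  assumes "sets \<mu> = sets Eqrel_borel" "sets \<nu> = sets Eqrel_borel" "finite_measure \<mu>" "finite_measure \<nu>"
    and A: "A \<in> sets Eqrel_borel" and "\<epsilon> > 0"
  obtains C where "C \<in> cylinders" "measure \<mu> (sym_diff A C) < \<epsilon>" "measure \<nu> (sym_diff A C) < \<epsilon>"
proof -
  interpret \<mu>: finite_measure \<mu> by fact
  interpret \<nu>: finite_measure \<nu> by fact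
  have sp: "space \<mu> = Eqrel" "space \<nu> = Eqrel"
    using assms(1,2) by (metis sets_eq_imp_space_eq space_Eqrel_borel)+
  have S [simp]: "sets \<mu> = sets Eqrel_borel" "sets \<nu> = sets Eqrel_borel" by fact+
  have cylS: "C \<in> sets Eqrel_borel" if "C \<in> cylinders" for C :: "('a \<Rightarrow> 'a \<Rightarrow> bool) set"
    using cylinders_subset_sets that by blast
  have "A \<in> sigma_sets Eqrel cylinders" using A by (simp add: sets_Eqrel_borel)
  then have "\<forall>\<epsilon>>0. \<exists>C\<in>cylinders. measure \<mu> (sym_diff A C) < \<epsilon> \<and> measure \<nu> (sym_diff A C) < \<epsilon>"
  proof induction
    case (Basic a)
    then show ?case by (intro allI impI bexI [of _ a]) auto
  next
    case Empty
    show ?case using cyl.empty_sets by (intro allI impI bexI [of _ "{}"]) auto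
  next
    case (Compl a)
    have aS: "a \<subseteq> Eqrel"
      using sigma_sets_into_sp [OF cyl.space_closed Compl.hyps] by blast
    show ?case
    proof (intro allI impI)
      fix \<epsilon> :: real assume "\<epsilon> > 0"
      then obtain C where C: "C \<in> cylinders" "measure \<mu> (sym_diff a C) < \<epsilon>" "measure \<nu> (sym_diff a C) < \<epsilon>"
        using Compl.IH by blast
      have "C \<subseteq> Eqrel" using C(1) cyl.space_closed by blast
      with aS have "sym_diff (Eqrel - a) (Eqrel - C) = sym_diff a C" by blast
      moreover have "Eqrel - C \<in> cylinders" using C(1) by (rule cyl.compl_sets)
      ultimately show "\<exists>C\<in>cylinders. measure \<mu> (sym_diff (Eqrel - a) C) < \<epsilon> \<and> measure \<nu> (sym_diff (Eqrel - a) C) < \<epsilon>"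
        using C by metis
    qed
  next
    case (Union a)
    have aS: "a i \<in> sets Eqrel_borel" for i
      using Union.hyps by (simp add: sets_Eqrel_borel)
    show ?case
    proof (intro allI impI)
      fix \<epsilon> :: real assume \<epsilon>: "\<epsilon> > 0"
      let ?B = "\<lambda>n. \<Union>i<n. a i"
      have inc: "incseq ?B" unfolding incseq_def by (intro allI impI UN_mono) auto
      have un: "(\<Union>n. ?B n) = (\<Union>i. a i)" by blast
      have "(\<lambda>n. measure \<mu> (?B n)) \<longlonglongrightarrow> measure \<mu> (\<Union>i. a i)" "(\<lambda>n. measure \<nu> (?B n)) \<longlonglongrightarrow> measure \<nu> (\<Union>i. a i)"
        using \<mu>.finite_Lim_measure_incseq [OF _ inc] \<nu>.finite_Lim_measure_incseq [OF _ inc] aS un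
        by auto
      then have "\<forall>\<^sub>F n in sequentially. measure \<mu> (?B n) > measure \<mu> (\<Union>i. a i) - \<epsilon>/2"
        "\<forall>\<^sub>F n in sequentially. measure \<nu> (?B n) > measure \<nu> (\<Union>i. a i) - \<epsilon>/2"
        using \<epsilon> by (auto elim!: order_tendstoD)
      then have "\<forall>\<^sub>F n in sequentially. measure \<mu> (?B n) > measure \<mu> (\<Union>i. a i) - \<epsilon>/2 \<and>
        measure \<nu> (?B n) > measure \<nu> (\<Union>i. a i) - \<epsilon>/2 \<and> n > 0"
        by (intro eventually_conj eventually_gt_at_top)
      then have "\<exists>n. measure \<mu> (?B n) > measure \<mu> (\<Union>i. a i) - \<epsilon>/2 \<and>
        measure \<nu> (?B n) > measure \<nu> (\<Union>i. a i) - \<epsilon>/2 \<and> n > 0"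
        by (rule eventually_happens' [OF sequentially_bot])
      then obtain n where n: "measure \<mu> (?B n) > measure \<mu> (\<Union>i. a i) - \<epsilon>/2"
        "measure \<nu> (?B n) > measure \<nu> (\<Union>i. a i) - \<epsilon>/2" "n > 0"
        by blast
      \<comment> \<open>Half of \<open>\<epsilon>\<close> pays for cutting the union at
        \<open>n\<close>; the other half is shared equally by the \<open>n\<close> approximations,
        whence \<open>n > 0\<close>.\<close>
      have "\<forall>i. \<exists>C\<in>cylinders. measure \<mu> (sym_diff (a i) C) < \<epsilon>/(2*n) \<and> measure \<nu> (sym_diff (a i) C) < \<epsilon>/(2*n)"
        using Union.IH \<epsilon> n(3) by simp
      then obtain C where C: "\<And>i. C i \<in> cylinders" "\<And>i. measure \<mu> (sym_diff (a i) (C i)) < \<epsilon>/(2*n)"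
        "\<And>i. measure \<nu> (sym_diff (a i) (C i)) < \<epsilon>/(2*n)" by metis
      have CS: "C i \<in> sets Eqrel_borel" for i using C(1) cylS by blast
      let ?D = "\<Union>i<n. C i"
      have D: "?D \<in> cylinders" using C(1) by (intro cyl.finite_UN) auto
      have sub: "sym_diff (\<Union>i. a i) ?D \<subseteq> ((\<Union>i. a i) - ?B n) \<union> (\<Union>i<n. sym_diff (a i) (C i))" by blast
      have bound: "measure \<kappa> (sym_diff (\<Union>i. a i) ?D) < \<epsilon>"
        if "finite_measure \<kappa>" and sets [simp]: "sets \<kappa> = sets Eqrel_borel"
          and 1: "measure \<kappa> (?B n) > measure \<kappa> (\<Union>i. a i) - \<epsilon>/2"
          and 2: "\<And>i. measure \<kappa> (sym_diff (a i) (C i)) < \<epsilon>/(2*n)" for \<kappa>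
      proof -
        interpret \<kappa>: finite_measure \<kappa> by fact
        have "measure \<kappa> (sym_diff (\<Union>i. a i) ?D) \<le> measure \<kappa> (((\<Union>i. a i) - ?B n) \<union> (\<Union>i<n. sym_diff (a i) (C i)))"
          using aS CS by (intro \<kappa>.finite_measure_mono sub) auto
        also have "\<dots> \<le> measure \<kappa> ((\<Union>i. a i) - ?B n) + measure \<kappa> (\<Union>i<n. sym_diff (a i) (C i))"
          using aS CS by (intro measure_Un_le) auto
        also have "measure \<kappa> ((\<Union>i. a i) - ?B n) = measure \<kappa> (\<Union>i. a i) - measure \<kappa> (?B n)"
          using aS by (intro \<kappa>.finite_measure_Diff) auto
        also have "measure \<kappa> (\<Union>i<n. sym_diff (a i) (C i)) \<le> (\<Sum>i<n. measure \<kappa> (sym_diff (a i) (C i)))"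
          using aS CS by (intro measure_UNION_le) auto
        also have "\<dots> \<le> (\<Sum>i<n. \<epsilon>/(2*n))" using 2 by (intro sum_mono less_imp_le)
        also have "\<dots> = \<epsilon>/2" using n(3) by simp
        finally show ?thesis using 1 by linarith
      qed
      show "\<exists>C\<in>cylinders. measure \<mu> (sym_diff (\<Union>i. a i) C) < \<epsilon> \<and> measure \<nu> (sym_diff (\<Union>i. a i) C) < \<epsilon>"
        using D bound [OF assms(3,1) n(1) C(2)] bound [OF assms(4,2) n(2) C(3)] by blast
    qed
  qed
  with \<open>\<epsilon> > 0\<close> that show ?thesis by blast
qed

text \<open>Limits are known only on cylinders; testing on a cylinder close to \<open>A\<close> for
  both measures carries a domination over to all Borel sets.\<close>

lemma Eqrel_measure_mono:
  fixes \<mu> \<nu> :: "('a::countable \<Rightarrow> 'a \<Rightarrow> bool) measure"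
  assumes "sets \<mu> = sets Eqrel_borel" "sets \<nu> = sets Eqrel_borel" "finite_measure \<mu>" "finite_measure \<nu>"
    and le: "\<And>C. C \<in> cylinders \<Longrightarrow> measure \<mu> C \<le> measure \<nu> C" and A: "A \<in> sets Eqrel_borel"
  shows "measure \<mu> A \<le> measure \<nu> A"
proof (rule field_le_epsilon)
  fix \<epsilon> :: real assume "\<epsilon> > 0"
  then have "\<epsilon>/2 > 0" by simp
  then obtain C where C: "C \<in> cylinders" "measure \<mu> (sym_diff A C) < \<epsilon>/2" "measure \<nu> (sym_diff A C) < \<epsilon>/2"
    using Eqrel_measure_approx [OF assms(1-4) A] by metis
  have CS: "C \<in> sets Eqrel_borel" using C(1) cylinders_subset_sets by blast
  have le': "measure \<kappa> X \<le> measure \<kappa> Y + measure \<kappa> (sym_diff A C)"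
    if "finite_measure \<kappa>" "sets \<kappa> = sets Eqrel_borel" "X \<in> sets Eqrel_borel" "Y \<in> sets Eqrel_borel"
      "X \<subseteq> Y \<union> sym_diff A C" for \<kappa> X Y
  proof -
    interpret \<kappa>: finite_measure \<kappa> by fact
    have "measure \<kappa> X \<le> measure \<kappa> (Y \<union> sym_diff A C)"
      using that A CS by (intro \<kappa>.finite_measure_mono) auto
    also have "\<dots> \<le> measure \<kappa> Y + measure \<kappa> (sym_diff A C)"
      using that A CS by (intro measure_Un_le) auto
    finally show ?thesis .
  qed
  have "measure \<mu> A \<le> measure \<mu> C + measure \<mu> (sym_diff A C)"
    by (rule le') (use assms A CS in auto)
  moreover have "measure \<nu> C \<le> measure \<nu> A + measure \<nu> (sym_diff A C)"
    by (rule le') (use assms A CS in auto)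
  ultimately show "measure \<mu> A \<le> measure \<nu> A + \<epsilon>"
    using C(2,3) le [OF C(1)] by linarith
qed

subsection \<open>Weak convergence\<close>

lemma Prob_EqrelD:
  assumes "\<rho> \<in> Prob_Eqrel"
  shows "prob_space \<rho>" "sets \<rho> = sets Eqrel_borel" "space \<rho> = Eqrel"
  using assms sets_eq_imp_space_eq [of \<rho> Eqrel_borel] by (auto simp: Prob_Eqrel_def)

lemma local_on_measurable:
  assumes "finite F" "local_on F f" "sets \<rho> = sets Eqrel_borel"
  shows "f \<in> measurable \<rho> (count_space UNIV)"
proof -
  have sp: "space \<rho> = Eqrel" using sets_eq_imp_space_eq [OF assms(3)] by simp
  show ?thesis
  proof (rule measurableI)
    fix A show "f -` A \<inter> space \<rho> \<in> sets \<rho>"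
      using cylindersI [OF assms(1) local_on_comp [OF assms(2), of "\<lambda>y. y \<in> A"]] cylinders_subset_sets
      by (auto simp: sp assms(3) Int_def vimage_def conj_commute)
  qed simp
qed

lemma local_on_borel_measurable:
  assumes "finite F" "local_on F f" "sets \<rho> = sets Eqrel_borel"
  shows "f \<in> borel_measurable \<rho>"
  by (rule measurable_compose [OF local_on_measurable [OF assms], of "\<lambda>x. x"]) simp

text \<open>A local function has finitely many values, each attained on a cylinder, so its integral
  is a finite combination of measures of cylinders and passes to limits on cylinders.\<close>

lemma integral_local_on:
  fixes f :: "('a \<Rightarrow> 'a \<Rightarrow> bool) \<Rightarrow> real"
  assumes F: "finite F" "local_on F f" and \<rho>: "\<rho> \<in> Prob_Eqrel"
  shows "(\<integral>r. f r \<partial>\<rho>) = (\<Sum>v\<in>f ` Eqrel. v * measure \<rho> {r \<in> Eqrel. f r = v})"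
proof -
  interpret prob_space \<rho> using \<rho> by (rule Prob_EqrelD)
  have fin: "finite (f ` Eqrel)" by (rule local_on_finite_image [OF F])
  have S: "{r \<in> Eqrel. f r = v} \<in> sets \<rho>" for v
    using cylindersI [OF F(1) local_on_comp [OF F(2), of "\<lambda>y. y = v"]] cylinders_subset_sets Prob_EqrelD(2) [OF \<rho>]
    by auto
  have "(\<integral>r. f r \<partial>\<rho>) = (\<integral>r. (\<Sum>v\<in>f ` Eqrel. v * indicator {r \<in> Eqrel. f r = v} r) \<partial>\<rho>)"
  proof (rule Bochner_Integration.integral_cong)
    fix r assume "r \<in> space \<rho>"
    then have r: "r \<in> Eqrel" by (simp add: Prob_EqrelD [OF \<rho>])
    have "(\<Sum>v\<in>f ` Eqrel. v * indicator {r \<in> Eqrel. f r = v} r) = (\<Sum>v\<in>f ` Eqrel. if v = f r then v else 0)"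
      using r by (intro sum.cong) auto
    then show "f r = (\<Sum>v\<in>f ` Eqrel. v * indicator {r \<in> Eqrel. f r = v} r)"
      using fin r by (simp add: sum.delta)
  qed simp
  also have "\<dots> = (\<Sum>v\<in>f ` Eqrel. v * measure \<rho> {r \<in> Eqrel. f r = v})"
    using S by (subst Bochner_Integration.integral_sum) (auto simp: emeasure_eq_measure)
  finally show ?thesis .
qed

text \<open>For probability measures this is weak convergence: indicators of cylinders are
  continuous, and their linear combinations approximate every continuous function uniformly.\<close>

definition cyl_tendsto :: "(nat \<Rightarrow> ('a \<Rightarrow> 'a \<Rightarrow> bool) measure) \<Rightarrow> ('a \<Rightarrow> 'a \<Rightarrow> bool) measure \<Rightarrow> bool" where
  "cyl_tendsto \<rho>s \<rho> \<longleftrightarrow> (\<forall>C\<in>cylinders. (\<lambda>n. measure (\<rho>s n) C) \<longlonglongrightarrow> measure \<rho> C)"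

lemma cyl_tendsto_integral_local:
  fixes f :: "('a \<Rightarrow> 'a \<Rightarrow> bool) \<Rightarrow> real"
  assumes "cyl_tendsto \<rho>s \<rho>" "\<rho> \<in> Prob_Eqrel" "\<And>n. \<rho>s n \<in> Prob_Eqrel" and F: "finite F" "local_on F f"
  shows "(\<lambda>n. \<integral>r. f r \<partial>\<rho>s n) \<longlonglongrightarrow> (\<integral>r. f r \<partial>\<rho>)"
proof -
  have "{r \<in> Eqrel. f r = v} \<in> cylinders" for v
    by (rule cylindersI [OF F(1) local_on_comp [OF F(2), of "\<lambda>y. y = v"]])
  then show ?thesis
    unfolding integral_local_on [OF F assms(2)] integral_local_on [OF F assms(3)]
    using assms(1) by (intro tendsto_intros) (simp add: cyl_tendsto_def)
qed

lemma window_subset: "window G r = window G r' \<Longrightarrow> F \<subseteq> G \<Longrightarrow> window F r = window F r'"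
  unfolding window_eq_iff by blast

lemma open_fun_contains_basis:
  fixes U :: "('i \<Rightarrow> 'b::topological_space) set"
  assumes "open U" "x \<in> U"
  obtains X where "x \<in> Pi UNIV X" "\<And>i. open (X i)" "finite {i. X i \<noteq> UNIV}" "Pi UNIV X \<subseteq> U"
proof -
  have "openin (product_topology (\<lambda>_. euclidean) UNIV) U"
    using assms(1) by (simp add: euclidean_product_topology)
  from product_topology_open_contains_basis [OF this assms(2)] that show ?thesis
    by (auto simp: PiE_UNIV_domain)
qed

text \<open>Uniform continuity in terms of windows. Each point has a finite window that confines
  \<open>f\<close> to within \<open>\<epsilon>/2\<close>; finitely many of these neighbourhoods
  cover \<open>Eqrel\<close>, and the union \<open>G\<close> of their windows determines
  \<open>f\<close> up to \<open>\<epsilon>\<close>. The approximant evaluates \<open>f\<close> at a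
  chosen representative of each pattern on \<open>G\<close>.\<close>

lemma continuous_on_Eqrel_approx:
  fixes f :: "('a \<Rightarrow> 'a \<Rightarrow> bool) \<Rightarrow> real"
  assumes f: "continuous_on Eqrel f" and "\<epsilon> > 0"
  obtains F g where "finite F" "local_on F g" "\<And>r. r \<in> Eqrel \<Longrightarrow> \<bar>f r - g r\<bar> < \<epsilon>"
proof -
  let ?W = "\<lambda>F s. {r :: 'a \<Rightarrow> 'a \<Rightarrow> bool. window F r = window F s}"
  have "\<exists>F. finite F \<and> (\<forall>r'\<in>Eqrel. r' \<in> ?W F s \<longrightarrow> \<bar>f r' - f s\<bar> < \<epsilon>/2)" if s: "s \<in> Eqrel" for s
  proof -
    obtain T where T: "open T" "Eqrel \<inter> f -` ball (f s) (\<epsilon>/2) = Eqrel \<inter> T"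
      using f continuous_on_open_invariant [of Eqrel f] open_ball by (metis Int_commute)
    have "s \<in> Eqrel \<inter> f -` ball (f s) (\<epsilon>/2)" using s assms(2) by simp
    then have "s \<in> T" unfolding T(2) by blast
    \<comment> \<open>The topology is an iterated product, so a basic neighbourhood is unpacked
      twice: \<open>U\<close> restricts finitely many rows of the relation, and \<open>V\<close>
      restricts finitely many entries of each of these rows.\<close>
    obtain U where U: "s \<in> Pi UNIV U" "\<And>a. open (U a)" "finite {a. U a \<noteq> UNIV}" "Pi UNIV U \<subseteq> T"
      using open_fun_contains_basis [OF T(1) \<open>s \<in> T\<close>] by blast
    have "\<exists>V. s a \<in> Pi UNIV V \<and> finite {b. V b \<noteq> (UNIV :: bool set)} \<and> Pi UNIV V \<subseteq> U a" for a
    proof -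
      have "s a \<in> U a" using U(1) by (simp add: Pi_iff)
      from open_fun_contains_basis [OF U(2) this] show ?thesis by metis
    qed
    then obtain V where V: "\<And>a. s a \<in> Pi UNIV (V a)" "\<And>a. finite {b. V a b \<noteq> (UNIV :: bool set)}" 
      "\<And>a. Pi UNIV (V a) \<subseteq> U a" by metis
    define F where "F = Sigma {a. U a \<noteq> UNIV} (\<lambda>a. {b. V a b \<noteq> UNIV})"
    have "finite F" unfolding F_def using U(3) V(2) by blast
    moreover have "\<bar>f r - f s\<bar> < \<epsilon>/2" if r: "r \<in> Eqrel" "window F r = window F s" for r
    proof -
      have "r a \<in> U a" for a
      proof (cases "U a = UNIV")
        case False
        have "r a b \<in> V a b" for b
        proof (cases "V a b = UNIV")
          case b: False
          then have "(a, b) \<in> F" using False by (simp add: F_def)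
          then have "r a b = s a b" using r(2) by (auto simp: window_eq_iff)
          then show ?thesis using V(1) [of a] by (simp add: Pi_iff)
        qed simp
        then show ?thesis using V(3) [of a] by (auto simp: Pi_iff)
      qed simp
      then have "r \<in> T" using U(4) by (auto simp: Pi_iff)
      then have "f r \<in> ball (f s) (\<epsilon>/2)" using r(1) T(2) by blast
      then show ?thesis by (simp add: dist_real_def abs_minus_commute)
    qed
    ultimately show ?thesis by blast
  qed
  then obtain F where F: "\<And>s. s \<in> Eqrel \<Longrightarrow> finite (F s)"
    "\<And>s r. s \<in> Eqrel \<Longrightarrow> r \<in> Eqrel \<Longrightarrow> window (F s) r = window (F s) s \<Longrightarrow> \<bar>f r - f s\<bar> < \<epsilon>/2"
    by (metis (mono_tags, lifting) mem_Collect_eq)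
  obtain D where D: "D \<subseteq> Eqrel" "finite D" "Eqrel \<subseteq> (\<Union>s\<in>D. ?W (F s) s)"
    using compactE_image [OF compact_Eqrel, of Eqrel "\<lambda>s. ?W (F s) s"] open_window [OF F(1)] by blast
  define G where "G = (\<Union>s\<in>D. F s)"
  have finG: "finite G" unfolding G_def using D F(1) by blast
  have osc: "\<bar>f r - f r'\<bar> < \<epsilon>" if r: "r \<in> Eqrel" "r' \<in> Eqrel" "window G r = window G r'" for r r'
  proof -
    obtain s where s: "s \<in> D" "window (F s) r = window (F s) s" using D(3) r(1) by blast
    have "window (F s) r' = window (F s) s"
      using window_subset [OF r(3), of "F s"] s by (auto simp: G_def)
    then have "\<bar>f r - f s\<bar> < \<epsilon>/2" "\<bar>f r' - f s\<bar> < \<epsilon>/2" using F(2) [of s] s r D(1) by auto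
    then show ?thesis by linarith
  qed
  define g where "g r = f (SOME r'. r' \<in> Eqrel \<and> window G r' = window G r)" for r
  have "\<bar>f r - g r\<bar> < \<epsilon>" if "r \<in> Eqrel" for r
  proof -
    have "(SOME r'. r' \<in> Eqrel \<and> window G r' = window G r) \<in> Eqrel \<and>
      window G (SOME r'. r' \<in> Eqrel \<and> window G r' = window G r) = window G r"
      by (rule someI [of _ r]) (use that in auto)
    then show ?thesis unfolding g_def using that by (intro osc) auto
  qed
  moreover have "local_on G g" unfolding local_on_def g_def by simp
  ultimately show ?thesis using finG that by blast
qed

lemma cyl_tendsto_integral:
  fixes f :: "('a \<Rightarrow> 'a \<Rightarrow> bool) \<Rightarrow> real"
  assumes lim: "cyl_tendsto \<rho>s \<rho>" and \<rho>: "\<rho> \<in> Prob_Eqrel" and \<rho>s: "\<And>n. \<rho>s n \<in> Prob_Eqrel"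
    and f: "continuous_on Eqrel f"
  shows "(\<lambda>n. \<integral>r. f r \<partial>\<rho>s n) \<longlonglongrightarrow> (\<integral>r. f r \<partial>\<rho>)"
proof (rule LIMSEQ_I)
  fix \<epsilon> :: real assume \<epsilon>: "\<epsilon> > 0"
  then have "\<epsilon>/4 > 0" by simp
  then obtain F g where g: "finite F" "local_on F g" "\<And>r. r \<in> Eqrel \<Longrightarrow> \<bar>f r - g r\<bar> < \<epsilon>/4"
    using continuous_on_Eqrel_approx [OF f] by metis
  have "compact (f ` Eqrel)" by (rule compact_continuous_image [OF f compact_Eqrel])
  then have "bounded (f ` Eqrel)" by (rule compact_imp_bounded)
  then obtain B where B: "\<And>r. r \<in> Eqrel \<Longrightarrow> \<bar>f r\<bar> \<le> B" unfolding bounded_iff by auto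
  have approx: "\<bar>(\<integral>r. f r \<partial>\<mu>) - (\<integral>r. g r \<partial>\<mu>)\<bar> \<le> \<epsilon>/4" if \<mu>: "\<mu> \<in> Prob_Eqrel" for \<mu>
  proof -
    interpret prob_space \<mu> using \<mu> by (rule Prob_EqrelD)
    note sp = Prob_EqrelD(2,3) [OF \<mu>]
    have g_meas: "g \<in> borel_measurable \<mu>" using g sp by (intro local_on_borel_measurable)
    have "f \<in> borel_measurable (restrict_space borel Eqrel)"
      by (rule borel_measurable_continuous_on_restrict [OF f])
    then have f_meas: "f \<in> borel_measurable \<mu>"
      using sp(1) unfolding Eqrel_borel_def by (simp cong: measurable_cong_sets)
    have intf: "integrable \<mu> f"
      by (rule integrable_const_bound [OF AE_I2 f_meas, of B]) (simp add: sp B)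
    have "\<bar>g r\<bar> \<le> B + \<epsilon>/4" if "r \<in> Eqrel" for r
      using g(3) [OF that] B [OF that] by linarith
    then have intg: "integrable \<mu> g"
      by (intro integrable_const_bound [OF AE_I2 g_meas, of "B + \<epsilon>/4"]) (simp add: sp)
    have "\<bar>(\<integral>r. f r \<partial>\<mu>) - (\<integral>r. g r \<partial>\<mu>)\<bar> = \<bar>\<integral>r. f r - g r \<partial>\<mu>\<bar>"
      using intf intg by simp
    also have "\<dots> \<le> (\<integral>r. \<bar>f r - g r\<bar> \<partial>\<mu>)" by (rule integral_abs_bound)
    also have "\<dots> \<le> (\<integral>r. \<epsilon>/4 \<partial>\<mu>)"
      using intf intg g(3) by (intro integral_mono) (auto simp: sp intro: less_imp_le)
    finally show ?thesis by (simp add: prob_space)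
  qed
  have "(\<lambda>n. \<integral>r. g r \<partial>\<rho>s n) \<longlonglongrightarrow> (\<integral>r. g r \<partial>\<rho>)"
    using lim \<rho> \<rho>s g(1,2) by (rule cyl_tendsto_integral_local)
  then obtain N where N: "\<And>n. n \<ge> N \<Longrightarrow> norm ((\<integral>r. g r \<partial>\<rho>s n) - (\<integral>r. g r \<partial>\<rho>)) < \<epsilon>/4"
    using LIMSEQ_D \<open>\<epsilon>/4 > 0\<close> by metis
  have "norm ((\<integral>r. f r \<partial>\<rho>s n) - (\<integral>r. f r \<partial>\<rho>)) < \<epsilon>" if "n \<ge> N" for n
    using N [OF that] approx [OF \<rho>] approx [OF \<rho>s [of n]] \<epsilon> unfolding real_norm_def by linarith
  then show "\<exists>N. \<forall>n\<ge>N. norm ((\<integral>r. f r \<partial>\<rho>s n) - (\<integral>r. f r \<partial>\<rho>)) < \<epsilon>" by blast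
qed

section \<open>Consequences of shift invariance\<close>

lemma Prob_Eqrel_measurable_shift:
  assumes "\<rho> \<in> Prob_Eqrel"
  shows "shift (g :: 'a::group_add) \<in> measurable \<rho> \<rho>"
  using shift_measurable [of g] measurable_cong_sets [OF Prob_EqrelD(2) [OF assms] Prob_EqrelD(2) [OF assms]]
  by blast

lemma IRE_Prob_Eqrel: "\<rho> \<in> IRE \<Longrightarrow> \<rho> \<in> Prob_Eqrel"
  by (simp add: IRE_def)

text \<open>Cylinders form an intersection-stable generator. In this form invariance is visibly
  preserved by limits on cylinders.\<close>

lemma IRE_iff:
  fixes \<rho> :: "('a::{group_add, countable} \<Rightarrow> 'a \<Rightarrow> bool) measure"
  assumes \<rho>: "\<rho> \<in> Prob_Eqrel"
  shows "\<rho> \<in> IRE \<longleftrightarrow> (\<forall>g. \<forall>C\<in>cylinders. measure \<rho> (shift g -` C \<inter> Eqrel) = measure \<rho> C)"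
proof -
  interpret prob_space \<rho> using \<rho> by (rule Prob_EqrelD)
  note sp = Prob_EqrelD(2,3) [OF \<rho>]
  have m: "shift g \<in> measurable \<rho> \<rho>" for g by (rule Prob_Eqrel_measurable_shift [OF \<rho>])
  have CS: "C \<in> sets \<rho>" if "C \<in> cylinders" for C using that cylinders_subset_sets sp(1) by blast
  have em: "emeasure (distr \<rho> \<rho> (shift g)) C = measure \<rho> (shift g -` C \<inter> Eqrel)" if "C \<in> cylinders" for g C
    using emeasure_distr [OF m CS [OF that]] by (simp add: sp emeasure_eq_measure)
  have "distr \<rho> \<rho> (shift g) = \<rho> \<longleftrightarrow> (\<forall>C\<in>cylinders. measure \<rho> (shift g -` C \<inter> Eqrel) = measure \<rho> C)" for g
  proof
    assume *: "distr \<rho> \<rho> (shift g) = \<rho>"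
    show "\<forall>C\<in>cylinders. measure \<rho> (shift g -` C \<inter> Eqrel) = measure \<rho> C"
    proof
      fix C :: "('a \<Rightarrow> 'a \<Rightarrow> bool) set" assume "C \<in> cylinders"
      from em [OF this, of g] show "measure \<rho> (shift g -` C \<inter> Eqrel) = measure \<rho> C"
        unfolding * by (simp add: emeasure_eq_measure)
    qed
  next
    assume *: "\<forall>C\<in>cylinders. measure \<rho> (shift g -` C \<inter> Eqrel) = measure \<rho> C"
    show "distr \<rho> \<rho> (shift g) = \<rho>"
    proof (rule Eqrel_measure_eqI)
      show "finite_measure (distr \<rho> \<rho> (shift g))" 
        by (rule finite_measure_distr [OF m])
    qed (use * em in \<open>auto simp: sp emeasure_eq_measure\<close>)
  qed
  then show ?thesis using \<rho> by (simp add: IRE_def)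
qed

lemma IRE_measure_shift:
  assumes \<rho>: "\<rho> \<in> IRE" and A: "A \<in> sets Eqrel_borel"
  shows "measure \<rho> (shift g -` A \<inter> Eqrel) = measure \<rho> A"
proof -
  have P: "\<rho> \<in> Prob_Eqrel" using \<rho> by (rule IRE_Prob_Eqrel)
  note sp = Prob_EqrelD(2,3) [OF P]
  have "measure \<rho> A = measure (distr \<rho> \<rho> (shift g)) A"
    using \<rho> by (simp add: IRE_def)
  also have "\<dots> = measure \<rho> (shift g -` A \<inter> Eqrel)"
    using measure_distr [OF Prob_Eqrel_measurable_shift [OF P]] A by (simp add: sp)
  finally show ?thesis by simp
qed

lemma IRE_integral_shift:
  fixes f :: "_ \<Rightarrow> real"
  assumes \<rho>: "\<rho> \<in> IRE" and f: "f \<in> borel_measurable \<rho>"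
  shows "(\<integral>r. f (shift g r) \<partial>\<rho>) = (\<integral>r. f r \<partial>\<rho>)"
proof -
  have P: "\<rho> \<in> Prob_Eqrel" using \<rho> by (rule IRE_Prob_Eqrel)
  have "(\<integral>r. f r \<partial>\<rho>) = (\<integral>r. f r \<partial>distr \<rho> \<rho> (shift g))"
    using \<rho> by (simp add: IRE_def)
  also have "\<dots> = (\<integral>r. f (shift g r) \<partial>\<rho>)"
    by (rule integral_distr [OF Prob_Eqrel_measurable_shift [OF P] f])
  finally show ?thesis by simp
qed

lemma IRE_nn_integral_shift:
  assumes \<rho>: "\<rho> \<in> IRE" and f: "f \<in> borel_measurable \<rho>"
  shows "(\<integral>\<^sup>+r. f (shift g r) \<partial>\<rho>) = (\<integral>\<^sup>+r. f r \<partial>\<rho>)"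
proof -
  have P: "\<rho> \<in> Prob_Eqrel" using \<rho> by (rule IRE_Prob_Eqrel)
  have "(\<integral>\<^sup>+r. f r \<partial>\<rho>) = (\<integral>\<^sup>+r. f r \<partial>distr \<rho> \<rho> (shift g))"
    using \<rho> by (simp add: IRE_def)
  also have "\<dots> = (\<integral>\<^sup>+r. f (shift g r) \<partial>\<rho>)"
    by (rule nn_integral_distr [OF Prob_Eqrel_measurable_shift [OF P]]) (use f in simp)
  finally show ?thesis by simp
qed

lemma IRE_AE_shift:
  assumes \<rho>: "\<rho> \<in> IRE" and "AE r in \<rho>. Q r"
  shows "AE r in \<rho>. Q (shift g r)"
proof -
  have P: "\<rho> \<in> Prob_Eqrel" using \<rho> by (rule IRE_Prob_Eqrel)
  have "distr \<rho> \<rho> (shift g) = \<rho>" using \<rho> by (simp add: IRE_def)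
  then have "AE r in distr \<rho> \<rho> (shift g). Q r" using assms(2) by (simp only:)
  then show ?thesis
    using AE_distrD [OF Prob_Eqrel_measurable_shift [OF P]] by blast
qed

section \<open>Weak closure in terms of sequences\<close>

lemma topspace_IRE_topology: "topspace IRE_topology = IRE"
  unfolding IRE_topology_def using topspace_weak_topology by (auto simp: IRE_def)

text \<open>The topology is given by a subbasis, so that the sequence is eventually in each
  neighbourhood follows by induction on the generation of open sets.\<close>

lemma cyl_tendsto_closure:
  assumes "cyl_tendsto \<rho>s \<rho>" "\<rho> \<in> IRE" "S \<subseteq> IRE" "\<And>n. \<rho>s n \<in> S"
  shows "\<rho> \<in> IRE_topology closure_of S"
proof -
  have ev: "\<rho> \<in> T \<Longrightarrow> \<forall>\<^sub>F n in sequentially. \<rho>s n \<in> T" if "openin weak_topology T" for T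
    using that unfolding weak_topology_def openin_topology_generated_by_iff
  proof induction
    case (Int a b)
    then show ?case by (auto intro: eventually_conj)
  next
    case (UN K)
    then obtain k where "k \<in> K" "\<rho> \<in> k" by blast
    from UN.IH [OF this] show ?case by (rule eventually_mono) (use \<open>k \<in> K\<close> in blast)
  next
    case (Basis s)
    then obtain f :: "('a \<Rightarrow> 'a \<Rightarrow> bool) \<Rightarrow> real" and U :: "real set"
      where s: "s = {\<rho> \<in> Prob_Eqrel. (\<integral>r. f r \<partial>\<rho>) \<in> U}"
      and f: "continuous_on Eqrel f" and U: "open U" by blast
    have "(\<lambda>n. \<integral>r. f r \<partial>\<rho>s n) \<longlonglongrightarrow> (\<integral>r. f r \<partial>\<rho>)"
      using assms f by (intro cyl_tendsto_integral) (auto intro: IRE_Prob_Eqrel)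
    moreover have "(\<integral>r. f r \<partial>\<rho>) \<in> U" using Basis s by simp
    ultimately have "\<forall>\<^sub>F n in sequentially. (\<integral>r. f r \<partial>\<rho>s n) \<in> U"
      using topological_tendstoD [OF _ U] by blast
    then show ?case
    proof eventually_elim
      case (elim n)
      have "\<rho>s n \<in> Prob_Eqrel" using assms(3,4) IRE_Prob_Eqrel by blast
      with elim show ?case unfolding s by blast
    qed
  qed simp
  show ?thesis
    unfolding in_closure_of topspace_IRE_topology
  proof (intro conjI allI impI)
    fix T assume T: "\<rho> \<in> T \<and> openin IRE_topology T"
    then obtain T' where T': "openin weak_topology T'" "T = T' \<inter> IRE"
      unfolding IRE_topology_def openin_subtopology by blast
    then have "\<forall>\<^sub>F n in sequentially. \<rho>s n \<in> T'" using ev T by blast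
    then obtain n where "\<rho>s n \<in> T'" using eventually_happens' [OF sequentially_bot] by blast
    then show "\<exists>y. y \<in> S \<and> y \<in> T" using assms(3,4) T'(2) by blast
  qed (rule assms(2))
qed

text \<open>Sequences suffice although the subbasis ranges over all continuous functions: the
  \<open>n\<close>-th term only has to match the first \<open>n + 1\<close> cylinders of an
  enumeration up to \<open>1 / (n + 1)\<close>.\<close>

lemma closure_cyl_tendsto:
  fixes \<rho> :: "('a::{group_add, countable} \<Rightarrow> 'a \<Rightarrow> bool) measure"
  assumes "\<rho> \<in> IRE_topology closure_of S"
  obtains \<rho>s where "\<And>n. \<rho>s n \<in> S" "cyl_tendsto \<rho>s \<rho>" "\<rho> \<in> IRE"
proof -
  have \<rho>: "\<rho> \<in> IRE"
    using assms unfolding in_closure_of topspace_IRE_topology by blast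
  define C :: "nat \<Rightarrow> ('a \<Rightarrow> 'a \<Rightarrow> bool) set" where "C = from_nat_into cylinders"
  have ne: "cylinders \<noteq> ({} :: ('a \<Rightarrow> 'a \<Rightarrow> bool) set set)" using cyl.top by blast
  have C: "C i \<in> cylinders" for i unfolding C_def by (rule from_nat_into [OF ne])
  define B where "B n i = {\<mu> \<in> Prob_Eqrel. (\<integral>r. indicator (C i) r \<partial>\<mu>) \<in> ball (measure \<rho> (C i)) (1 / Suc n)}" for n i
  have opB: "openin weak_topology (B n i)" for n i
  proof -
    obtain F where F: "finite F" "local_on F (\<lambda>r. r \<in> C i)" using C [of i] by (rule cylindersE)
    have "local_on F (\<lambda>r. indicator (C i) r :: real)"
      using local_on_comp [OF F(2), of "of_bool :: bool \<Rightarrow> real"] by (simp add: indicator_def)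
    then have "continuous_on Eqrel (indicator (C i) :: _ \<Rightarrow> real)"
      by (rule local_on_continuous [OF F(1)])
    then show ?thesis
      unfolding weak_topology_def B_def by (intro topology_generated_by_Basis) blast
  qed
  have ind: "C i \<inter> space \<mu> = C i" if "\<mu> \<in> Prob_Eqrel" for \<mu> i
    using C [of i] cyl.space_closed Prob_EqrelD(3) [OF that] by blast
  have inB: "\<rho> \<in> B n i" for n i
    using IRE_Prob_Eqrel [OF \<rho>] by (simp add: B_def ind)
  have "\<exists>\<mu>. \<mu> \<in> S \<and> \<mu> \<in> (\<Inter>i\<le>n. B n i) \<inter> IRE" for n
  proof -
    have "openin weak_topology (\<Inter>i\<le>n. B n i)"
      by (intro openin_INT2) (use opB in auto)
    then have "openin IRE_topology ((\<Inter>i\<le>n. B n i) \<inter> IRE)"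
      unfolding IRE_topology_def openin_subtopology by blast
    moreover have "\<rho> \<in> (\<Inter>i\<le>n. B n i) \<inter> IRE" using inB \<rho> by blast
    ultimately show ?thesis using assms unfolding in_closure_of by meson
  qed
  then have "\<exists>\<rho>s. \<forall>n. \<rho>s n \<in> S \<and> \<rho>s n \<in> (\<Inter>i\<le>n. B n i) \<inter> IRE"
    by (intro choice allI)
  then obtain \<rho>s where \<rho>s: "\<And>n. \<rho>s n \<in> S" "\<And>n. \<rho>s n \<in> (\<Inter>i\<le>n. B n i)" by blast
  have "cyl_tendsto \<rho>s \<rho>"
    unfolding cyl_tendsto_def
  proof (intro ballI)
    fix A :: "('a \<Rightarrow> 'a \<Rightarrow> bool) set" assume "A \<in> cylinders"
    from from_nat_into_surj [OF countable_cylinders this]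
    obtain i where i: "A = C i" unfolding C_def by blast
    have bound: "norm (measure (\<rho>s n) A - measure \<rho> A) \<le> 1 / Suc n" if "n \<ge> i" for n
    proof -
      have "\<rho>s n \<in> B n i" using \<rho>s(2) [of n] that by blast
      then have "\<rho>s n \<in> Prob_Eqrel" "dist (measure \<rho> (C i)) (\<integral>r. indicator (C i) r \<partial>\<rho>s n) < 1 / Suc n"
        by (simp_all add: B_def)
      then show ?thesis by (simp add: ind i dist_real_def abs_minus_commute)
    qed
    have "(\<lambda>n. measure (\<rho>s n) A - measure \<rho> A) \<longlonglongrightarrow> 0"
    proof (rule Lim_null_comparison)
      show "\<forall>\<^sub>F n in sequentially. norm (measure (\<rho>s n) A - measure \<rho> A) \<le> 1 / Suc n"
        using eventually_ge_at_top [of i] by eventually_elim (rule bound)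
      show "(\<lambda>n. 1 / real (Suc n)) \<longlonglongrightarrow> 0" by (rule LIMSEQ_Suc [OF lim_1_over_n])
    qed
    then show "(\<lambda>n. measure (\<rho>s n) A) \<longlonglongrightarrow> measure \<rho> A" by (simp add: LIM_zero_iff)
  qed
  from that [OF \<rho>s(1) this \<rho>] show ?thesis .
qed

subsection \<open>Compactness\<close>

lemma compact_Pi_UNIV:
  fixes S :: "'i \<Rightarrow> 'b::topological_space set"
  assumes "\<And>i. compact (S i)"
  shows "compact (Pi UNIV S)"
proof -
  have "compactin (product_topology (\<lambda>_. euclidean) UNIV) (Pi\<^sub>E UNIV S)"
    using assms by (simp add: compactin_PiE)
  then show ?thesis by (simp add: euclidean_product_topology PiE_UNIV_domain)
qed

text \<open>This replaces diagonal arguments: a cube over a countable index type is compact and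
  metrizable, hence sequentially compact.\<close>

lemma bounded_pointwise_subsequence:
  fixes F :: "nat \<Rightarrow> 'i::countable \<Rightarrow> real"
  assumes "\<And>n i. 0 \<le> F n i" "\<And>n i. F n i \<le> 1"
  obtains s L where "strict_mono s" "\<And>i. (\<lambda>n. F (s n) i) \<longlonglongrightarrow> L i"
proof -
  have "compact (Pi UNIV (\<lambda>_::'i. {0..1::real}))" by (rule compact_Pi_UNIV) simp
  moreover have "\<forall>n. F n \<in> Pi UNIV (\<lambda>_. {0..1})" using assms by simp
  ultimately obtain L s where L: "strict_mono (s :: nat \<Rightarrow> nat)" "(F \<circ> s) \<longlonglongrightarrow> L"
    unfolding compact_def by blast
  have "(\<lambda>n. F (s n) i) \<longlonglongrightarrow> L i" for i
  proof -
    have "isCont (\<lambda>f :: 'i \<Rightarrow> real. f i) L"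
      using continuous_on_eq_continuous_at [OF open_UNIV] continuous_on_product_coordinates [of i] by blast
    from isCont_tendsto_compose [OF this L(2)] show ?thesis by (simp add: o_def)
  qed
  with L(1) that show ?thesis by blast
qed

text \<open>After a subsequence the measures converge on every cylinder. The limit is finitely
  additive there, which \<open>Eqrel_measure_extension\<close> promotes to a measure, and it is
  invariant because shifts permute cylinders.\<close>

lemma IRE_convergent_subsequence:
  fixes \<rho>s :: "nat \<Rightarrow> ('a::{group_add, countable} \<Rightarrow> 'a \<Rightarrow> bool) measure"
  assumes \<rho>s: "\<And>n. \<rho>s n \<in> IRE"
  obtains s \<rho> where "strict_mono s" "\<rho> \<in> IRE" "cyl_tendsto (\<lambda>n. \<rho>s (s n)) \<rho>"
proof -
  have P: "\<rho>s n \<in> Prob_Eqrel" for n using \<rho>s by (rule IRE_Prob_Eqrel)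
  have prob: "prob_space (\<rho>s n)" for n using P by (rule Prob_EqrelD)
  let ?C = "from_nat_into cylinders :: nat \<Rightarrow> ('a \<Rightarrow> 'a \<Rightarrow> bool) set"
  obtain s L where s: "strict_mono s" and L: "\<And>i. (\<lambda>n. measure (\<rho>s (s n)) (?C i)) \<longlonglongrightarrow> L i"
    using bounded_pointwise_subsequence [of "\<lambda>n i. measure (\<rho>s n) (?C i)"] prob_space.prob_le_1 [OF prob]
    by auto
  define \<psi> where "\<psi> C = lim (\<lambda>n. measure (\<rho>s (s n)) C)" for C
  have lim: "(\<lambda>n. measure (\<rho>s (s n)) C) \<longlonglongrightarrow> \<psi> C" if "C \<in> cylinders" for C
  proof -
    from from_nat_into_surj [OF countable_cylinders that] obtain i where i: "?C i = C" by blast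
    then show ?thesis unfolding \<psi>_def using L [of i] limI [OF L [of i]] unfolding i by simp
  qed
  have nonneg: "0 \<le> \<psi> C" if "C \<in> cylinders" for C
    by (rule LIMSEQ_le_const [OF lim [OF that]]) auto
  have CS: "C \<in> sets (\<rho>s n)" if "C \<in> cylinders" for C n
    using that cylinders_subset_sets Prob_EqrelD(2) [OF P] by blast
  have "\<psi> (C \<union> D) = \<psi> C + \<psi> D" if "C \<in> cylinders" "D \<in> cylinders" "C \<inter> D = {}" for C D
  proof (rule LIMSEQ_unique [OF lim])
    have "measure (\<rho>s n) (C \<union> D) = measure (\<rho>s n) C + measure (\<rho>s n) D" for n
      by (intro finite_measure.finite_measure_Union [OF prob_space.finite_measure [OF prob]] CS that)
    then show "(\<lambda>n. measure (\<rho>s (s n)) (C \<union> D)) \<longlonglongrightarrow> \<psi> C + \<psi> D"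
      using lim that by (simp add: tendsto_add)
  qed (use that in blast)
  then obtain \<rho> where \<rho>: "finite_measure \<rho>" "sets \<rho> = sets Eqrel_borel" "\<And>C. C \<in> cylinders \<Longrightarrow> measure \<rho> C = \<psi> C"
    using Eqrel_measure_extension [of \<psi>] nonneg by blast
  have sp: "space \<rho> = Eqrel" using sets_eq_imp_space_eq [OF \<rho>(2)] by simp
  have "measure \<rho> Eqrel = 1"
  proof (rule LIMSEQ_unique)
    show "(\<lambda>n. measure (\<rho>s (s n)) Eqrel) \<longlonglongrightarrow> measure \<rho> Eqrel"
      using lim [OF cyl.top] \<rho>(3) [OF cyl.top] by simp
    have "measure (\<rho>s n) Eqrel = 1" for n
      using prob_space.prob_space [OF prob [of n]] Prob_EqrelD(3) [OF P [of n]] by simp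
    then show "(\<lambda>n. measure (\<rho>s (s n)) Eqrel) \<longlonglongrightarrow> 1" by simp
  qed
  then have "prob_space \<rho>"
    using finite_measure.emeasure_eq_measure [OF \<rho>(1), of Eqrel] sp by (intro prob_spaceI) simp
  then have \<rho>P: "\<rho> \<in> Prob_Eqrel" using \<rho>(2) by (simp add: Prob_Eqrel_def)
  have ct: "cyl_tendsto (\<lambda>n. \<rho>s (s n)) \<rho>"
    unfolding cyl_tendsto_def using lim \<rho>(3) by simp
  have "measure \<rho> (shift g -` C \<inter> Eqrel) = measure \<rho> C" if C: "C \<in> cylinders" for g C
  proof (rule LIMSEQ_unique)
    show "(\<lambda>n. measure (\<rho>s (s n)) C) \<longlonglongrightarrow> measure \<rho> C" using ct C by (simp add: cyl_tendsto_def)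
    have "(\<lambda>n. measure (\<rho>s (s n)) (shift g -` C \<inter> Eqrel)) \<longlonglongrightarrow> measure \<rho> (shift g -` C \<inter> Eqrel)"
      using ct shift_vimage_cylinder [OF C] by (simp add: cyl_tendsto_def)
    moreover have "measure (\<rho>s (s n)) (shift g -` C \<inter> Eqrel) = measure (\<rho>s (s n)) C" for n
      using C cylinders_subset_sets by (intro IRE_measure_shift [OF \<rho>s]) blast
    ultimately show "(\<lambda>n. measure (\<rho>s (s n)) C) \<longlonglongrightarrow> measure \<rho> (shift g -` C \<inter> Eqrel)"
      by simp
  qed
  then have "\<rho> \<in> IRE" using IRE_iff [OF \<rho>P] by blast
  with s ct that show ?thesis by blast
qed

subsection \<open>Factor maps\<close>

lemma shift_shift: "shift a (shift b r) = shift (a + b) (r :: 'a::group_add \<Rightarrow> 'a \<Rightarrow> bool)"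
  by (simp only: shift_def minus_add add.assoc)

lemma shift_0 [simp]: "shift 0 r = r"
  by (simp add: shift_def)

text \<open>Both constructions of finite relations, clusters and tilings, are equivariant images of
  a process driven by invariant random labels.\<close>

lemma distr_IRE:
  fixes R :: "'x \<Rightarrow> 'a::{group_add, countable} \<Rightarrow> 'a \<Rightarrow> bool"
  assumes M: "prob_space M" and R: "R \<in> measurable M Eqrel_borel"
    and T: "\<And>g. T g \<in> measurable M M" "\<And>g. distr M M (T g) = M"
    and equiv: "\<And>g x. x \<in> space M \<Longrightarrow> R (T g x) = shift g (R x)"
  shows "distr M Eqrel_borel R \<in> IRE"
proof -
  let ?\<rho> = "distr M Eqrel_borel R"
  have "?\<rho> \<in> Prob_Eqrel"
    using prob_space.prob_space_distr [OF M R] by (simp add: Prob_Eqrel_def)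
  moreover have "distr ?\<rho> ?\<rho> (shift g) = ?\<rho>" for g
  proof -
    have "distr ?\<rho> ?\<rho> (shift g) = distr ?\<rho> Eqrel_borel (shift g)"
      by (rule distr_cong) auto
    also have "\<dots> = distr M Eqrel_borel (shift g \<circ> R)"
      by (rule distr_distr [OF shift_measurable R])
    also have "\<dots> = distr M Eqrel_borel (R \<circ> T g)"
      by (rule distr_cong) (auto simp: equiv)
    also have "\<dots> = distr (distr M M (T g)) Eqrel_borel R"
      by (rule distr_distr [OF R T(1), symmetric])
    finally show ?thesis by (simp add: T(2))
  qed
  ultimately show ?thesis by (simp add: IRE_def)
qed

lemma measurable_eqrel_coordinate [measurable]:
  "Measurable.pred Eqrel_borel (\<lambda>r :: 'a::countable \<Rightarrow> 'a \<Rightarrow> bool. r a b)"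
  unfolding pred_def using cylinders_subset_sets coordinate_cylinder [of a b] by auto

text \<open>Finiteness becomes an existential quantifier over the countable type of lists, which
  preserves measurability.\<close>

lemma pred_finite_classes:
  "Measurable.pred Eqrel_borel (\<lambda>r :: 'a::countable \<Rightarrow> 'a \<Rightarrow> bool. \<forall>g. finite (eqclass r g))"
proof -
  have "finite (eqclass r g) \<longleftrightarrow> (\<exists>xs::'a list. \<forall>h. r g h \<longrightarrow> h \<in> set xs)" for r :: "'a \<Rightarrow> 'a \<Rightarrow> bool" and g
    unfolding eqclass_def by (auto dest!: finite_list intro: finite_subset [of _ "set _"])
  then show ?thesis by simp
qed

lemma distr_FIRE:
  fixes R :: "'x \<Rightarrow> 'a::{group_add, countable} \<Rightarrow> 'a \<Rightarrow> bool"
  assumes R: "R \<in> measurable M Eqrel_borel" and I: "distr M Eqrel_borel R \<in> IRE"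
    and fin: "AE x in M. \<forall>g. finite (eqclass (R x) g)"
  shows "distr M Eqrel_borel R \<in> FIRE"
proof -
  have "AE r in distr M Eqrel_borel R. \<forall>g. finite (eqclass r g)"
    by (subst AE_distr_iff [OF R]) (use fin pred_finite_classes in \<open>auto simp: pred_def\<close>)
  with I show ?thesis by (simp add: FIRE_def)
qed

subsection \<open>Independent uniform labels\<close>

definition uniform01 :: "real measure" where
  "uniform01 = uniform_measure lborel {0..1}"

lemma sets_uniform01 [simp, measurable_cong]: "sets uniform01 = sets borel"
  and space_uniform01 [simp]: "space uniform01 = UNIV"
  by (simp_all add: uniform01_def)

definition labels :: "('a \<Rightarrow> real) measure" where
  "labels = Pi\<^sub>M UNIV (\<lambda>_. uniform01)"

lemma prob_space_uniform01: "prob_space uniform01"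
  unfolding uniform01_def by (rule prob_space_uniform_measure) auto

lemma prob_space_labels: "prob_space labels"
  unfolding labels_def by (rule prob_space_PiM) (rule prob_space_uniform01)

lemma space_labels [simp]: "space labels = UNIV"
  by (simp add: labels_def space_PiM PiE_UNIV_domain)

lemma measurable_label [measurable]: "(\<lambda>U. U k) \<in> borel_measurable labels"
proof -
  have "(\<lambda>U. U k) \<in> measurable labels uniform01"
    unfolding labels_def by (rule measurable_component_singleton) simp
  also have "measurable labels uniform01 = borel_measurable labels"
    by (rule measurable_cong_sets) simp_all
  finally show ?thesis .
qed

definition shift_labels :: "'a::group_add \<Rightarrow> ('a \<Rightarrow> real) \<Rightarrow> ('a \<Rightarrow> real)" where
  "shift_labels g U = (\<lambda>h. U (- g + h))"

lemma measurable_shift_labels [measurable]: "shift_labels g \<in> measurable labels labels"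
proof -
  have "(\<lambda>U h. U (- g + h)) \<in> measurable labels (Pi\<^sub>M UNIV (\<lambda>_. uniform01))"
  proof (rule measurable_PiM_single')
    show "(\<lambda>U. U (- g + h)) \<in> measurable labels uniform01" for h
      unfolding labels_def by (rule measurable_component_singleton) simp
  qed auto
  then show ?thesis by (simp add: shift_labels_def [abs_def] flip: labels_def)
qed

lemma distr_shift_labels: "distr labels labels (shift_labels g) = labels"
proof -
  have "inj ((+) (- g))" by simp
  from distr_PiM_reindex [where K = UNIV and M = "\<lambda>_. uniform01", OF _ this]
  show ?thesis
    using prob_space_uniform01 by (simp add: shift_labels_def [abs_def] labels_def restrict_UNIV)
qed

lemma emeasure_uniform01_le:
  assumes "0 \<le> a" shows "emeasure uniform01 {..a} = ennreal (min 1 a)"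
proof -
  have "{0..1} \<inter> {..a} = {0..min 1 a}" using assms by auto
  then have "emeasure uniform01 {..a} = ennreal (min 1 a) / ennreal 1"
    using assms by (simp add: uniform01_def)
  then show ?thesis using assms by (simp only: divide_ennreal) simp
qed

lemma emeasure_uniform01_gt:
  assumes "0 \<le> a" shows "emeasure uniform01 {a<..} = ennreal (1 - min 1 a)"
proof -
  interpret prob_space uniform01 by (rule prob_space_uniform01)
  have "measure uniform01 {..a} = min 1 a"
    using emeasure_uniform01_le [OF assms] assms by (simp add: measure_def)
  moreover have "UNIV - {..a} = {a<..}" by auto
  ultimately have "prob {a<..} = 1 - min 1 a" using prob_compl [of "{..a}"] by simp
  then show ?thesis by (simp add: emeasure_eq_measure)
qed

lemma emeasure_labels_Collect:
  fixes A :: "'a \<Rightarrow> real set"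
  assumes "finite K" "\<And>k. k \<in> K \<Longrightarrow> A k \<in> sets borel"
  shows "emeasure labels {U. \<forall>k\<in>K. U k \<in> A k} = (\<Prod>k\<in>K. emeasure uniform01 (A k))"
proof -
  interpret product_prob_space "\<lambda>_. uniform01" UNIV
    by (intro product_prob_spaceI prob_space_uniform01)
  show ?thesis
    using emeasure_PiM_Collect [of K A] assms space_labels [where 'a = 'a] unfolding labels_def by simp
qed

lemma emeasure_label_le:
  assumes "0 \<le> a" shows "emeasure labels {U. U k \<le> a} = ennreal (min 1 a)"
  using emeasure_labels_Collect [of "{k}" "\<lambda>_. {..a}"] emeasure_uniform01_le [OF assms] by simp

text \<open>Independence and \<open>1 - x \<le> exp (- x)\<close>. Thresholds above 1 are harmless,
  since their factor is 0; this matters because \<open>N * pmf p k\<close> may exceed 1.\<close>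

lemma emeasure_labels_gt:
  assumes "finite K" and a: "\<And>k. k \<in> K \<Longrightarrow> 0 \<le> a k"
  shows "emeasure labels {U. \<forall>k\<in>K. a k < U k} \<le> ennreal (exp (- (\<Sum>k\<in>K. a k)))"
proof -
  have "emeasure labels {U. \<forall>k\<in>K. a k < U k} = (\<Prod>k\<in>K. ennreal (1 - min 1 (a k)))"
    using emeasure_labels_Collect [of K "\<lambda>k. {a k<..}"] assms by (simp add: emeasure_uniform01_gt)
  also have "\<dots> = ennreal (\<Prod>k\<in>K. 1 - min 1 (a k))"
    by (rule prod_ennreal) simp
  also have "(\<Prod>k\<in>K. 1 - min 1 (a k)) \<le> (\<Prod>k\<in>K. exp (- a k))"
  proof (rule prod_mono)
    fix k
    have "1 - a k \<le> exp (- a k)" using exp_ge_add_one_self [of "- a k"] by simp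
    then show "0 \<le> 1 - min 1 (a k) \<and> 1 - min 1 (a k) \<le> exp (- a k)"
      by (cases "a k \<le> 1") (auto simp: min_def)
  qed
  also have "\<dots> = exp (- (\<Sum>k\<in>K. a k))"
    using assms(1) by (simp add: exp_sum sum_negf [symmetric])
  finally show ?thesis by (simp add: ennreal_leI)
qed

text \<open>Comparing all thresholds with the same label is a coupling: a label distinguishes two
  thresholds only if it falls between them. Thresholds beyond 1 can only decrease the
  probability.\<close>

lemma emeasure_label_separates:
  assumes "0 \<le> a" "0 \<le> b"
  shows "emeasure labels {U. (U k \<le> a) \<noteq> (U k \<le> b)} \<le> ennreal \<bar>a - b\<bar>"
proof -
  interpret prob_space labels by (rule prob_space_labels)
  have *: "emeasure labels {U. (U k \<le> a) \<noteq> (U k \<le> b)} \<le> ennreal (b - a)" if "0 \<le> a" "a \<le> b" for a b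
  proof -
    have "{U. (U k \<le> a) \<noteq> (U k \<le> b)} = {U. U k \<le> b} - {U. U k \<le> a}" using that by auto
    also have "emeasure labels \<dots> = emeasure labels {U. U k \<le> b} - emeasure labels {U. U k \<le> a}"
    proof (rule emeasure_Diff)
      show "{U. U k \<le> a} \<in> sets labels" "{U. U k \<le> b} \<in> sets labels"
        using measurable_sets [OF measurable_label [of k], of "{..a}"] measurable_sets [OF measurable_label [of k], of "{..b}"]
        by (simp_all add: vimage_def)
    qed (use that in auto)
    also have "\<dots> = ennreal (min 1 b - min 1 a)"
      using that by (simp add: emeasure_label_le ennreal_minus)
    also have "\<dots> \<le> ennreal (b - a)" using that by (intro ennreal_leI) (auto simp: min_def)
    finally show ?thesis .
  qed
  show ?thesis
  proof (cases "a \<le> b")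
    case True then show ?thesis using * [of a b] assms by simp
  next
    case False
    have "{U. (U k \<le> a) \<noteq> (U k \<le> b)} = {U. (U k \<le> b) \<noteq> (U k \<le> a)}" by auto
    then show ?thesis using * [of b a] assms False by simp
  qed
qed

section \<open>Countable sums as integrals over counting measure\<close>

lemma borel_measurable_nn_integral_count_space:
  fixes f :: "'i::countable \<Rightarrow> 'x \<Rightarrow> ennreal"
  assumes "\<And>i. f i \<in> borel_measurable M"
  shows "(\<lambda>x. \<integral>\<^sup>+i. f i x \<partial>count_space UNIV) \<in> borel_measurable M"
proof -
  interpret sigma_finite_measure "count_space (UNIV :: 'i set)"
    by (rule sigma_finite_measure_count_space)
  have "case_prod f \<in> borel_measurable (count_space UNIV \<Otimes>\<^sub>M M)"
    by (rule measurable_pair_measure_countable1) (use assms in auto)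
  then have "(\<lambda>(x, i). f i x) \<in> borel_measurable (M \<Otimes>\<^sub>M count_space UNIV)"
    using measurable_pair_swap_iff [of "\<lambda>(x, i). f i x" M "count_space UNIV" borel] by simp
  then show ?thesis by (rule borel_measurable_nn_integral)
qed

lemma nn_integral_count_space_swap:
  fixes f :: "'i::countable \<Rightarrow> 'x \<Rightarrow> ennreal"
  assumes "\<And>i. f i \<in> borel_measurable M"
  shows "(\<integral>\<^sup>+x. (\<integral>\<^sup>+i. f i x \<partial>count_space UNIV) \<partial>M) = (\<integral>\<^sup>+i. (\<integral>\<^sup>+x. f i x \<partial>M) \<partial>count_space UNIV)"
  by (rule nn_integral_count_space_nn_integral) (use assms in auto)

lemma emeasure_UN_le_nn_integral:
  fixes X :: "'i::countable \<Rightarrow> 'x set"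
  assumes "\<And>i. X i \<in> sets M"
  shows "emeasure M (\<Union>i. X i) \<le> (\<integral>\<^sup>+i. emeasure M (X i) \<partial>count_space UNIV)"
proof -
  have "emeasure M (\<Union>i. X i) = (\<integral>\<^sup>+x. indicator (\<Union>i. X i) x \<partial>M)"
    by (rule nn_integral_indicator [symmetric]) (use assms in blast)
  also have "\<dots> \<le> (\<integral>\<^sup>+x. (\<integral>\<^sup>+i. indicator (X i) x \<partial>count_space UNIV) \<partial>M)"
  proof (rule nn_integral_mono)
    fix x
    show "indicator (\<Union>i. X i) x \<le> (\<integral>\<^sup>+i. indicator (X i) x \<partial>count_space UNIV :: ennreal)"
    proof (cases "x \<in> (\<Union>i. X i)")
      case True
      then obtain i where "x \<in> X i" by blast
      then show ?thesis
        using nn_integral_ge_point [of i UNIV "\<lambda>i. indicator (X i) x"] by (auto simp: indicator_def split: if_splits)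
    qed simp
  qed
  also have "\<dots> = (\<integral>\<^sup>+i. (\<integral>\<^sup>+x. indicator (X i) x \<partial>M) \<partial>count_space UNIV)"
    by (rule nn_integral_count_space_swap) (use assms in simp)
  also have "\<dots> = (\<integral>\<^sup>+i. emeasure M (X i) \<partial>count_space UNIV)"
    using assms by simp
  finally show ?thesis .
qed

lemma l1_dist_eq_nn_integral:
  "ennreal (l1_dist p q) = (\<integral>\<^sup>+k. ennreal \<bar>pmf p k - pmf q k\<bar> \<partial>count_space UNIV)"
proof -
  have "(\<lambda>k. norm \<bar>pmf p k - pmf q k\<bar>) summable_on UNIV"
    using l1_summable_on by simp
  then have "Infinite_Set_Sum.abs_summable_on (\<lambda>k. \<bar>pmf p k - pmf q k\<bar>) UNIV"
    unfolding abs_summable_equivalent [symmetric] .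
  then show ?thesis
    unfolding l1_dist_def
    by (subst nn_integral_conv_infsetsum) (auto simp: infsetsum_infsum)
qed

subsection \<open>Finite approximations of amenable relations\<close>

text \<open>The measure that \<open>lam\<close> assigns to the relation seen from \<open>h\<close>,
  moved back to \<open>h\<close>. The resulting family is equivariant in the pair of
  \<open>r\<close> and \<open>h\<close>, and amenability makes it almost constant on
  classes.\<close>

definition transport :: "(('a::group_add \<Rightarrow> 'a \<Rightarrow> bool) \<Rightarrow> 'a pmf) \<Rightarrow> ('a \<Rightarrow> 'a \<Rightarrow> bool) \<Rightarrow> 'a \<Rightarrow> 'a pmf" where
  "transport lam r h = translate h (lam (shift (- h) r))"

lemma pmf_transport: "pmf (transport lam r h) k = pmf (lam (shift (- h) r)) (- h + k)"
  by (simp add: transport_def pmf_translate)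

lemma transport_shift: "transport lam (shift g r) h = translate g (transport lam r (- g + h))"
  by (simp add: transport_def shift_shift translate_translate minus_add)

lemma measurable_transport:
  fixes lam :: "('a::{group_add, countable} \<Rightarrow> 'a \<Rightarrow> bool) \<Rightarrow> 'a pmf"
  assumes "lam \<in> measurable Eqrel_borel Prob_borel"
  shows "(\<lambda>r. transport lam r h) \<in> measurable Eqrel_borel Prob_borel"
  unfolding transport_def
  by (intro measurable_translate measurable_compose [OF shift_measurable assms])

locale random_clustering =
  fixes \<rho> :: "('a::{group_add, countable} \<Rightarrow> 'a \<Rightarrow> bool) measure"
    and lam :: "('a \<Rightarrow> 'a \<Rightarrow> bool) \<Rightarrow> 'a pmf" and N :: real
  assumes \<rho>: "\<rho> \<in> IRE" and lam: "lam \<in> measurable Eqrel_borel Prob_borel" and N: "0 < N"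
begin

text \<open>For fixed \<open>r\<close> and \<open>h\<close> the point \<open>k\<close> is hit with
  probability \<open>min 1 (N * pmf (transport lam r h) k)\<close>. Since all \<open>h\<close> share
  the same labels, nearby measures tend to have equal hit sets.\<close>

definition hits :: "('a \<Rightarrow> 'a \<Rightarrow> bool) \<times> ('a \<Rightarrow> real) \<Rightarrow> 'a \<Rightarrow> 'a set" where
  "hits x h = {k. snd x k \<le> N * pmf (transport lam (fst x) h) k}"

text \<open>Related points with empty hit sets would share them and could form an infinite piece.
  They are made singletons instead, which is the role of the equality disjunct.\<close>

definition cluster :: "('a \<Rightarrow> 'a \<Rightarrow> bool) \<times> ('a \<Rightarrow> real) \<Rightarrow> 'a \<Rightarrow> 'a \<Rightarrow> bool" where
  "cluster x = (\<lambda>h h'. h = h' \<or> fst x h h' \<and> hits x h \<noteq> {} \<and> hits x h = hits x h')"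

abbreviation "M \<equiv> \<rho> \<Otimes>\<^sub>M (labels :: ('a \<Rightarrow> real) measure)"

lemma \<rho>_sets [simp, measurable_cong]: "sets \<rho> = sets Eqrel_borel"
  and \<rho>_space [simp]: "space \<rho> = Eqrel"
  using Prob_EqrelD [OF IRE_Prob_Eqrel [OF \<rho>]] by auto

sublocale \<rho>: prob_space \<rho>
  using Prob_EqrelD [OF IRE_Prob_Eqrel [OF \<rho>]] by auto

sublocale L: prob_space "labels :: ('a \<Rightarrow> real) measure"
  by (rule prob_space_labels)

sublocale pair_prob_space \<rho> "labels :: ('a \<Rightarrow> real) measure" ..

lemma measurable_\<rho>: "measurable \<rho> K = measurable Eqrel_borel K"
  by (rule measurable_cong_sets) simp_all

lemma measurable_pmf_lam [measurable]: "(\<lambda>r. pmf (lam r) k) \<in> borel_measurable \<rho>"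
  using lam unfolding measurable_\<rho> measurable_Prob_borel_iff by blast

lemma measurable_mass [measurable]: "(\<lambda>r. pmf (transport lam r h) k) \<in> borel_measurable \<rho>"
  using measurable_transport [OF lam] unfolding measurable_\<rho> measurable_Prob_borel_iff by blast

lemma measurable_in_hits [measurable]: "Measurable.pred M (\<lambda>x. k \<in> hits x h)"
  unfolding hits_def mem_Collect_eq by measurable

lemma measurable_fst_coordinate [measurable]: "Measurable.pred M (\<lambda>x. fst x a b)"
  by (rule measurable_compose [OF measurable_fst]) measurable

lemma measurable_cluster_coordinate: "Measurable.pred M (\<lambda>x. cluster x h h')"
proof -
  have "cluster x h h' \<longleftrightarrow> h = h' \<or> fst x h h' \<and> (\<exists>k. k \<in> hits x h) \<and> (\<forall>k. k \<in> hits x h \<longleftrightarrow> k \<in> hits x h')" for x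
    by (auto simp: cluster_def)
  then show ?thesis by simp
qed

lemma measurable_cluster: "cluster \<in> measurable M Eqrel_borel"
proof (rule measurable_Eqrel_borelI [OF _ measurable_cluster_coordinate])
  fix x assume "x \<in> space M"
  then have "equivp (fst x)" by (auto simp: space_pair_measure Eqrel_def)
  then show "cluster x \<in> Eqrel"
    unfolding Eqrel_def mem_Collect_eq
    by (intro equivpI reflpI sympI transpI)
       (auto simp: cluster_def dest: equivp_symp equivp_transp)
qed

definition act :: "'a \<Rightarrow> ('a \<Rightarrow> 'a \<Rightarrow> bool) \<times> ('a \<Rightarrow> real) \<Rightarrow> ('a \<Rightarrow> 'a \<Rightarrow> bool) \<times> ('a \<Rightarrow> real)" where
  "act g = (\<lambda>(r, U). (shift g r, shift_labels g U))"

lemma hits_act: "hits (act g x) h = (+) g ` hits x (- g + h)"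
proof -
  have *: "k \<in> (+) g ` S" if "- g + k \<in> S" for k and S :: "'a set"
    by (rule image_eqI [OF _ that]) (simp add: add.assoc [symmetric])
  have **: "- g + k \<in> S" if "k \<in> (+) g ` S" for k and S :: "'a set"
    using that by (elim imageE) (simp add: add.assoc [symmetric])
  have "k \<in> hits (act g x) h \<longleftrightarrow> - g + k \<in> hits x (- g + h)" for k
    unfolding hits_def act_def case_prod_beta fst_conv snd_conv shift_labels_def transport_shift pmf_translate
      mem_Collect_eq by (rule refl)
  then show ?thesis using * ** by blast
qed

lemma cluster_act: "cluster (act g x) = shift g (cluster x)"
proof (intro ext)
  fix h h'
  have inj: "inj ((+) g)" by simp
  show "cluster (act g x) h h' = shift g (cluster x) h h'"
    unfolding cluster_def hits_act inj_image_eq_iff [OF inj] image_is_empty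
    by (simp add: act_def shift_def case_prod_beta)
qed

lemma measurable_act: "act g \<in> measurable M M"
  unfolding act_def case_prod_beta
  by (intro measurable_Pair measurable_compose [OF measurable_fst] measurable_compose [OF measurable_snd]
      measurable_shift_labels Prob_Eqrel_measurable_shift IRE_Prob_Eqrel \<rho>)

lemma distr_act: "distr M M (act g) = M"
proof -
  have s: "distr \<rho> \<rho> (shift g) = \<rho>" using \<rho> by (simp add: IRE_def)
  have "distr \<rho> \<rho> (shift g) \<Otimes>\<^sub>M distr labels labels (shift_labels g) = distr M M (act g)"
    unfolding act_def
    by (rule pair_measure_distr)
       (simp_all add: Prob_Eqrel_measurable_shift IRE_Prob_Eqrel \<rho> measurable_shift_labels distr_shift_labels L.sigma_finite_measure)
  then show ?thesis by (simp only: s distr_shift_labels)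
qed

lemma cluster_IRE: "distr M Eqrel_borel cluster \<in> IRE"
  by (rule distr_IRE [OF _ measurable_cluster measurable_act distr_act]) (auto intro: cluster_act prob_space_axioms)

lemma emeasure_M_fibre:
  assumes "A \<in> sets M"
  shows "emeasure M A = (\<integral>\<^sup>+r. emeasure labels {U. (r, U) \<in> A} \<partial>\<rho>)"
  using L.emeasure_pair_measure_alt [OF assms] by (simp add: vimage_def)

text \<open>Mass transport: the expected number of points hitting a given label is at most \<open>N\<close>.\<close>

lemma AE_finite_hitters: "AE x in M. finite {h. k \<in> hits x h}"
proof -
  have sets: "{x \<in> space M. k \<in> hits x h} \<in> sets M" for h by measurable
  have "(\<integral>\<^sup>+x. (\<integral>\<^sup>+h. indicator {x \<in> space M. k \<in> hits x h} x \<partial>count_space UNIV) \<partial>M)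
      = (\<integral>\<^sup>+h. emeasure M {x \<in> space M. k \<in> hits x h} \<partial>count_space UNIV)"
    by (subst nn_integral_count_space_swap) (use sets in auto)
  also have "\<dots> \<le> (\<integral>\<^sup>+h. (\<integral>\<^sup>+r. ennreal N * ennreal (pmf (lam r) (- h + k)) \<partial>\<rho>) \<partial>count_space UNIV)"
  proof (rule nn_integral_mono)
    fix h
    have "emeasure M {x \<in> space M. k \<in> hits x h} = (\<integral>\<^sup>+r. emeasure labels {U. (r, U) \<in> {x \<in> space M. k \<in> hits x h}} \<partial>\<rho>)"
      by (rule emeasure_M_fibre [OF sets])
    also have "\<dots> = (\<integral>\<^sup>+r. emeasure labels {U. U k \<le> N * pmf (transport lam r h) k} \<partial>\<rho>)"
      by (intro nn_integral_cong arg_cong [of _ _ "emeasure labels"]) (auto simp: hits_def space_pair_measure)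
    also have "\<dots> \<le> (\<integral>\<^sup>+r. ennreal N * ennreal (pmf (lam (shift (- h) r)) (- h + k)) \<partial>\<rho>)"
      using N by (intro nn_integral_mono) (auto simp: emeasure_label_le pmf_transport ennreal_mult [symmetric] intro!: ennreal_leI)
    \<comment> \<open>Invariance moves the base point from \<open>h\<close> to the identity: what
      \<open>h\<close> sends to \<open>k\<close> is, on average, what the identity sends to
      \<open>- h + k\<close>. The sum over \<open>h\<close> then becomes the total mass sent by the
      identity, namely \<open>N\<close>.\<close>
    also have "\<dots> = (\<integral>\<^sup>+r. ennreal N * ennreal (pmf (lam r) (- h + k)) \<partial>\<rho>)"
      by (rule IRE_nn_integral_shift [OF \<rho>, of "\<lambda>r. ennreal N * ennreal (pmf (lam r) (- h + k))"]) measurable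
    finally show "emeasure M {x \<in> space M. k \<in> hits x h} \<le> (\<integral>\<^sup>+r. ennreal N * ennreal (pmf (lam r) (- h + k)) \<partial>\<rho>)" .
  qed
  also have "\<dots> = (\<integral>\<^sup>+r. (\<integral>\<^sup>+h. ennreal N * ennreal (pmf (lam r) (- h + k)) \<partial>count_space UNIV) \<partial>\<rho>)"
    by (rule nn_integral_count_space_swap [symmetric]) measurable
  also have "\<dots> = (\<integral>\<^sup>+r. ennreal N \<partial>\<rho>)"
  proof (rule nn_integral_cong)
    fix r
    have bij: "bij_betw (\<lambda>h. - h + k) UNIV (UNIV :: 'a set)"
      by (rule bij_betwI [where g = "\<lambda>h. k - h"]) (auto simp: add.assoc diff_conv_add_uminus minus_add simp del: add_uminus_conv_diff)
    have "(\<integral>\<^sup>+h. ennreal N * ennreal (pmf (lam r) (- h + k)) \<partial>count_space UNIV)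
        = (\<integral>\<^sup>+h. ennreal N * ennreal (pmf (lam r) h) \<partial>count_space UNIV)"
      by (rule nn_integral_bij_count_space [OF bij, of "\<lambda>h. ennreal N * ennreal (pmf (lam r) h)"])
    also have "\<dots> = ennreal N * (\<integral>\<^sup>+h. ennreal (pmf (lam r) h) \<partial>count_space UNIV)"
      by (rule nn_integral_cmult) simp
    also have "(\<integral>\<^sup>+h. ennreal (pmf (lam r) h) \<partial>count_space UNIV) = 1"
      by (simp add: nn_integral_pmf)
    finally show "(\<integral>\<^sup>+h. ennreal N * ennreal (pmf (lam r) (- h + k)) \<partial>count_space UNIV) = ennreal N" by simp
  qed
  also have "\<dots> < \<infinity>" by (simp add: \<rho>.emeasure_space_1 less_top [symmetric] ennreal_mult_eq_top_iff)
  finally have fin: "(\<integral>\<^sup>+x. (\<integral>\<^sup>+h. indicator {x \<in> space M. k \<in> hits x h} x \<partial>count_space UNIV) \<partial>M) \<noteq> \<infinity>"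
    by simp
  have "AE x in M. (\<integral>\<^sup>+h. indicator {x \<in> space M. k \<in> hits x h} x \<partial>count_space UNIV) \<noteq> (\<infinity>::ennreal)"
  proof (rule nn_integral_PInf_AE [OF _ fin])
    show "(\<lambda>x. \<integral>\<^sup>+h. indicator {x \<in> space M. k \<in> hits x h} x \<partial>count_space UNIV) \<in> borel_measurable M"
      by (rule borel_measurable_nn_integral_count_space) (use sets in simp)
  qed
  then show ?thesis
  proof (rule AE_mp, intro AE_I2 impI)
    fix x assume x: "x \<in> space M" and "(\<integral>\<^sup>+h. indicator {x \<in> space M. k \<in> hits x h} x \<partial>count_space UNIV) \<noteq> (\<infinity>::ennreal)"
    moreover have "(\<integral>\<^sup>+h. indicator {x \<in> space M. k \<in> hits x h} x \<partial>count_space UNIV)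
        = (\<integral>\<^sup>+h. indicator {h. k \<in> hits x h} h \<partial>count_space UNIV)"
      using x by (intro nn_integral_cong) (auto simp: indicator_def)
    moreover have "\<dots> = emeasure (count_space UNIV) {h. k \<in> hits x h}" by simp
    ultimately show "finite {h. k \<in> hits x h}"
      by (auto simp: emeasure_count_space split: if_splits)
  qed
qed

end

lemma sets_labels_le [measurable]: "Measurable.pred labels (\<lambda>U. U k \<le> (a::real))"
  by measurable

text \<open>A union bound. The two sets differ only if some label falls between
  \<open>N * pmf p k\<close> and \<open>N * pmf q k\<close>; these events have total probability at
  most \<open>N * l1_dist p q\<close>. Emptiness is tested on a finite \<open>K\<close> carrying
  more than half of the mass of \<open>p\<close>, because independence is available for finitely
  many labels; this explains the exponent \<open>- N / 2\<close>.\<close>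

lemma emeasure_labels_differ:
  fixes p q :: "'a::countable pmf"
  assumes N: "0 < N"
  shows "emeasure labels {U. (\<forall>k. N * pmf p k < U k) \<or> {k. U k \<le> N * pmf p k} \<noteq> {k. U k \<le> N * pmf q k}}
    \<le> ennreal (exp (- N / 2)) + ennreal N * ennreal (l1_dist p q)"
proof -
  let ?X = "\<lambda>k. {U :: 'a \<Rightarrow> real. (U k \<le> N * pmf p k) \<noteq> (U k \<le> N * pmf q k)}"
  have X: "?X k \<in> sets labels" for k
  proof -
    have "{U \<in> space labels. (U k \<le> N * pmf p k) \<noteq> (U k \<le> N * pmf q k)} \<in> sets labels" by measurable
    then show ?thesis by simp
  qed
  obtain K where K: "finite K" "1 - 1/2 < (\<Sum>k\<in>K. pmf p k)"
    using pmf_finite_mass [of "1/2" p] by auto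
  let ?Y = "{U :: 'a \<Rightarrow> real. \<forall>k\<in>K. N * pmf p k < U k}"
  have Y: "?Y \<in> sets labels"
  proof -
    have "{U \<in> space labels. \<forall>k\<in>K. N * pmf p k < U k} \<in> sets labels" by measurable
    then show ?thesis by simp
  qed
  have "emeasure labels {U. (\<forall>k. N * pmf p k < U k) \<or> {k. U k \<le> N * pmf p k} \<noteq> {k. U k \<le> N * pmf q k}}
      \<le> emeasure labels (?Y \<union> (\<Union>k. ?X k))"
    by (rule emeasure_mono) (use X Y in auto)
  also have "\<dots> \<le> emeasure labels ?Y + emeasure labels (\<Union>k. ?X k)"
    by (rule emeasure_subadditive) (use X Y in auto)
  also have "emeasure labels ?Y \<le> ennreal (exp (- N / 2))"
  proof -
    have "emeasure labels ?Y \<le> ennreal (exp (- (\<Sum>k\<in>K. N * pmf p k)))"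
      using N by (intro emeasure_labels_gt K) auto
    also have "N / 2 \<le> (\<Sum>k\<in>K. N * pmf p k)"
      using K(2) N by (simp add: sum_distrib_left [symmetric] field_simps)
    then have "ennreal (exp (- (\<Sum>k\<in>K. N * pmf p k))) \<le> ennreal (exp (- N / 2))"
      by (intro ennreal_leI) simp
    finally show ?thesis .
  qed
  also have "emeasure labels (\<Union>k. ?X k) \<le> (\<integral>\<^sup>+k. emeasure labels (?X k) \<partial>count_space UNIV)"
    by (rule emeasure_UN_le_nn_integral) (rule X)
  also have "\<dots> \<le> (\<integral>\<^sup>+k. ennreal N * ennreal \<bar>pmf p k - pmf q k\<bar> \<partial>count_space UNIV)"
  proof (rule nn_integral_mono)
    fix k
    have "emeasure labels (?X k) \<le> ennreal \<bar>N * pmf p k - N * pmf q k\<bar>"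
      using N by (intro emeasure_label_separates) auto
    also have "\<bar>N * pmf p k - N * pmf q k\<bar> = N * \<bar>pmf p k - pmf q k\<bar>"
      using N by (simp add: abs_mult flip: right_diff_distrib)
    finally show "emeasure labels (?X k) \<le> ennreal N * ennreal \<bar>pmf p k - pmf q k\<bar>"
      using N by (simp add: ennreal_mult)
  qed
  also have "\<dots> = ennreal N * ennreal (l1_dist p q)"
    unfolding l1_dist_eq_nn_integral by (rule nn_integral_cmult) simp
  finally show ?thesis by (simp add: add_mono)
qed

context random_clustering
begin

lemma cluster_FIRE: "distr M Eqrel_borel cluster \<in> FIRE"
proof (rule distr_FIRE [OF measurable_cluster cluster_IRE])
  have "AE x in M. \<forall>k. finite {h. k \<in> hits x h}"
    unfolding AE_all_countable using AE_finite_hitters by blast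
  then show "AE x in M. \<forall>g. finite (eqclass (cluster x) g)"
  proof (rule AE_mp, intro AE_I2 impI allI)
    fix x g assume *: "\<forall>k. finite {h. k \<in> hits x h}"
    show "finite (eqclass (cluster x) g)"
    proof (cases "hits x g = {}")
      case True
      then have "eqclass (cluster x) g \<subseteq> {g}" by (auto simp: eqclass_def cluster_def)
      then show ?thesis by (rule finite_subset) simp
    next
      case False
      then obtain k where k: "k \<in> hits x g" by blast
      then have "eqclass (cluster x) g \<subseteq> {h. k \<in> hits x h}" by (auto simp: eqclass_def cluster_def)
      then show ?thesis by (rule finite_subset) (use * in blast)
    qed
  qed
qed

lemma emeasure_not_joined:
  "emeasure M {x \<in> space M. fst x a b \<and> \<not> cluster x a b} \<le> ennreal (exp (- N / 2)) +
    ennreal N * (\<integral>\<^sup>+r. (if r a b then ennreal (l1_dist (transport lam r a) (transport lam r b)) else 0) \<partial>\<rho>)"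
proof -
  let ?l = "\<lambda>r. if r a b then ennreal (l1_dist (transport lam r a) (transport lam r b)) else 0"
  have [measurable]: "Measurable.pred M (\<lambda>x. cluster x a b)" by (rule measurable_cluster_coordinate)
  have [measurable]: "(\<lambda>r. l1_dist (transport lam r a) (transport lam r b)) \<in> borel_measurable \<rho>"
    unfolding measurable_\<rho> by (intro borel_measurable_l1_dist measurable_transport lam)
  have [measurable]: "?l \<in> borel_measurable \<rho>" by measurable
  have sets: "{x \<in> space M. fst x a b \<and> \<not> cluster x a b} \<in> sets M" by measurable
  have "emeasure M {x \<in> space M. fst x a b \<and> \<not> cluster x a b}
      = (\<integral>\<^sup>+r. emeasure labels {U. (r, U) \<in> {x \<in> space M. fst x a b \<and> \<not> cluster x a b}} \<partial>\<rho>)"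
    by (rule emeasure_M_fibre [OF sets])
  also have "\<dots> \<le> (\<integral>\<^sup>+r. ennreal (exp (- N / 2)) + ennreal N * ?l r \<partial>\<rho>)"
  proof (rule nn_integral_mono)
    fix r assume "r \<in> space \<rho>"
    let ?p = "transport lam r a" and ?q = "transport lam r b"
    show "emeasure labels {U. (r, U) \<in> {x \<in> space M. fst x a b \<and> \<not> cluster x a b}} \<le> ennreal (exp (- N / 2)) + ennreal N * ?l r"
    proof (cases "r a b")
      case True
      have S: "{U \<in> space labels. (\<forall>k. N * pmf ?p k < U k) \<or> (\<exists>k. (U k \<le> N * pmf ?p k) \<noteq> (U k \<le> N * pmf ?q k))} \<in> sets labels"
        by measurable
      have "emeasure labels {U. (r, U) \<in> {x \<in> space M. fst x a b \<and> \<not> cluster x a b}}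
         \<le> emeasure labels {U. (\<forall>k. N * pmf ?p k < U k) \<or> {k. U k \<le> N * pmf ?p k} \<noteq> {k. U k \<le> N * pmf ?q k}}"
      proof (rule emeasure_mono)
        show "{U. (r, U) \<in> {x \<in> space M. fst x a b \<and> \<not> cluster x a b}} \<subseteq>
            {U. (\<forall>k. N * pmf ?p k < U k) \<or> {k. U k \<le> N * pmf ?p k} \<noteq> {k. U k \<le> N * pmf ?q k}}"
          by (auto simp: cluster_def hits_def not_less [symmetric] simp del: not_less)
        have "{U. (\<forall>k. N * pmf ?p k < U k) \<or> {k. U k \<le> N * pmf ?p k} \<noteq> {k. U k \<le> N * pmf ?q k}} =
          {U \<in> space labels. (\<forall>k. N * pmf ?p k < U k) \<or> (\<exists>k. (U k \<le> N * pmf ?p k) \<noteq> (U k \<le> N * pmf ?q k))}"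
          unfolding set_eq_iff mem_Collect_eq space_labels by blast
        with S show "{U. (\<forall>k. N * pmf ?p k < U k) \<or> {k. U k \<le> N * pmf ?p k} \<noteq> {k. U k \<le> N * pmf ?q k}} \<in> sets labels"
          by simp
      qed
      also have "\<dots> \<le> ennreal (exp (- N / 2)) + ennreal N * ennreal (l1_dist ?p ?q)"
        by (rule emeasure_labels_differ [OF N])
      finally show ?thesis using True by simp
    qed simp
  qed
  also have "\<dots> = ennreal (exp (- N / 2)) + ennreal N * (\<integral>\<^sup>+r. ?l r \<partial>\<rho>)"
    using \<rho>.emeasure_space_1 by (subst nn_integral_add) (auto simp: nn_integral_cmult)
  finally show ?thesis .
qed

text \<open>Clusters refine the given relation, so on the window \<open>F\<close> the two can
  disagree only by separating a related pair of \<open>F\<close>; the events are summed over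
  \<open>F\<close>.\<close>

lemma cluster_cylinder_close:
  fixes \<delta> :: real
  assumes C: "finite F" "local_on F (\<lambda>r. r \<in> C)" "C \<in> cylinders" and \<delta>: "0 \<le> \<delta>"
    and F: "\<And>a b. (a, b) \<in> F \<Longrightarrow> emeasure M {x \<in> space M. fst x a b \<and> \<not> cluster x a b} \<le> ennreal \<delta>"
  shows "\<bar>measure (distr M Eqrel_borel cluster) C - measure \<rho> C\<bar> \<le> card F * \<delta>"
proof -
  have [measurable]: "Measurable.pred M (\<lambda>x. cluster x a b)" for a b by (rule measurable_cluster_coordinate)
  have CS: "C \<in> sets Eqrel_borel" using C(3) cylinders_subset_sets by blast
  have CE: "C \<subseteq> Eqrel" using C(3) cyl.space_closed by blast
  let ?A = "cluster -` C \<inter> space M" and ?B = "fst -` C \<inter> space M"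
  let ?D = "\<lambda>x. {y \<in> space M. fst y (fst x) (snd x) \<and> \<not> cluster y (fst x) (snd x)}"
  have A: "?A \<in> sets M" by (rule measurable_sets [OF measurable_cluster CS])
  have B: "?B \<in> sets M" by (rule measurable_sets [OF measurable_fst]) (use CS in simp)
  have D: "?D x \<in> sets M" for x by measurable
  have 1: "measure (distr M Eqrel_borel cluster) C = prob ?A"
    by (rule measure_distr [OF measurable_cluster CS])
  have "?B = C \<times> space labels" using CE by (auto simp: space_pair_measure)
  then have "emeasure M ?B = emeasure \<rho> C"
    using CS L.emeasure_pair_measure_Times [of C \<rho> "space labels"] L.emeasure_space_1
      sets.top [of "labels :: ('a \<Rightarrow> real) measure"] by simp
  then have 2: "measure \<rho> C = prob ?B" by (simp add: measure_def)
  have sub: "sym_diff ?A ?B \<subseteq> (\<Union>x\<in>F. ?D x)"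
  proof (rule ccontr)
    assume "\<not> ?thesis"
    then obtain y where y: "y \<in> space M" "(cluster y \<in> C) \<noteq> (fst y \<in> C)" "\<forall>x\<in>F. y \<notin> ?D x" by blast
    have "cluster y a b = fst y a b" if "(a, b) \<in> F" for a b
    proof -
      have "fst y \<in> Eqrel" using y(1) by (auto simp: space_pair_measure)
      then have "fst y a a" by (simp add: Eqrel_def equivp_reflp)
      then show ?thesis using bspec [OF y(3) that] y(1) by (auto simp: cluster_def)
    qed
    then have "window F (cluster y) = window F (fst y)" unfolding window_eq_iff by blast
    moreover have "cluster y \<in> Eqrel" "fst y \<in> Eqrel"
      using measurable_space [OF measurable_cluster y(1)] y(1) by (auto simp: space_pair_measure)
    ultimately show False using local_onD [OF C(2)] y(2) by blast
  qed
  have "\<bar>prob ?A - prob ?B\<bar> \<le> prob (sym_diff ?A ?B)"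
  proof -
    have "prob ?A \<le> prob (?B \<union> sym_diff ?A ?B)" "prob ?B \<le> prob (?A \<union> sym_diff ?A ?B)"
      using A B by (auto intro!: finite_measure_mono)
    moreover have "prob (?B \<union> sym_diff ?A ?B) \<le> prob ?B + prob (sym_diff ?A ?B)"
      "prob (?A \<union> sym_diff ?A ?B) \<le> prob ?A + prob (sym_diff ?A ?B)"
      using A B by (auto intro!: measure_Un_le)
    ultimately show ?thesis by linarith
  qed
  also have "\<dots> \<le> prob (\<Union>x\<in>F. ?D x)"
    using D C(1) by (intro finite_measure_mono sub) auto
  also have "\<dots> \<le> (\<Sum>x\<in>F. prob (?D x))"
    using D C(1) by (intro measure_UNION_le) auto
  also have "\<dots> \<le> (\<Sum>x\<in>F. \<delta>)"
  proof (rule sum_mono)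
    fix x assume "x \<in> F"
    then have "emeasure M (?D x) \<le> ennreal \<delta>" using F [of "fst x" "snd x"] by simp
    then show "prob (?D x) \<le> \<delta>" using \<delta> by (simp add: emeasure_eq_measure)
  qed
  finally show ?thesis by (simp add: 1 2)
qed

end

section \<open>Integrated asymmetry and the approximating sequence\<close>

text \<open>The defect in the definition of \<open>AIRE\<close>, set to 0 when \<open>g\<close> is
  outside the class of the identity. It is bounded by 2, so dominated convergence turns almost sure
  convergence into convergence of integrals.\<close>

definition asymmetry :: "(('a::{group_add, countable} \<Rightarrow> 'a \<Rightarrow> bool) \<Rightarrow> 'a pmf) \<Rightarrow> 'a \<Rightarrow> ('a \<Rightarrow> 'a \<Rightarrow> bool) \<Rightarrow> real" where
  "asymmetry lam g r = (if r 0 g then l1_dist (translate (- g) (lam r)) (lam (shift (- g) r)) else 0)"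

lemma asymmetry_bounds: "0 \<le> asymmetry lam g r" "asymmetry lam g r \<le> 2"
  by (simp_all add: asymmetry_def l1_dist_le_2)

lemma measurable_asymmetry:
  assumes "lam \<in> measurable Eqrel_borel Prob_borel"
  shows "asymmetry lam g \<in> borel_measurable Eqrel_borel"
proof -
  have [measurable]: "(\<lambda>r. l1_dist (translate (- g) (lam r)) (lam (shift (- g) r))) \<in> borel_measurable Eqrel_borel"
    by (intro borel_measurable_l1_dist measurable_translate assms measurable_compose [OF shift_measurable])
  show ?thesis unfolding asymmetry_def [abs_def] by measurable
qed

lemma AIRE_asymmetry_tendsto:
  assumes "\<rho> \<in> AIRE"
  obtains lam where "\<And>n. lam n \<in> measurable Eqrel_borel Prob_borel"
    "\<And>g. (\<lambda>n. \<integral>r. asymmetry (lam n) g r \<partial>\<rho>) \<longlonglongrightarrow> 0"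
proof -
  from assms have \<rho>: "\<rho> \<in> IRE" by (simp add: AIRE_def)
  from assms obtain lam where lam: "\<And>n. lam n \<in> measurable Eqrel_borel Prob_borel"
    and AE: "AE r in \<rho>. \<forall>g\<in>eqclass r 0. (\<lambda>n. l1_dist (translate (- g) (lam n r)) (lam n (shift (- g) r))) \<longlonglongrightarrow> 0"
    unfolding AIRE_def by blast
  note P = Prob_EqrelD [OF IRE_Prob_Eqrel [OF \<rho>]]
  interpret prob_space \<rho> by (rule P)
  have m: "asymmetry (lam n) g \<in> borel_measurable \<rho>" for n g
    using measurable_asymmetry [OF lam] measurable_cong_sets [OF P(2) refl] by blast
  have "(\<lambda>n. \<integral>r. asymmetry (lam n) g r \<partial>\<rho>) \<longlonglongrightarrow> (\<integral>r. 0 \<partial>\<rho>)" for g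
  proof (rule integral_dominated_convergence [where w = "\<lambda>_. 2"])
    show "AE r in \<rho>. (\<lambda>n. asymmetry (lam n) g r) \<longlonglongrightarrow> 0"
      using AE
    proof eventually_elim
      case (elim r)
      then show ?case by (cases "r 0 g") (auto simp: asymmetry_def eqclass_def)
    qed
    show "AE r in \<rho>. norm (asymmetry (lam n) g r) \<le> 2" for n
      using asymmetry_bounds [of "lam n" g] by simp
  qed (use m in auto)
  then have "\<And>g. (\<lambda>n. \<integral>r. asymmetry (lam n) g r \<partial>\<rho>) \<longlonglongrightarrow> 0" by simp
  from that [OF lam this] show ?thesis .
qed

text \<open>Seen from \<open>a\<close>, the pair of \<open>a\<close> and \<open>b\<close> becomes
  the pair of the identity and \<open>- a + b\<close>; invariance reduces every pair to this
  case.\<close>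

lemma nn_integral_transport:
  assumes \<rho>: "\<rho> \<in> IRE" and lam: "lam \<in> measurable Eqrel_borel Prob_borel"
  shows "(\<integral>\<^sup>+r. (if r a b then ennreal (l1_dist (transport lam r a) (transport lam r b)) else 0) \<partial>\<rho>)
    = ennreal (\<integral>r. asymmetry lam (- a + b) r \<partial>\<rho>)"
proof -
  note P = Prob_EqrelD [OF IRE_Prob_Eqrel [OF \<rho>]]
  interpret prob_space \<rho> by (rule P)
  have m: "asymmetry lam g \<in> borel_measurable \<rho>" for g
    using measurable_asymmetry [OF lam] measurable_cong_sets [OF P(2) refl] by blast
  have "(if r a b then ennreal (l1_dist (transport lam r a) (transport lam r b)) else 0)
      = ennreal (asymmetry lam (- a + b) (shift (- a) r))" for r
  proof -
    have "shift (- a) r 0 (- a + b) = r a b" by (simp add: shift_def add.assoc [symmetric])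
    moreover have "shift (- (- a + b)) (shift (- a) r) = shift (- b) r"
      by (simp only: shift_shift minus_add minus_minus add.assoc add.right_inverse add.right_neutral)
    moreover have "l1_dist (transport lam r a) (transport lam r b)
        = l1_dist (translate (- (- a + b)) (lam (shift (- a) r))) (lam (shift (- b) r))"
      unfolding transport_def
      by (simp only: l1_dist_translate_left translate_translate minus_add minus_minus)
    ultimately show ?thesis by (simp add: asymmetry_def)
  qed
  then have "(\<integral>\<^sup>+r. (if r a b then ennreal (l1_dist (transport lam r a) (transport lam r b)) else 0) \<partial>\<rho>)
      = (\<integral>\<^sup>+r. ennreal (asymmetry lam (- a + b) (shift (- a) r)) \<partial>\<rho>)" by simp
  also have "\<dots> = (\<integral>\<^sup>+r. ennreal (asymmetry lam (- a + b) r) \<partial>\<rho>)"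
    by (rule IRE_nn_integral_shift [OF \<rho>, of "\<lambda>r. ennreal (asymmetry lam (- a + b) r)"]) (use m in measurable)
  also have "\<dots> = ennreal (\<integral>r. asymmetry lam (- a + b) r \<partial>\<rho>)"
    by (rule nn_integral_eq_integral)
       (auto intro!: integrable_const_bound [where B = 2] m simp: asymmetry_bounds)
  finally show ?thesis .
qed

theorem AIRE_subset_closure_FIRE:
  "(AIRE :: ('a::{group_add, countable} \<Rightarrow> 'a \<Rightarrow> bool) measure set) \<subseteq> IRE_topology closure_of FIRE"
proof
  fix \<rho> :: "('a \<Rightarrow> 'a \<Rightarrow> bool) measure" assume A: "\<rho> \<in> AIRE"
  then have \<rho>: "\<rho> \<in> IRE" by (simp add: AIRE_def)
  obtain lam where lam: "\<And>n. lam n \<in> measurable Eqrel_borel Prob_borel"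
    and lim: "\<And>g. (\<lambda>n. \<integral>r. asymmetry (lam n) g r \<partial>\<rho>) \<longlonglongrightarrow> 0"
    using AIRE_asymmetry_tendsto [OF A] by blast
  define P :: "nat \<Rightarrow> ('a \<times> 'a) set" where "P m = from_nat ` {..<m}" for m
  \<comment> \<open>The tolerance anticipates \<open>N m = 2 * (m + 1)\<close>: then
    \<open>exp (- N m / 2)\<close> and \<open>N m\<close> times the asymmetry are both at most
    \<open>1 / (m + 1)\<close>. Increasing \<open>N\<close> alone would make the second term large,
    so the kernel is chosen after \<open>m\<close>.\<close>
  have "\<exists>n. \<forall>(a, b)\<in>P m. (\<integral>r. asymmetry (lam n) (- a + b) r \<partial>\<rho>) < 1 / (2 * (real m + 1) * (real m + 1))" for m :: nat
  proof -
    have "\<forall>\<^sub>F n in sequentially. (\<integral>r. asymmetry (lam n) (- fst x + snd x) r \<partial>\<rho>) < 1 / (2 * (real m + 1) * (real m + 1))" for x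
      by (rule order_tendstoD(2) [OF lim]) (simp add: add_pos_nonneg)
    then have "\<forall>\<^sub>F n in sequentially. \<forall>x\<in>P m. (\<integral>r. asymmetry (lam n) (- fst x + snd x) r \<partial>\<rho>) < 1 / (2 * (real m + 1) * (real m + 1))"
      by (intro eventually_ball_finite) (auto simp: P_def)
    then show ?thesis using eventually_happens' [OF sequentially_bot] by (auto simp: case_prod_beta)
  qed
  then have "\<exists>n. \<forall>m. \<forall>(a, b)\<in>P m. (\<integral>r. asymmetry (lam (n m)) (- a + b) r \<partial>\<rho>) < 1 / (2 * (real m + 1) * (real m + 1))"
    by (intro choice allI)
  then obtain n where n: "\<And>m a b. (a, b) \<in> P m \<Longrightarrow> (\<integral>r. asymmetry (lam (n m)) (- a + b) r \<partial>\<rho>) < 1 / (2 * (real m + 1) * (real m + 1))"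
    by fast
  define N where "N m = 2 * (real m + 1)" for m :: nat
  define \<rho>s where "\<rho>s m = distr (\<rho> \<Otimes>\<^sub>M labels) Eqrel_borel (random_clustering.cluster (lam (n m)) (N m))" for m
  have rc: "random_clustering \<rho> (lam (n m)) (N m)" for m
    by (rule random_clustering.intro) (use \<rho> lam in \<open>auto simp: N_def\<close>)
  have bound: "emeasure (\<rho> \<Otimes>\<^sub>M labels) {x \<in> space (\<rho> \<Otimes>\<^sub>M labels). fst x a b \<and> \<not> random_clustering.cluster (lam (n m)) (N m) x a b}
      \<le> ennreal (2 / (real m + 1))" if "(a, b) \<in> P m" for a b m
  proof -
    interpret random_clustering \<rho> "lam (n m)" "N m" by (rule rc)
    have "emeasure M {x \<in> space M. fst x a b \<and> \<not> cluster x a b} \<le> ennreal (exp (- N m / 2)) +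
        ennreal (N m) * ennreal (\<integral>r. asymmetry (lam (n m)) (- a + b) r \<partial>\<rho>)"
      using emeasure_not_joined [of a b] unfolding nn_integral_transport [OF \<rho> lam] .
    also have "\<dots> \<le> ennreal (1 / (real m + 1)) + ennreal (N m) * ennreal (1 / (2 * (real m + 1) * (real m + 1)))"
    proof (intro add_mono mult_left_mono ennreal_leI)
      have "real m + 1 \<le> exp (real m + 1)" using exp_ge_add_one_self [of "real m + 1"] by linarith
      then have "inverse (exp (real m + 1)) \<le> inverse (real m + 1)"
        by (intro le_imp_inverse_le) auto
      moreover have "- N m / 2 = - (real m + 1)" by (simp add: N_def field_simps)
      ultimately show "exp (- N m / 2) \<le> 1 / (real m + 1)"
        by (simp only: exp_minus inverse_eq_divide)
    qed (use n [OF that] in auto)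
    also have "\<dots> = ennreal (1 / (real m + 1) + N m * (1 / (2 * (real m + 1) * (real m + 1))))"
    proof -
      have "0 \<le> N m" "0 \<le> 1 / (2 * (real m + 1) * (real m + 1))" "0 \<le> 1 / (real m + 1)"
        by (simp_all add: N_def)
      then show ?thesis by (simp only: ennreal_plus ennreal_mult mult_nonneg_nonneg)
    qed
    also have "1 / (real m + 1) + N m * (1 / (2 * (real m + 1) * (real m + 1))) = 2 / (real m + 1)"
    proof -
      have "1 / t + 2 * t * (1 / (2 * t * t)) = 2 / t" if "t > 0" for t :: real
        using that by (simp add: field_simps)
      then show ?thesis unfolding N_def by simp
    qed
    finally show ?thesis .
  qed
  show "\<rho> \<in> IRE_topology closure_of FIRE"
  proof (rule cyl_tendsto_closure [OF _ \<rho>])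
    show "\<rho>s m \<in> FIRE" for m
      unfolding \<rho>s_def by (rule random_clustering.cluster_FIRE [OF rc])
    show "FIRE \<subseteq> (IRE :: ('a \<Rightarrow> 'a \<Rightarrow> bool) measure set)" by (auto simp: FIRE_def)
    show "cyl_tendsto \<rho>s \<rho>"
      unfolding cyl_tendsto_def
    proof
      fix C :: "('a \<Rightarrow> 'a \<Rightarrow> bool) set" assume C: "C \<in> cylinders"
      then obtain F where F: "finite F" "local_on F (\<lambda>r. r \<in> C)" by (rule cylindersE)
      define m0 where "m0 = Suc (Max (insert 0 (to_nat ` F)))"
      have FP: "F \<subseteq> P m" if "m \<ge> m0" for m
      proof
        fix x assume "x \<in> F"
        then have "to_nat x \<le> Max (insert 0 (to_nat ` F))" using F(1) by (intro Max_ge) auto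
        then have "to_nat x < m" using that by (simp add: m0_def)
        then show "x \<in> P m" unfolding P_def by (intro image_eqI [of _ _ "to_nat x"]) auto
      qed
      have "(\<lambda>m. measure (\<rho>s m) C - measure \<rho> C) \<longlonglongrightarrow> 0"
      proof (rule Lim_null_comparison)
        show "\<forall>\<^sub>F m in sequentially. norm (measure (\<rho>s m) C - measure \<rho> C) \<le> card F * (2 / (real m + 1))"
          using eventually_ge_at_top [of m0]
        proof eventually_elim
          case (elim m)
          have "\<bar>measure (\<rho>s m) C - measure \<rho> C\<bar> \<le> card F * (2 / (real m + 1))"
            unfolding \<rho>s_def
            by (rule random_clustering.cluster_cylinder_close [OF rc F C]) (use FP [OF elim] bound in auto)
          then show ?case by simp
        qed
        show "(\<lambda>m. real (card F) * (2 / (real m + 1))) \<longlonglongrightarrow> 0" by real_asymp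
      qed
      then show "(\<lambda>m. measure (\<rho>s m) C) \<longlonglongrightarrow> measure \<rho> C" by (simp add: LIM_zero_iff)
    qed
  qed
qed

subsection \<open>Limits of finite relations over exact groups\<close>

lemma pmf_to_pmf_nn_integral:
  assumes "\<And>k. 0 \<le> f k" "(\<integral>\<^sup>+k. ennreal (f k) \<partial>count_space UNIV) = 1"
  shows "pmf (to_pmf f) = f"
proof -
  have "pmf (embed_pmf f) = f"
    using assms by (intro ext pmf_embed_pmf)
  then show ?thesis unfolding to_pmf_def by (rule someI)
qed

lemma integrable_indicator_mult:
  fixes f :: "'x \<Rightarrow> real"
  assumes "integrable M f" "A \<in> sets M"
  shows "integrable M (\<lambda>x. indicator A x * f x)"
  using integrable_real_mult_indicator [OF assms(2,1)] by (simp add: mult.commute)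

text \<open>The positive and negative parts of \<open>w\<close> are densities of two finite
  measures, \<open>\<mu> 1\<close> and \<open>\<mu> (-1)\<close>. The hypothesis compares them on
  cylinders and \<open>Eqrel_measure_mono\<close> on Borel sets; on the set where \<open>w\<close>
  is negative the first one vanishes, hence so does the second. In this way inequalities between
  limits of integrals become almost sure inequalities.\<close>

lemma AE_nonneg_if_cylinders:
  fixes w :: "('a::countable \<Rightarrow> 'a \<Rightarrow> bool) \<Rightarrow> real"
  assumes \<rho>: "\<rho> \<in> Prob_Eqrel" and w: "integrable \<rho> w"
    and nonneg: "\<And>C. C \<in> cylinders \<Longrightarrow> 0 \<le> (\<integral>r. indicator C r * w r \<partial>\<rho>)"
  shows "AE r in \<rho>. 0 \<le> w r"
proof -
  note P = Prob_EqrelD [OF \<rho>]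
  interpret prob_space \<rho> by (rule P)
  have wm [measurable]: "w \<in> borel_measurable \<rho>" using w by simp
  define \<mu> where "\<mu> s = density \<rho> (\<lambda>r. ennreal (max 0 (s * w r)))" for s :: real
  have int: "integrable \<rho> (\<lambda>r. max 0 (s * w r))" for s
    using w by (intro integrable_max) auto
  have S: "sets (\<mu> s) = sets Eqrel_borel" for s by (simp add: \<mu>_def P)
  have em: "emeasure (\<mu> s) A = ennreal (\<integral>r. indicator A r * max 0 (s * w r) \<partial>\<rho>)" if A: "A \<in> sets Eqrel_borel" for A s
  proof -
    have [measurable]: "A \<in> sets \<rho>" using A by (simp add: P)
    have "emeasure (\<mu> s) A = (\<integral>\<^sup>+r. ennreal (max 0 (s * w r)) * indicator A r \<partial>\<rho>)"
      unfolding \<mu>_def by (rule emeasure_density) measurable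
    also have "\<dots> = (\<integral>\<^sup>+r. ennreal (indicator A r * max 0 (s * w r)) \<partial>\<rho>)"
      by (intro nn_integral_cong) (simp split: split_indicator)
    also have "\<dots> = ennreal (\<integral>r. indicator A r * max 0 (s * w r) \<partial>\<rho>)"
      using int by (intro nn_integral_eq_integral integrable_indicator_mult) auto
    finally show ?thesis .
  qed
  have fin: "finite_measure (\<mu> s)" for s
    by (rule finite_measureI) (use em [of Eqrel s] sets.top [of "Eqrel_borel :: ('a \<Rightarrow> 'a \<Rightarrow> bool) measure"] in \<open>simp add: \<mu>_def P\<close>)
  have m: "measure (\<mu> s) A = (\<integral>r. indicator A r * max 0 (s * w r) \<partial>\<rho>)" if A: "A \<in> sets Eqrel_borel" for A s
    using em [OF A, of s] by (simp add: measure_def integral_nonneg_AE)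
  have "measure (\<mu> (-1)) C \<le> measure (\<mu> 1) C" if C: "C \<in> cylinders" for C
  proof -
    have CS: "C \<in> sets Eqrel_borel" using C cylinders_subset_sets by blast
    have "(\<integral>r. indicator C r * w r \<partial>\<rho>) =
        (\<integral>r. indicator C r * max 0 (1 * w r) - indicator C r * max 0 (-1 * w r) \<partial>\<rho>)"
      by (intro Bochner_Integration.integral_cong) (auto simp: max_def split: split_indicator)
    also have "\<dots> = measure (\<mu> 1) C - measure (\<mu> (-1)) C"
      unfolding m [OF CS]
      by (intro Bochner_Integration.integral_diff integrable_indicator_mult int) (use CS in \<open>simp_all add: P\<close>)
    finally show ?thesis using nonneg [OF C] by simp
  qed
  then have le: "measure (\<mu> (-1)) A \<le> measure (\<mu> 1) A" if "A \<in> sets Eqrel_borel" for A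
    using Eqrel_measure_mono [OF S S fin fin _ that] by blast
  define A where "A = {r \<in> space \<rho>. w r < 0}"
  have "{r \<in> space \<rho>. w r < 0} \<in> sets \<rho>" by measurable
  then have A: "A \<in> sets Eqrel_borel" unfolding A_def P(2) .
  have "measure (\<mu> 1) A = (\<integral>r. 0 \<partial>\<rho>)"
    unfolding m [OF A] by (intro Bochner_Integration.integral_cong) (auto simp: A_def max_def split: split_indicator)
  then have "(\<integral>r. indicator A r * max 0 (-1 * w r) \<partial>\<rho>) \<le> 0"
    using le [OF A] by (simp add: m [OF A])
  then have "(\<integral>r. indicator A r * max 0 (-1 * w r) \<partial>\<rho>) = 0"
    by (intro antisym integral_nonneg_AE) auto
  then have "AE r in \<rho>. indicator A r * max 0 (-1 * w r) = 0"
    by (subst (asm) integral_nonneg_eq_0_iff_AE)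
       (use A int [of "-1"] in \<open>auto intro!: integrable_indicator_mult simp: P\<close>)
  then show ?thesis
    by (rule AE_mp) (auto simp: A_def max_def indicator_def split: if_splits intro!: AE_I2)
qed

section \<open>Averages over finite classes\<close>

lemma l1_dist_bind_pmf_of_set:
  assumes A: "finite A" "A \<noteq> {}" and le: "\<And>h. h \<in> A \<Longrightarrow> l1_dist (f h) (f' h) \<le> c"
  shows "l1_dist (bind_pmf (pmf_of_set A) f) (bind_pmf (pmf_of_set A) f') \<le> c"
proof (rule l1_dist_leI)
  fix K :: "'b set" assume K: "finite K"
  have c: "card A > 0" using A by (simp add: card_gt_0_iff)
  have "(\<Sum>k\<in>K. \<bar>pmf (bind_pmf (pmf_of_set A) f) k - pmf (bind_pmf (pmf_of_set A) f') k\<bar>)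
      = (\<Sum>k\<in>K. \<bar>\<Sum>h\<in>A. pmf (f h) k - pmf (f' h) k\<bar> / card A)"
    using A by (intro sum.cong) (auto simp: pmf_bind_pmf_of_set sum_subtractf abs_divide diff_divide_distrib [symmetric])
  also have "\<dots> \<le> (\<Sum>k\<in>K. (\<Sum>h\<in>A. \<bar>pmf (f h) k - pmf (f' h) k\<bar>) / card A)"
    by (intro sum_mono divide_right_mono sum_abs) auto
  also have "\<dots> = (\<Sum>h\<in>A. \<Sum>k\<in>K. \<bar>pmf (f h) k - pmf (f' h) k\<bar>) / card A"
    by (subst sum.swap) (simp add: sum_divide_distrib)
  also have "\<dots> \<le> (\<Sum>h\<in>A. c) / card A"
    using order_trans [OF sum_le_l1_dist [OF K] le] by (intro divide_right_mono sum_mono) auto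
  also have "\<dots> = c" using c by simp
  finally show "(\<Sum>k\<in>K. \<bar>pmf (bind_pmf (pmf_of_set A) f) k - pmf (bind_pmf (pmf_of_set A) f') k\<bar>) \<le> c" .
qed

text \<open>The default \<open>{0}\<close> makes the average meaningful for every relation. For a
  finite IRE it replaces the class of the identity only on a null set.\<close>

definition finite_class :: "('a::group_add \<Rightarrow> 'a \<Rightarrow> bool) \<Rightarrow> 'a set" where
  "finite_class r = (if finite (eqclass r 0) then eqclass r 0 else {0})"

lemma finite_class:
  assumes "r \<in> Eqrel" shows "finite (finite_class r)" "0 \<in> finite_class r"
  using assms by (auto simp: finite_class_def eqclass_def Eqrel_def equivp_reflp)

definition class_average :: "('a::group_add \<Rightarrow> 'a pmf) \<Rightarrow> ('a \<Rightarrow> 'a \<Rightarrow> bool) \<Rightarrow> 'a pmf" where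
  "class_average f r = bind_pmf (pmf_of_set (finite_class r)) f"

text \<open>The finite class takes values in the countable collection of finite sets, so
  measurability reduces to the preimages of single finite sets.\<close>

lemma measurable_class_average:
  fixes f :: "'a::{group_add, countable} \<Rightarrow> 'a pmf"
  shows "(\<lambda>r. pmf (class_average f r) k) \<in> borel_measurable Eqrel_borel"
proof -
  have "finite_class \<in> measurable Eqrel_borel (count_space (Collect finite :: 'a set set))"
  proof (subst measurable_count_space_eq_countable [OF countable_Collect_finite], intro conjI ballI)
    show "finite_class \<in> space Eqrel_borel \<rightarrow> Collect finite" using finite_class by auto
    fix S :: "'a set" assume S: "S \<in> Collect finite"
    have "finite (eqclass r 0) \<longleftrightarrow> (\<exists>xs::'a list. \<forall>h. r 0 h \<longrightarrow> h \<in> set xs)" for r :: "'a \<Rightarrow> 'a \<Rightarrow> bool"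
      unfolding eqclass_def by (auto dest!: finite_list intro: finite_subset [of _ "set _"])
    then have [measurable]: "Measurable.pred Eqrel_borel (\<lambda>r :: 'a \<Rightarrow> 'a \<Rightarrow> bool. finite (eqclass r 0))" by simp
    have "{r \<in> space Eqrel_borel. finite (eqclass r 0) \<and> (\<forall>h. r 0 h \<longleftrightarrow> h \<in> S) \<or> \<not> finite (eqclass r 0) \<and> S = {0}}
        \<in> sets Eqrel_borel" by measurable
    also have "{r \<in> space Eqrel_borel. finite (eqclass r 0) \<and> (\<forall>h. r 0 h \<longleftrightarrow> h \<in> S) \<or> \<not> finite (eqclass r 0) \<and> S = {0}}
        = finite_class -` {S} \<inter> space Eqrel_borel"
      by (auto simp: finite_class_def eqclass_def set_eq_iff split: if_splits)
    finally show "finite_class -` {S} \<inter> space Eqrel_borel \<in> sets Eqrel_borel" .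
  qed
  from measurable_compose [OF this, of "\<lambda>A. pmf (bind_pmf (pmf_of_set A) f) k"]
  show ?thesis by (simp add: class_average_def)
qed

lemma class_average_shift:
  assumes r: "r \<in> Eqrel" "finite (eqclass r 0)" "r 0 g"
  shows "class_average f (shift (- g) r) = bind_pmf (pmf_of_set (eqclass r 0)) (\<lambda>h. f (- g + h))"
proof -
  have rg: "r g = r 0" using r by (simp add: Eqrel_def equivp_def)
  have "eqclass (shift (- g) r) 0 = (\<lambda>h. - g + h) ` eqclass r 0"
  proof (intro set_eqI iffI)
    fix h assume "h \<in> eqclass (shift (- g) r) 0"
    then have "g + h \<in> eqclass r 0" using rg by (simp add: eqclass_def shift_def)
    then show "h \<in> (\<lambda>h. - g + h) ` eqclass r 0"
      by (rule image_eqI [rotated]) (simp add: add.assoc [symmetric])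
  next
    fix h assume "h \<in> (\<lambda>h. - g + h) ` eqclass r 0"
    then show "h \<in> eqclass (shift (- g) r) 0"
      using rg by (auto simp: eqclass_def shift_def add.assoc [symmetric])
  qed
  moreover have "inj_on (\<lambda>h. - g + h) (eqclass r 0)" by (simp add: inj_on_def)
  moreover have "eqclass r 0 \<noteq> {}" using r(3) by (auto simp: eqclass_def)
  ultimately have "pmf_of_set (finite_class (shift (- g) r)) = map_pmf (\<lambda>h. - g + h) (pmf_of_set (eqclass r 0))"
    using r(2) by (simp add: finite_class_def map_pmf_of_set_inj)
  then show ?thesis by (simp add: class_average_def bind_map_pmf)
qed

text \<open>Moving the base point inside a class leaves the set of averaged points unchanged up to
  translation. Only the failure of equivariance of \<open>f\<close> remains, and convexity of the
  distance keeps it below \<open>c\<close>.\<close>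

lemma class_average_asymmetry:
  assumes r: "r \<in> Eqrel" "finite (eqclass r 0)" "r 0 g"
    and le: "\<And>h. l1_dist (translate (- g) (f h)) (f (- g + h)) \<le> c"
  shows "l1_dist (translate (- g) (class_average f r)) (class_average f (shift (- g) r)) \<le> c"
proof -
  have "translate (- g) (class_average f r) = bind_pmf (pmf_of_set (eqclass r 0)) (\<lambda>h. translate (- g) (f h))"
    using r(2) by (simp add: class_average_def finite_class_def translate_def map_bind_pmf)
  moreover have "eqclass r 0 \<noteq> {}" using r(3) by (auto simp: eqclass_def)
  ultimately show ?thesis
    unfolding class_average_shift [OF r] using r(2) le by (auto intro: l1_dist_bind_pmf_of_set)
qed


lemma nn_integral_count_space_le_1:
  assumes nonneg: "\<And>k. 0 \<le> u k" and le: "\<And>K. finite K \<Longrightarrow> (\<Sum>k\<in>K. u k) \<le> 1"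
  shows "(\<integral>\<^sup>+k. ennreal (u k) \<partial>count_space UNIV) \<le> 1"
proof -
  have sum: "u summable_on UNIV"
    by (rule nonneg_bdd_above_summable_on) (use assms in \<open>auto intro!: bdd_aboveI [of _ 1]\<close>)
  then have "(\<lambda>k. norm (u k)) summable_on UNIV" using nonneg by simp
  then have "Infinite_Set_Sum.abs_summable_on u UNIV" unfolding abs_summable_equivalent [symmetric] .
  then have "(\<integral>\<^sup>+k. ennreal (u k) \<partial>count_space UNIV) = ennreal (infsum u UNIV)"
    using nonneg by (subst nn_integral_conv_infsetsum) (auto simp: infsetsum_infsum)
  also have "infsum u UNIV \<le> 1" by (rule infsum_le_finite_sums [OF sum]) (use le in auto)
  finally show ?thesis by (simp add: ennreal_leI)
qed

text \<open>This moves a shift from the integrand to the set. Shifted cylinders are cylinders, so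
  limits known on cylinders apply again.\<close>

lemma IRE_integral_indicator_shift:
  fixes u :: "('a::{group_add, countable} \<Rightarrow> 'a \<Rightarrow> bool) \<Rightarrow> real"
  assumes \<rho>: "\<rho> \<in> IRE" and u: "u \<in> borel_measurable Eqrel_borel" and E: "E \<in> sets Eqrel_borel"
  shows "(\<integral>r. indicator (shift g -` E \<inter> Eqrel) r * u r \<partial>\<rho>) = (\<integral>r. indicator E r * u (shift (- g) r) \<partial>\<rho>)"
proof -
  note P = Prob_EqrelD [OF IRE_Prob_Eqrel [OF \<rho>]]
  let ?F = "\<lambda>r. indicator E r * u (shift (- g) r)"
  have "?F \<in> borel_measurable Eqrel_borel"
    by (intro borel_measurable_times borel_measurable_indicator E measurable_compose [OF shift_measurable u])
  then have "?F \<in> borel_measurable \<rho>" using measurable_cong_sets [OF P(2) refl] by blast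
  from IRE_integral_shift [OF \<rho> this, of g]
  have "(\<integral>r. indicator E r * u (shift (- g) r) \<partial>\<rho>) = (\<integral>r. indicator E (shift g r) * u (shift (- g) (shift g r)) \<partial>\<rho>)"
    by simp
  also have "\<dots> = (\<integral>r. indicator (shift g -` E \<inter> Eqrel) r * u r \<partial>\<rho>)"
    by (rule Bochner_Integration.integral_cong) (auto simp: shift_shift P indicator_def)
  finally show ?thesis by simp
qed

text \<open>For each coordinate \<open>k\<close>, the integrals of the class averages over cylinders
  converge along a subsequence. The limits are measures dominated by \<open>\<rho>\<close>, and
  their densities \<open>D k\<close> serve as the coordinates of the required kernel. The bound
  \<open>c\<close> holds on each finite relation and is inherited without loss.\<close>

theorem closure_FIRE_kernel:
  fixes f :: "'a::{group_add, countable} \<Rightarrow> 'a pmf" and \<rho> :: "('a \<Rightarrow> 'a \<Rightarrow> bool) measure"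
  assumes closure: "\<rho> \<in> IRE_topology closure_of FIRE"
    and tight: "\<And>\<epsilon>. \<epsilon> > 0 \<Longrightarrow> \<exists>K. finite K \<and> (\<forall>h. 1 - \<epsilon> \<le> (\<Sum>k\<in>K. pmf (f h) k))"
    and le: "\<And>g h. l1_dist (translate g (f h)) (f (g + h)) \<le> c g"
  shows "\<exists>lam\<in>measurable Eqrel_borel Prob_borel. \<forall>g. AE r in \<rho>. r 0 g \<longrightarrow>
    l1_dist (translate (- g) (lam r)) (lam (shift (- g) r)) \<le> c (- g)"
proof -
  obtain \<rho>s where \<rho>s: "\<And>n. \<rho>s n \<in> FIRE" and ct: "cyl_tendsto \<rho>s \<rho>" and \<rho>: "\<rho> \<in> IRE"
    using closure_cyl_tendsto [OF closure] by blast
  note P = Prob_EqrelD [OF IRE_Prob_Eqrel [OF \<rho>]]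
  interpret prob_space \<rho> by (rule P)
  define a where "a k r = pmf (class_average f r) k" for k r
  have a_meas: "a k \<in> borel_measurable Eqrel_borel" for k
    unfolding a_def by (rule measurable_class_average)
  have a_bounds: "0 \<le> a k r" "a k r \<le> 1" for k r by (simp_all add: a_def pmf_le_1)
  have Ps: "prob_space (\<rho>s n)" "sets (\<rho>s n) = sets Eqrel_borel" "space (\<rho>s n) = Eqrel" "\<rho>s n \<in> IRE" for n
    using Prob_EqrelD [OF IRE_Prob_Eqrel, of "\<rho>s n"] \<rho>s [of n] by (auto simp: FIRE_def)
  have cylS: "C \<in> sets Eqrel_borel" if "C \<in> cylinders" for C :: "('a \<Rightarrow> 'a \<Rightarrow> bool) set"
    using that cylinders_subset_sets by blast
  have ind_int: "integrable (\<rho>s n) (\<lambda>r. indicator C r * u r)"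
    if "C \<in> sets Eqrel_borel" "u \<in> borel_measurable Eqrel_borel" "\<And>r. \<bar>u r\<bar> \<le> B" for C n B and u :: "_ \<Rightarrow> real"
  proof -
    interpret \<rho>s: prob_space "\<rho>s n" by (rule Ps)
    have "u \<in> borel_measurable (\<rho>s n)" using that(2) measurable_cong_sets [OF Ps(2) refl] by blast
    then have "integrable (\<rho>s n) u"
      by (intro \<rho>s.integrable_const_bound [where B = B]) (use that(3) in auto)
    then show ?thesis by (rule integrable_indicator_mult) (use that(1) in \<open>simp add: Ps\<close>)
  qed
  have a_int: "integrable (\<rho>s n) (\<lambda>r. indicator C r * a k r)" if "C \<in> cylinders" for C n k
    by (rule ind_int [OF cylS [OF that] a_meas, of _ 1]) (use a_bounds in auto)

  \<comment> \<open>The index pairs the number of a cylinder with a group element, so one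
    subsequence serves all cylinders and all coordinates.\<close>
  obtain s L where s: "strict_mono (s :: nat \<Rightarrow> nat)" 
    and L: "\<And>i :: nat \<times> 'a. (\<lambda>n. \<integral>r. indicator (from_nat_into cylinders (fst i)) r * a (snd i) r \<partial>\<rho>s (s n)) \<longlonglongrightarrow> L i"
  proof (rule bounded_pointwise_subsequence [of "\<lambda>n (i :: nat \<times> 'a). \<integral>r. indicator (from_nat_into cylinders (fst i)) r * a (snd i) r \<partial>\<rho>s n"])
    fix n and i :: "nat \<times> 'a"
    interpret \<rho>s: prob_space "\<rho>s n" by (rule Ps)
    show "0 \<le> (\<integral>r. indicator (from_nat_into cylinders (fst i)) r * a (snd i) r \<partial>\<rho>s n)"
      by (rule integral_nonneg_AE) (simp add: a_bounds)
    have "(\<integral>r. indicator (from_nat_into cylinders (fst i)) r * a (snd i) r \<partial>\<rho>s n) \<le> (\<integral>r. 1 \<partial>\<rho>s n)"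
    proof (rule integral_mono)
      have "from_nat_into cylinders (fst i) \<in> (cylinders :: ('a \<Rightarrow> 'a \<Rightarrow> bool) set set)"
        by (rule from_nat_into) (use cyl.top in blast)
      then show "integrable (\<rho>s n) (\<lambda>r. indicator (from_nat_into cylinders (fst i)) r * a (snd i) r)"
        by (rule a_int)
      show "indicator (from_nat_into cylinders (fst i)) r * a (snd i) r \<le> 1" for r
        using a_bounds [of "snd i" r] by (simp split: split_indicator)
    qed simp
    then show "(\<integral>r. indicator (from_nat_into cylinders (fst i)) r * a (snd i) r \<partial>\<rho>s n) \<le> 1"
      by (simp add: \<rho>s.prob_space)
  qed blast
  define \<sigma> where "\<sigma> n = \<rho>s (s n)" for n
  define \<psi> where "\<psi> k C = lim (\<lambda>n. \<integral>r. indicator C r * a k r \<partial>\<sigma> n)" for k C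
  have lim: "(\<lambda>n. \<integral>r. indicator C r * a k r \<partial>\<sigma> n) \<longlonglongrightarrow> \<psi> k C" if "C \<in> cylinders" for k C
  proof -
    from from_nat_into_surj [OF countable_cylinders that] obtain i where "from_nat_into cylinders i = C" by blast
    then have "(\<lambda>n. \<integral>r. indicator C r * a k r \<partial>\<sigma> n) \<longlonglongrightarrow> L (i, k)"
      using L [of "(i, k)"] by (simp add: \<sigma>_def)
    with limI [OF this] show ?thesis by (simp add: \<psi>_def)
  qed
  have lim\<rho>: "(\<lambda>n. measure (\<sigma> n) C) \<longlonglongrightarrow> measure \<rho> C" if "C \<in> cylinders" for C
    using LIMSEQ_subseq_LIMSEQ [OF _ s, of "\<lambda>n. measure (\<rho>s n) C"] ct that
    by (simp add: cyl_tendsto_def \<sigma>_def o_def)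
  have \<sigma>: "prob_space (\<sigma> n)" "sets (\<sigma> n) = sets Eqrel_borel" "space (\<sigma> n) = Eqrel" "\<sigma> n \<in> IRE" "\<sigma> n \<in> FIRE" for n
    using Ps [of "s n"] \<rho>s by (auto simp: \<sigma>_def)
  have \<sigma>_int: "integrable (\<sigma> n) (\<lambda>r. indicator C r * u r)"
    if "C \<in> sets Eqrel_borel" "u \<in> borel_measurable Eqrel_borel" "\<And>r. \<bar>u r\<bar> \<le> B" for C n B and u :: "_ \<Rightarrow> real"
    unfolding \<sigma>_def by (rule ind_int [OF that])
  have a_int: "integrable (\<sigma> n) (\<lambda>r. indicator C r * a k r)" if "C \<in> cylinders" for C n k
    unfolding \<sigma>_def by (rule a_int [OF that])
  have ind_\<sigma>: "C \<inter> space (\<sigma> n) = C" if "C \<in> cylinders" for C n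
    using that cyl.space_closed by (auto simp: \<sigma>)
  have ind_int\<sigma>: "integrable (\<sigma> n) (indicator C :: _ \<Rightarrow> real)" if "C \<in> cylinders" for C n
    using \<sigma>_int [OF cylS [OF that], of "\<lambda>_. 1" 1] by simp

  have \<psi>_nonneg: "0 \<le> \<psi> k C" if "C \<in> cylinders" for k C
    by (rule LIMSEQ_le_const [OF lim [OF that]]) (auto intro!: exI [of _ 0] integral_nonneg_AE simp: a_bounds)
  \<comment> \<open>A singleton \<open>K\<close> gives the domination behind absolute continuity;
    general finite \<open>K\<close> will give total mass at most 1.\<close>
  have \<psi>_sum: "(\<Sum>k\<in>K. \<psi> k C) \<le> measure \<rho> C" if C: "C \<in> cylinders" and K: "finite K" for K C
  proof (rule LIMSEQ_le [OF tendsto_sum [OF lim [OF C]] lim\<rho> [OF C]], intro exI [of _ 0] allI impI)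
    fix n
    have "(\<Sum>k\<in>K. \<integral>r. indicator C r * a k r \<partial>\<sigma> n) = (\<integral>r. (\<Sum>k\<in>K. indicator C r * a k r) \<partial>\<sigma> n)"
      by (rule Bochner_Integration.integral_sum [symmetric]) (rule a_int [OF C])
    also have "\<dots> \<le> (\<integral>r. indicator C r \<partial>\<sigma> n)"
      using sum_pmf_le_1 [OF K]
      by (intro integral_mono Bochner_Integration.integrable_sum a_int ind_int\<sigma> C)
         (auto simp: a_def simp flip: sum_distrib_left split: split_indicator)
    also have "\<dots> = measure (\<sigma> n) C" by (simp add: ind_\<sigma> [OF C])
    finally show "(\<Sum>k\<in>K. \<integral>r. indicator C r * a k r \<partial>\<sigma> n) \<le> measure (\<sigma> n) C" .
  qed
  have \<psi>_add: "\<psi> k (C \<union> D) = \<psi> k C + \<psi> k D" if "C \<in> cylinders" "D \<in> cylinders" "C \<inter> D = {}" for k C D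
  proof (rule LIMSEQ_unique [OF lim])
    have "(\<integral>r. indicator (C \<union> D) r * a k r \<partial>\<sigma> n) =
        (\<integral>r. indicator C r * a k r \<partial>\<sigma> n) + (\<integral>r. indicator D r * a k r \<partial>\<sigma> n)" for n
    proof -
      have "(\<integral>r. indicator (C \<union> D) r * a k r \<partial>\<sigma> n) = (\<integral>r. indicator C r * a k r + indicator D r * a k r \<partial>\<sigma> n)"
        using that(3) by (intro Bochner_Integration.integral_cong) (auto split: split_indicator)
      also have "\<dots> = (\<integral>r. indicator C r * a k r \<partial>\<sigma> n) + (\<integral>r. indicator D r * a k r \<partial>\<sigma> n)"
        by (rule Bochner_Integration.integral_add) (intro a_int that)+
      finally show ?thesis .
    qed
    then show "(\<lambda>n. \<integral>r. indicator (C \<union> D) r * a k r \<partial>\<sigma> n) \<longlonglongrightarrow> \<psi> k C + \<psi> k D"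
      using tendsto_add [OF lim [OF that(1), of k] lim [OF that(2), of k]] by simp
  qed (use that in blast)

  have "\<exists>D. (\<forall>r. 0 \<le> D r) \<and> D \<in> borel_measurable Eqrel_borel \<and> integrable \<rho> D \<and>
      (\<forall>C\<in>cylinders. (\<integral>r. indicator C r * D r \<partial>\<rho>) = \<psi> k C)" for k
  proof -
    obtain \<nu> where \<nu>: "finite_measure \<nu>" "sets \<nu> = sets Eqrel_borel" "\<And>C. C \<in> cylinders \<Longrightarrow> measure \<nu> C = \<psi> k C"
      using Eqrel_measure_extension [of "\<psi> k", OF \<psi>_nonneg \<psi>_add] by blast
    have \<nu>\<rho>: "measure \<nu> A \<le> measure \<rho> A" if "A \<in> sets Eqrel_borel" for A
      using Eqrel_measure_mono [OF \<nu>(2) P(2) \<nu>(1) finite_measure_axioms _ that] \<psi>_sum [of _ "{k}"] \<nu>(3) by simp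
    have ac: "absolutely_continuous \<rho> \<nu>"
      using finite_measure.emeasure_eq_measure [OF \<nu>(1)]
      by (auto simp: absolutely_continuous_def null_sets_def P \<nu> emeasure_eq_measure ennreal_eq_0_iff
          intro: order_trans [OF \<nu>\<rho>])
    have st: "sets \<nu> = sets \<rho>" by (simp add: \<nu> P)
    obtain D where D: "D \<in> borel_measurable \<rho>" "AE x in \<rho>. RN_deriv \<rho> \<nu> x = ennreal (D x)" "\<And>x. 0 \<le> D x"
      using real_RN_deriv [OF \<nu>(1) ac st] by blast
    have "density \<rho> (\<lambda>x. ennreal (D x)) = density \<rho> (RN_deriv \<rho> \<nu>)"
      using D by (intro density_cong) auto
    also have "\<dots> = \<nu>" by (rule density_RN_deriv [OF ac st])
    finally have dens: "density \<rho> (\<lambda>x. ennreal (D x)) = \<nu>" .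
    have em: "emeasure \<nu> A = (\<integral>\<^sup>+x. ennreal (D x) * indicator A x \<partial>\<rho>)" if "A \<in> sets \<rho>" for A
      unfolding dens [symmetric] using D that by (intro emeasure_density) auto
    have "(\<integral>\<^sup>+x. ennreal (D x) \<partial>\<rho>) = emeasure \<nu> (space \<rho>)"
      unfolding em [OF sets.top] by (intro nn_integral_cong) simp
    also have "\<dots> < \<infinity>" using finite_measure.emeasure_finite [OF \<nu>(1)] by (simp add: less_top)
    finally have int: "integrable \<rho> D" using D by (intro integrableI_nonneg) auto
    have "(\<integral>r. indicator C r * D r \<partial>\<rho>) = \<psi> k C" if C: "C \<in> cylinders" for C
    proof -
      have CS: "C \<in> sets \<rho>" using cylS [OF C] by (simp add: P)
      have "ennreal (\<integral>r. indicator C r * D r \<partial>\<rho>) = (\<integral>\<^sup>+r. ennreal (indicator C r * D r) \<partial>\<rho>)"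
        by (rule nn_integral_eq_integral [symmetric], rule integrable_indicator_mult [OF int CS])
           (simp add: D)
      also have "\<dots> = emeasure \<nu> C"
        unfolding em [OF CS] by (intro nn_integral_cong) (simp split: split_indicator)
      also have "\<dots> = ennreal (\<psi> k C)"
        using finite_measure.emeasure_eq_measure [OF \<nu>(1), of C] \<nu>(3) [OF C] by simp
      finally show ?thesis
        using \<psi>_nonneg [OF C] by (subst (asm) ennreal_inj) (auto intro!: integral_nonneg_AE simp: D)
    qed
    moreover have "D \<in> borel_measurable Eqrel_borel"
      using D(1) measurable_cong_sets [OF P(2) refl] by blast
    ultimately show ?thesis using D(3) int by blast
  qed
  then obtain D where D: "\<And>k r. 0 \<le> D k r" "\<And>k. D k \<in> borel_measurable Eqrel_borel" "\<And>k. integrable \<rho> (D k)"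
    "\<And>k C. C \<in> cylinders \<Longrightarrow> (\<integral>r. indicator C r * D k r \<partial>\<rho>) = \<psi> k C" by metis
  have D_meas: "D k \<in> borel_measurable \<rho>" for k
    using D(2) measurable_cong_sets [OF P(2) refl] by blast
  have D_int: "integrable \<rho> (\<lambda>r. indicator C r * D k r)" if "C \<in> cylinders" for C k
    by (rule integrable_indicator_mult [OF D(3)]) (use cylS [OF that] in \<open>simp add: P\<close>)
  have ind_int\<rho>: "integrable \<rho> (indicator C :: _ \<Rightarrow> real)" if "C \<in> cylinders" for C
    using cylS [OF that] by (simp add: P less_top [symmetric] emeasure_eq_measure)
  have ind_\<rho>: "C \<inter> space \<rho> = C" if "C \<in> cylinders" for C
    using that cyl.space_closed by (auto simp: P)
  have \<rho>P: "\<rho> \<in> Prob_Eqrel" using \<rho> by (rule IRE_Prob_Eqrel)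

  have sum_le_1: "AE r in \<rho>. (\<Sum>k\<in>K. D k r) \<le> 1" if K: "finite K" for K
  proof -
    have "AE r in \<rho>. 0 \<le> 1 - (\<Sum>k\<in>K. D k r)"
    proof (rule AE_nonneg_if_cylinders [OF \<rho>P])
      show "integrable \<rho> (\<lambda>r. 1 - (\<Sum>k\<in>K. D k r))"
        using D(3) by (intro Bochner_Integration.integrable_diff Bochner_Integration.integrable_sum) auto
      fix C :: "('a \<Rightarrow> 'a \<Rightarrow> bool) set" assume C: "C \<in> cylinders"
      have "(\<integral>r. indicator C r * (1 - (\<Sum>k\<in>K. D k r)) \<partial>\<rho>) = (\<integral>r. indicator C r - (\<Sum>k\<in>K. indicator C r * D k r) \<partial>\<rho>)"
        by (simp add: right_diff_distrib sum_distrib_left)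
      also have "\<dots> = (\<integral>r. indicator C r \<partial>\<rho>) - (\<integral>r. (\<Sum>k\<in>K. indicator C r * D k r) \<partial>\<rho>)"
        by (rule Bochner_Integration.integral_diff [OF ind_int\<rho> [OF C] Bochner_Integration.integrable_sum]) (rule D_int [OF C])
      also have "\<dots> = measure \<rho> C - (\<Sum>k\<in>K. \<psi> k C)"
        using D(4) [OF C] by (subst Bochner_Integration.integral_sum [OF D_int [OF C]]) (simp add: ind_\<rho> [OF C])
      finally show "0 \<le> (\<integral>r. indicator C r * (1 - (\<Sum>k\<in>K. D k r)) \<partial>\<rho>)"
        using \<psi>_sum [OF C K] by simp
    qed
    then show ?thesis by (rule AE_mp) (auto intro!: AE_I2)
  qed
  define S where "S r = (\<integral>\<^sup>+k. ennreal (D k r) \<partial>count_space UNIV)" for r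
  have S_meas: "S \<in> borel_measurable Eqrel_borel"
    unfolding S_def [abs_def] by (rule borel_measurable_nn_integral_count_space) (use D(2) in measurable)
  then have S_meas\<rho> [measurable]: "S \<in> borel_measurable \<rho>"
    using measurable_cong_sets [OF P(2) refl] by blast
  have "AE r in \<rho>. \<forall>K\<in>Collect finite. (\<Sum>k\<in>K. D k r) \<le> 1"
    using sum_le_1 by (subst AE_ball_countable [OF countable_Collect_finite]) auto
  then have S_le: "AE r in \<rho>. S r \<le> 1"
    by (rule AE_mp) (auto intro!: AE_I2 nn_integral_count_space_le_1 D(1) simp: S_def)
  \<comment> \<open>Pointwise limits of coordinates could lose mass at infinity. Tightness holds
    uniformly in \<open>h\<close>, hence for all class averages, so one finite \<open>K\<close>
    retains mass \<open>1 - \<epsilon>\<close>; for finitely many coordinates sums and limits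
    commute.\<close>
  have S_eps: "(\<integral>\<^sup>+r. 1 - S r \<partial>\<rho>) \<le> ennreal \<epsilon>" if \<epsilon>: "\<epsilon> > 0" for \<epsilon>
  proof -
    obtain K where K: "finite K" "\<And>h. 1 - \<epsilon> \<le> (\<Sum>k\<in>K. pmf (f h) k)" using tight [OF \<epsilon>] by blast
    have aK: "1 - \<epsilon> \<le> (\<Sum>k\<in>K. a k r)" if r: "r \<in> Eqrel" for r
    proof -
      note fc = finite_class [OF r]
      have "(\<Sum>k\<in>K. a k r) = (\<Sum>k\<in>K. \<Sum>h\<in>finite_class r. pmf (f h) k) / card (finite_class r)"
      proof -
        have "finite_class r \<noteq> {}" using fc by blast
        then show ?thesis
          using fc(1) by (simp add: a_def class_average_def pmf_bind_pmf_of_set sum_divide_distrib)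
      qed
      also have "\<dots> = (\<Sum>h\<in>finite_class r. \<Sum>k\<in>K. pmf (f h) k) / card (finite_class r)"
        by (subst sum.swap) simp
      also have "\<dots> \<ge> (\<Sum>h\<in>finite_class r. 1 - \<epsilon>) / card (finite_class r)"
        using K(2) by (intro divide_right_mono sum_mono) auto
      moreover have "(\<Sum>h\<in>finite_class r. 1 - \<epsilon>) / card (finite_class r) = 1 - \<epsilon>"
        using fc by (auto simp: card_gt_0_iff)
      ultimately show ?thesis by simp
    qed
    have "1 - \<epsilon> \<le> (\<Sum>k\<in>K. \<psi> k Eqrel)"
    proof (rule LIMSEQ_le_const [OF tendsto_sum [OF lim [OF cyl.top]]], intro exI [of _ 0] allI impI)
      fix n
      interpret \<sigma>: prob_space "\<sigma> n" by (rule \<sigma>)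
      have "1 - \<epsilon> = (\<integral>r. 1 - \<epsilon> \<partial>\<sigma> n)" by (simp add: \<sigma>.prob_space)
      also have "\<dots> \<le> (\<integral>r. (\<Sum>k\<in>K. indicator Eqrel r * a k r) \<partial>\<sigma> n)"
        using aK by (intro integral_mono Bochner_Integration.integrable_sum a_int cyl.top) (auto simp: \<sigma>)
      also have "\<dots> = (\<Sum>k\<in>K. \<integral>r. indicator Eqrel r * a k r \<partial>\<sigma> n)"
        by (rule Bochner_Integration.integral_sum) (rule a_int [OF cyl.top])
      finally show "1 - \<epsilon> \<le> (\<Sum>k\<in>K. \<integral>r. indicator Eqrel r * a k r \<partial>\<sigma> n)" .
    qed
    also have "\<dots> = (\<Sum>k\<in>K. \<integral>r. indicator Eqrel r * D k r \<partial>\<rho>)"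
      using D(4) [OF cyl.top] by simp
    also have "\<dots> = (\<integral>r. (\<Sum>k\<in>K. indicator Eqrel r * D k r) \<partial>\<rho>)"
      by (rule Bochner_Integration.integral_sum [symmetric]) (rule D_int [OF cyl.top])
    also have "\<dots> = (\<integral>r. (\<Sum>k\<in>K. D k r) \<partial>\<rho>)"
      by (intro Bochner_Integration.integral_cong) (auto simp: P)
    finally have DK: "1 - \<epsilon> \<le> (\<integral>r. (\<Sum>k\<in>K. D k r) \<partial>\<rho>)" .
    have int: "integrable \<rho> (\<lambda>r. \<Sum>k\<in>K. D k r)" using D(3) by (intro Bochner_Integration.integrable_sum)
    have "(\<integral>\<^sup>+r. 1 - S r \<partial>\<rho>) \<le> (\<integral>\<^sup>+r. ennreal (1 - (\<Sum>k\<in>K. D k r)) \<partial>\<rho>)"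
    proof (rule nn_integral_mono)
      fix r
      have "ennreal (\<Sum>k\<in>K. D k r) = (\<Sum>k\<in>K. ennreal (D k r))"
        using D(1) by (simp add: sum_ennreal)
      also have "\<dots> = (\<integral>\<^sup>+k. ennreal (D k r) \<partial>count_space K)"
        using K(1) by (simp add: nn_integral_count_space_finite)
      also have "\<dots> \<le> S r"
        unfolding S_def by (subst nn_integral_count_space_indicator) (auto intro!: nn_integral_mono split: split_indicator)
      finally have "1 - S r \<le> ennreal 1 - ennreal (\<Sum>k\<in>K. D k r)"
        by (simp add: ennreal_minus_mono)
      then show "1 - S r \<le> ennreal (1 - (\<Sum>k\<in>K. D k r))"
        using D(1) by (subst (asm) ennreal_minus) (auto intro: sum_nonneg)
    qed
    also have "\<dots> = ennreal (\<integral>r. 1 - (\<Sum>k\<in>K. D k r) \<partial>\<rho>)"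
    proof (rule nn_integral_eq_integral)
      show "AE r in \<rho>. 0 \<le> 1 - (\<Sum>k\<in>K. D k r)"
        using sum_le_1 [OF K(1)] by (rule AE_mp) (auto intro!: AE_I2)
    qed (use int in auto)
    also have "(\<integral>r. 1 - (\<Sum>k\<in>K. D k r) \<partial>\<rho>) = 1 - (\<integral>r. (\<Sum>k\<in>K. D k r) \<partial>\<rho>)"
      using int by (simp add: prob_space)
    also have "ennreal \<dots> \<le> ennreal \<epsilon>" using DK by (intro ennreal_leI) simp
    finally show ?thesis .
  qed
  have "(\<integral>\<^sup>+r. 1 - S r \<partial>\<rho>) \<le> 0"
    by (rule ennreal_le_epsilon) (simp add: S_eps)
  then have "(\<integral>\<^sup>+r. 1 - S r \<partial>\<rho>) = 0" by simp
  then have "AE r in \<rho>. 1 - S r = 0"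
    by (subst (asm) nn_integral_0_iff_AE) auto
  with S_le have S_1: "AE r in \<rho>. S r = 1"
  proof eventually_elim
    case (elim r)
    have "1 \<le> S r" using elim(2) by (simp add: ennreal_minus_eq_0)
    with elim(1) show ?case by (rule antisym)
  qed

  \<comment> \<open>The distance is not linear in the densities, but each choice of signs
    \<open>t\<close> gives a linear inequality, which can be integrated over cylinders and passed to
    the limit. Equality in the choice of signs recovers the absolute values later.\<close>
  have key: "AE r in \<rho>. r 0 g \<longrightarrow> (\<Sum>k\<in>K. t k * (D (g + k) r - D k (shift (- g) r))) \<le> c (- g)"
    if K: "finite K" and t: "\<And>k. \<bar>t k\<bar> \<le> 1" for g K t
  proof -
    let ?G = "{r \<in> Eqrel. r 0 g}"
    define w where "w r = indicator ?G r * (c (- g) - (\<Sum>k\<in>K. t k * (D (g + k) r - D k (shift (- g) r))))" for r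
    have shD: "integrable \<rho> (\<lambda>r. D k (shift (- g) r))" for k
    proof -
      have "distr \<rho> \<rho> (shift (- g)) = \<rho>" using \<rho> by (simp add: IRE_def)
      then have "integrable (distr \<rho> \<rho> (shift (- g))) (D k)" using D(3) by (simp only:)
      from integrable_distr [OF Prob_Eqrel_measurable_shift [OF \<rho>P] this] show ?thesis .
    qed
    have "AE r in \<rho>. 0 \<le> w r"
    proof (rule AE_nonneg_if_cylinders [OF \<rho>P])
      show "integrable \<rho> w"
        unfolding w_def [abs_def]
        by (intro integrable_indicator_mult Bochner_Integration.integrable_diff Bochner_Integration.integrable_sum
            integrable_mult_right D(3) shD integrable_const)
           (use cylS [OF coordinate_cylinder [of 0 g]] in \<open>simp add: P\<close>)
      fix C :: "('a \<Rightarrow> 'a \<Rightarrow> bool) set" assume C: "C \<in> cylinders"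
      \<comment> \<open>On \<open>E\<close> the identity is related to \<open>g\<close>, so the
        bound for class averages is available. The term with the shifted relation is integrated over
        \<open>E'\<close> instead, since only integrals of unshifted coordinates over cylinders are
        known to converge.\<close>
      define E where "E = C \<inter> ?G"
      define E' where "E' = shift g -` E \<inter> Eqrel"
      have E: "E \<in> cylinders" unfolding E_def using C coordinate_cylinder by (rule cyl.Int)
      have E': "E' \<in> cylinders" unfolding E'_def by (rule shift_vimage_cylinder [OF E])
      have ES: "E \<in> sets \<rho>" using cylS [OF E] by (simp add: P)
      have "(\<integral>r. indicator C r * w r \<partial>\<rho>) = (\<integral>r. c (- g) * indicator E r -
          (\<Sum>k\<in>K. t k * (indicator E r * D (g + k) r - indicator E r * D k (shift (- g) r))) \<partial>\<rho>)"
        by (intro Bochner_Integration.integral_cong)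
           (auto simp: w_def E_def split: split_indicator)
      also have "\<dots> = c (- g) * measure \<rho> E -
          (\<Sum>k\<in>K. t k * ((\<integral>r. indicator E r * D (g + k) r \<partial>\<rho>) - (\<integral>r. indicator E r * D k (shift (- g) r) \<partial>\<rho>)))"
        using D_int [OF E] integrable_indicator_mult [OF shD ES] ind_int\<rho> [OF E]
        by (simp add: Bochner_Integration.integral_diff Bochner_Integration.integral_sum ind_\<rho> [OF E])
      also have "\<dots> = c (- g) * measure \<rho> E - (\<Sum>k\<in>K. t k * (\<psi> (g + k) E - \<psi> k E'))"
        using D(4) [OF E] D(4) [OF E'] IRE_integral_indicator_shift [where g = g, OF \<rho> D(2) cylS [OF E]]
        by (simp add: E'_def)
      also have "0 \<le> \<dots>"
      proof (rule LIMSEQ_le_const [OF tendsto_diff [OF tendsto_mult_left [OF lim\<rho> [OF E]] tendsto_sum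
              [OF tendsto_mult_left [OF tendsto_diff [OF lim [OF E] lim [OF E']]]]]], intro exI [of _ 0] allI impI)
        fix n
        have m: "(\<lambda>r. a k (shift (- g) r)) \<in> borel_measurable Eqrel_borel" for k
          by (rule measurable_compose [OF shift_measurable a_meas])
        have i: "integrable (\<sigma> n) (\<lambda>r. indicator E r * a k (shift (- g) r))" for k
          by (rule \<sigma>_int [OF cylS [OF E] m, of _ 1]) (use a_bounds in auto)
        have "c (- g) * measure (\<sigma> n) E - (\<Sum>k\<in>K. t k * ((\<integral>r. indicator E r * a (g + k) r \<partial>\<sigma> n) - (\<integral>r. indicator E' r * a k r \<partial>\<sigma> n)))
          = c (- g) * measure (\<sigma> n) E - (\<Sum>k\<in>K. t k * ((\<integral>r. indicator E r * a (g + k) r \<partial>\<sigma> n) - (\<integral>r. indicator E r * a k (shift (- g) r) \<partial>\<sigma> n)))"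
          using IRE_integral_indicator_shift [where g = g, OF \<sigma>(4) a_meas cylS [OF E]] by (simp add: E'_def)
        also have "\<dots> = (\<integral>r. c (- g) * indicator E r -
          (\<Sum>k\<in>K. t k * (indicator E r * a (g + k) r - indicator E r * a k (shift (- g) r))) \<partial>\<sigma> n)"
          using a_int [OF E] i ind_int\<sigma> [OF E]
          by (simp add: Bochner_Integration.integral_diff Bochner_Integration.integral_sum ind_\<sigma> [OF E])
        also have "\<dots> \<ge> 0"
        proof (rule integral_nonneg_AE)
          have "AE r in \<sigma> n. \<forall>g. finite (eqclass r g)" using \<sigma>(5) by (simp add: FIRE_def)
          then show "AE r in \<sigma> n. 0 \<le> c (- g) * indicator E r -
            (\<Sum>k\<in>K. t k * (indicator E r * a (g + k) r - indicator E r * a k (shift (- g) r)))"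
          proof (rule AE_mp, intro AE_I2 impI)
            fix r assume r: "r \<in> space (\<sigma> n)" and fin: "\<forall>g. finite (eqclass r g)"
            show "0 \<le> c (- g) * indicator E r -
              (\<Sum>k\<in>K. t k * (indicator E r * a (g + k) r - indicator E r * a k (shift (- g) r)))"
            proof (cases "r \<in> E")
              case True
              then have r0g: "r 0 g" by (simp add: E_def)
              have "(\<Sum>k\<in>K. t k * (a (g + k) r - a k (shift (- g) r))) \<le> (\<Sum>k\<in>K. \<bar>a (g + k) r - a k (shift (- g) r)\<bar>)"
              proof (rule sum_mono)
                fix k
                have "t k * (a (g + k) r - a k (shift (- g) r)) \<le> \<bar>t k\<bar> * \<bar>a (g + k) r - a k (shift (- g) r)\<bar>"
                  unfolding abs_mult [symmetric] by (rule abs_ge_self)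
                also have "\<dots> \<le> 1 * \<bar>a (g + k) r - a k (shift (- g) r)\<bar>" by (rule mult_right_mono [OF t]) simp
                finally show "t k * (a (g + k) r - a k (shift (- g) r)) \<le> \<bar>a (g + k) r - a k (shift (- g) r)\<bar>" by simp
              qed
              also have "\<dots> \<le> l1_dist (translate (- g) (class_average f r)) (class_average f (shift (- g) r))"
                using sum_le_l1_dist [OF K, of "translate (- g) (class_average f r)" "class_average f (shift (- g) r)"]
                by (simp add: a_def pmf_translate)
              also have "\<dots> \<le> c (- g)"
                by (rule class_average_asymmetry) (use r fin r0g le in \<open>auto simp: \<sigma>\<close>)
              finally show ?thesis using True by simp
            qed simp
          qed
        qed
        finally show "0 \<le> c (- g) * measure (\<sigma> n) E - (\<Sum>k\<in>K. t k * ((\<integral>r. indicator E r * a (g + k) r \<partial>\<sigma> n) - (\<integral>r. indicator E' r * a k r \<partial>\<sigma> n)))" .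
      qed
      finally show "0 \<le> (\<integral>r. indicator C r * w r \<partial>\<rho>)" .
    qed
    then show ?thesis
      by (rule AE_mp) (auto intro!: AE_I2 simp: w_def P)
  qed

  \<comment> \<open>Off the almost sure event \<open>S r = 1\<close> the coordinates need not form a
    probability measure; a constant value there keeps \<open>lam\<close> measurable
    everywhere.\<close>
  define lam where "lam r = (if S r = 1 then to_pmf (\<lambda>k. D k r) else return_pmf 0)" for r
  have lam: "pmf (lam r) k = D k r" if "S r = 1" for r k
    using pmf_to_pmf_nn_integral [of "\<lambda>k. D k r"] D(1) that by (simp add: lam_def S_def)
  have "(\<lambda>r. pmf (lam r) k) \<in> borel_measurable Eqrel_borel" for k
  proof -
    have "(\<lambda>r. pmf (lam r) k) = (\<lambda>r. if S r = 1 then D k r else pmf (return_pmf 0) k)"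
      using lam by (auto simp: lam_def fun_eq_iff)
    also have "\<dots> \<in> borel_measurable Eqrel_borel"
      using S_meas D(2) [of k] by measurable
    finally show ?thesis .
  qed
  then have lam_meas: "lam \<in> measurable Eqrel_borel Prob_borel" by (simp add: measurable_Prob_borel_iff)
  have "AE r in \<rho>. r 0 g \<longrightarrow> l1_dist (translate (- g) (lam r)) (lam (shift (- g) r)) \<le> c (- g)" for g
  proof -
    \<comment> \<open>Sign patterns are coded by finite sets \<open>X\<close>. There are countably
      many, so the exceptional null sets can be united before \<open>X\<close> is chosen depending
      on \<open>r\<close>.\<close>
    define t :: "'a set \<Rightarrow> 'a \<Rightarrow> real" where "t X k = (if k \<in> X then 1 else - 1)" for X k
    let ?C = "Collect finite :: 'a set set"
    have "AE r in \<rho>. \<forall>K\<in>?C. \<forall>X\<in>?C. r 0 g \<longrightarrow> (\<Sum>k\<in>K. t X k * (D (g + k) r - D k (shift (- g) r))) \<le> c (- g)"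
      by (subst AE_ball_countable [OF countable_Collect_finite], intro ballI,
          subst AE_ball_countable [OF countable_Collect_finite], intro ballI)
         (rule key, auto simp: t_def)
    moreover have "AE r in \<rho>. S (shift (- g) r) = 1" by (rule IRE_AE_shift [OF \<rho> S_1])
    ultimately show ?thesis using S_1
    proof eventually_elim
      case (elim r)
      show ?case
      proof (intro impI l1_dist_leI)
        fix K :: "'a set" assume r: "r 0 g" and K: "finite K"
        define X where "X = {k \<in> K. D (g + k) r \<ge> D k (shift (- g) r)}"
        have "(\<Sum>k\<in>K. \<bar>pmf (translate (- g) (lam r)) k - pmf (lam (shift (- g) r)) k\<bar>)
            = (\<Sum>k\<in>K. t X k * (D (g + k) r - D k (shift (- g) r)))"
          by (rule sum.cong) (auto simp: pmf_translate lam elim t_def X_def)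
        also have "\<dots> \<le> c (- g)" using elim(1) K r by (auto simp: X_def)
        finally show "(\<Sum>k\<in>K. \<bar>pmf (translate (- g) (lam r)) k - pmf (lam (shift (- g) r)) k\<bar>) \<le> c (- g)" .
      qed
    qed
  qed
  with lam_meas show ?thesis by blast
qed

section \<open>Kernels from amenable actions\<close>

text \<open>For a finite set the points whose measure gives it mass above
  \<open>1 - \<epsilon>\<close> form an open set. Compactness leaves finitely many such sets, and
  their union works because mass is monotone.\<close>

lemma uniformly_tight:
  fixes \<eta> :: "'x \<Rightarrow> 'a::countable pmf"
  assumes X: "compact_space X" and \<eta>: "continuous_map X Prob_topology \<eta>" and "\<epsilon> > 0"
  shows "\<exists>K. finite K \<and> (\<forall>x\<in>topspace X. 1 - \<epsilon> \<le> (\<Sum>k\<in>K. pmf (\<eta> x) k))"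
proof -
  define O' where "O' K = {x \<in> topspace X. (\<Sum>k\<in>K. pmf (\<eta> x) k) \<in> {1 - \<epsilon><..}}" for K
  have op: "openin X (O' K)" if "finite K" for K
  proof -
    have "continuous_map X euclideanreal (\<lambda>x. \<Sum>k\<in>K. pmf (\<eta> x) k)"
      using \<eta> that unfolding continuous_map_Prob_topology by (intro continuous_map_sum) auto
    then show ?thesis
      unfolding O'_def by (rule openin_continuous_map_preimage) (simp flip: open_openin)
  qed
  have cover: "topspace X \<subseteq> \<Union>(O' ` Collect finite)"
  proof
    fix x assume "x \<in> topspace X"
    moreover obtain K where "finite K" "1 - \<epsilon> < (\<Sum>k\<in>K. pmf (\<eta> x) k)"
      using pmf_finite_mass [OF assms(3)] .
    ultimately show "x \<in> \<Union>(O' ` Collect finite)" by (auto simp: O'_def)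
  qed
  have "\<forall>U\<in>O' ` Collect finite. openin X U" using op by simp
  with cover X obtain \<F> where F: "finite \<F>" "\<F> \<subseteq> O' ` Collect finite" "topspace X \<subseteq> \<Union>\<F>"
    unfolding compact_space_alt by meson
  obtain \<K> where K: "\<K> \<subseteq> Collect finite" "finite \<K>" "\<F> = O' ` \<K>"
    using finite_subset_image [OF F(1,2)] by blast
  have "1 - \<epsilon> \<le> (\<Sum>k\<in>\<Union>\<K>. pmf (\<eta> x) k)" if x: "x \<in> topspace X" for x
  proof -
    obtain L where L: "L \<in> \<K>" "x \<in> O' L" using F(3) K(3) x by blast
    then have "1 - \<epsilon> \<le> (\<Sum>k\<in>L. pmf (\<eta> x) k)" by (simp add: O'_def)
    also have "\<dots> \<le> (\<Sum>k\<in>\<Union>\<K>. pmf (\<eta> x) k)"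
      using K L by (intro sum_mono2) auto
    finally show ?thesis .
  qed
  then show ?thesis using K by (intro exI [of _ "\<Union>\<K>"]) auto
qed

theorem exact_closure_FIRE_subset_AIRE:
  assumes "exact_group TYPE('a::{group_add, countable})"
  shows "IRE_topology closure_of FIRE \<subseteq> (AIRE :: ('a \<Rightarrow> 'a \<Rightarrow> bool) measure set)"
proof
  fix \<rho> :: "('a \<Rightarrow> 'a \<Rightarrow> bool) measure" assume \<rho>: "\<rho> \<in> IRE_topology closure_of FIRE"
  obtain X :: "(nat \<Rightarrow> real) topology" and act :: "'a \<Rightarrow> (nat \<Rightarrow> real) \<Rightarrow> (nat \<Rightarrow> real)"
    where X: "compact_space X" "topspace X \<noteq> {}" and act: "homeo_action act X" and am: "topologically_amenable act X"
    using assms unfolding exact_group_def by blast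
  obtain \<eta> :: "nat \<Rightarrow> (nat \<Rightarrow> real) \<Rightarrow> 'a pmf" where \<eta>: "\<And>n. continuous_map X Prob_topology (\<eta> n)"
    "\<And>g. (\<lambda>n. SUP x\<in>topspace X. l1_dist (translate g (\<eta> n x)) (\<eta> n (act g x))) \<longlonglongrightarrow> 0"
    using am unfolding topologically_amenable_def by blast
  obtain x0 where x0: "x0 \<in> topspace X" using X(2) by blast
  have act_in: "act g x \<in> topspace X" if "x \<in> topspace X" for g x
  proof -
    have "homeomorphic_map X X (act g)" using act unfolding homeo_action_def by blast
    then show ?thesis using that homeomorphic_imp_surjective_map by blast
  qed
  \<comment> \<open>Each \<open>n\<close> yields its own kernel on the limit relation, with
    asymmetry at \<open>g\<close> bounded by \<open>c n (- g)\<close>. Topological amenability is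
    used only afterwards, when \<open>n\<close> tends to infinity.\<close>
  define c where "c n g = (SUP x\<in>topspace X. l1_dist (translate g (\<eta> n x)) (\<eta> n (act g x)))" for n g
  have c: "l1_dist (translate g (\<eta> n x)) (\<eta> n (act g x)) \<le> c n g" if "x \<in> topspace X" for n g x
    unfolding c_def by (rule cSUP_upper [OF that]) (auto intro!: bdd_aboveI [of _ 2] l1_dist_le_2)
  have "\<exists>lam\<in>measurable Eqrel_borel Prob_borel. \<forall>g. AE r in \<rho>. r 0 g \<longrightarrow>
    l1_dist (translate (- g) (lam r)) (lam (shift (- g) r)) \<le> c n (- g)" for n
  proof (rule closure_FIRE_kernel [OF \<rho>, of "\<lambda>h. \<eta> n (act h x0)"])
    show "\<exists>K. finite K \<and> (\<forall>h. 1 - \<epsilon> \<le> (\<Sum>k\<in>K. pmf (\<eta> n (act h x0)) k))" if "\<epsilon> > 0" for \<epsilon>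
    proof -
      from uniformly_tight [OF X(1) \<eta>(1) [of n] that]
      obtain K where "finite K" "\<forall>x\<in>topspace X. 1 - \<epsilon> \<le> (\<Sum>k\<in>K. pmf (\<eta> n x) k)" by auto
      then show ?thesis using act_in [OF x0] by (intro exI [of _ K]) simp
    qed
    show "l1_dist (translate g (\<eta> n (act h x0))) (\<eta> n (act (g + h) x0)) \<le> c n g" for g h
    proof -
      have "act (g + h) x0 = act g (act h x0)" using act x0 unfolding homeo_action_def by simp
      with c [OF act_in [OF x0, of h], of g n] show ?thesis by simp
    qed
  qed
  then have "\<forall>n. \<exists>lam. lam \<in> measurable Eqrel_borel Prob_borel \<and> (\<forall>g. AE r in \<rho>. r 0 g \<longrightarrow>
    l1_dist (translate (- g) (lam r)) (lam (shift (- g) r)) \<le> c n (- g))"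
    unfolding Bex_def by (rule allI)
  from choice [OF this] obtain lam where *: "\<forall>n. lam n \<in> measurable Eqrel_borel Prob_borel \<and> (\<forall>g. AE r in \<rho>. r 0 g \<longrightarrow>
    l1_dist (translate (- g) (lam n r)) (lam n (shift (- g) r)) \<le> c n (- g))" ..
  then have lam: "\<And>n. lam n \<in> measurable Eqrel_borel Prob_borel"
    and AE: "\<And>n g. AE r in \<rho>. r 0 g \<longrightarrow> l1_dist (translate (- g) (lam n r)) (lam n (shift (- g) r)) \<le> c n (- g)"
    by simp_all
  have "AE r in \<rho>. \<forall>n g. r 0 g \<longrightarrow> l1_dist (translate (- g) (lam n r)) (lam n (shift (- g) r)) \<le> c n (- g)"
    unfolding AE_all_countable using AE by blast
  then have "AE r in \<rho>. \<forall>g\<in>eqclass r 0. (\<lambda>n. l1_dist (translate (- g) (lam n r)) (lam n (shift (- g) r))) \<longlonglongrightarrow> 0"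
  proof eventually_elim
    case (elim r)
    show ?case
    proof
      fix g assume g: "g \<in> eqclass r 0"
      show "(\<lambda>n. l1_dist (translate (- g) (lam n r)) (lam n (shift (- g) r))) \<longlonglongrightarrow> 0"
      proof (rule Lim_null_comparison)
        show "(\<lambda>n. c n (- g)) \<longlonglongrightarrow> 0" using \<eta>(2) [of "- g"] by (simp add: c_def)
      qed (use elim g in \<open>auto simp: eqclass_def\<close>)
    qed
  qed
  moreover have "\<rho> \<in> IRE" using \<rho> unfolding in_closure_of topspace_IRE_topology by blast
  ultimately show "\<rho> \<in> AIRE" using lam by (auto simp: AIRE_def)
qed

subsection \<open>Property A\<close>

text \<open>Probability densities are kept as plain functions so that the product topology, and with
  it compactness, is available.\<close>

definition simplex_on :: "'a set \<Rightarrow> ('a \<Rightarrow> real) set" where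
  "simplex_on B = {u. (\<forall>k. 0 \<le> u k) \<and> (\<forall>k. k \<notin> B \<longrightarrow> u k = 0) \<and> (\<Sum>k\<in>B. u k) = 1}"

text \<open>For \<open>u\<close> and \<open>v\<close> in the simplex this is the distance between
  \<open>u\<close> and the translate of \<open>v\<close> by \<open>s\<close>. As a finite sum it is
  continuous for pointwise convergence.\<close>

definition gap :: "'a::group_add set \<Rightarrow> 'a \<Rightarrow> ('a \<Rightarrow> real) \<Rightarrow> ('a \<Rightarrow> real) \<Rightarrow> real" where
  "gap B s u v = (\<Sum>k\<in>B \<union> (+) s ` B. \<bar>u k - v (- s + k)\<bar>)"

text \<open>Reiter's form of property A. The measure attached to \<open>h\<close> is the translate
  of \<open>p h\<close> by \<open>h\<close>; recording it relative to \<open>h\<close> puts all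
  supports into one finite set \<open>B\<close>, and \<open>gap\<close> compares the measures
  attached to \<open>h\<close> and \<open>h + s\<close>.\<close>

definition property_A :: "'a::group_add itself \<Rightarrow> bool" where
  "property_A _ \<longleftrightarrow> (\<forall>S \<epsilon>. finite (S :: 'a set) \<longrightarrow> \<epsilon> > 0 \<longrightarrow>
     (\<exists>B p. finite B \<and> (\<forall>h. p h \<in> simplex_on B) \<and> (\<forall>h. \<forall>s\<in>S. gap B s (p h) (p (h + s)) \<le> \<epsilon>)))"

lemma compact_simplex_on:
  assumes "finite B" shows "compact (simplex_on B)"
proof -
  have "simplex_on B = Pi UNIV (\<lambda>_. {0..1}) \<inter> {u. \<forall>k. k \<notin> B \<longrightarrow> u k = 0} \<inter> {u. (\<Sum>k\<in>B. u k) = 1}"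
  proof -
    have "u k \<le> 1" if "\<forall>k. 0 \<le> u k" "\<forall>k. k \<notin> B \<longrightarrow> u k = 0" "(\<Sum>k\<in>B. u k) = 1" for u :: "'a \<Rightarrow> real" and k
    proof (cases "k \<in> B")
      case True
      then have "u k \<le> (\<Sum>k\<in>B. u k)" using assms that(1) by (intro member_le_sum) auto
      then show ?thesis using that(3) by simp
    qed (use that(2) in simp)
    then show ?thesis unfolding simplex_on_def by fastforce
  qed
  moreover have "closed {u :: 'a \<Rightarrow> real. \<forall>k. k \<notin> B \<longrightarrow> u k = 0}"
    by (intro closed_Collect_all closed_Collect_imp closed_Collect_eq continuous_on_product_coordinates continuous_on_const) auto
  moreover have "closed {u :: 'a \<Rightarrow> real. (\<Sum>k\<in>B. u k) = 1}"
    by (intro closed_Collect_eq continuous_on_sum continuous_on_product_coordinates continuous_on_const)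
  ultimately show ?thesis
    by (simp add: compact_Int_closed compact_Pi_UNIV)
qed

lemma continuous_on_gap [continuous_intros]:
  assumes "\<And>k. continuous_on A (\<lambda>x. f x k)" "\<And>k. continuous_on A (\<lambda>x. g x k)"
  shows "continuous_on A (\<lambda>x. gap B s (f x) (g x))"
  unfolding gap_def by (intro continuous_intros assms)

lemma gap_nonneg: "0 \<le> gap B s u v"
  unfolding gap_def by (rule sum_nonneg) simp

lemma pmf_simplex:
  assumes "finite B" "u \<in> simplex_on B"
  shows "pmf (to_pmf u) = u" "set_pmf (to_pmf u) \<subseteq> B"
  using assms pmf_to_pmf_finite [of u B] by (auto simp: simplex_on_def)

lemma gap_eq_l1_dist:
  assumes B: "finite B" and u: "u \<in> simplex_on B" and v: "v \<in> simplex_on B"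
  shows "gap B s u v = l1_dist (to_pmf u) (translate s (to_pmf v))"
proof -
  have "l1_dist (to_pmf u) (translate s (to_pmf v))
      = (\<Sum>k\<in>B \<union> (+) s ` B. \<bar>pmf (to_pmf u) k - pmf (translate s (to_pmf v)) k\<bar>)"
    using B pmf_simplex(2) [OF B u] pmf_simplex(2) [OF B v]
    by (intro l1_dist_finite_support) (auto simp: set_pmf_translate)
  then show ?thesis
    by (simp add: gap_def pmf_translate pmf_simplex(1) [OF B u] pmf_simplex(1) [OF B v])
qed

lemma gap_le_2: "finite B \<Longrightarrow> u \<in> simplex_on B \<Longrightarrow> v \<in> simplex_on B \<Longrightarrow> gap B s u v \<le> 2"
  by (simp add: gap_eq_l1_dist l1_dist_le_2)

text \<open>The witnesses of property A themselves form a compact space on which the group acts amenably.\<close>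

theorem property_A_exact:
  assumes "property_A TYPE('a::{group_add, countable})"
  shows "exact_group TYPE('a)"
proof -
  define S :: "nat \<Rightarrow> 'a set" where "S n = from_nat ` {..<n}" for n
  have "\<exists>B p. finite B \<and> (\<forall>h. p h \<in> simplex_on B) \<and> (\<forall>h. \<forall>s\<in>S n. gap B s (p h) (p (h + s)) \<le> 1 / (real n + 1))" for n
  proof -
    have "finite (S n)" "1 / (real n + 1) > 0" by (simp_all add: S_def)
    with assms show ?thesis unfolding property_A_def by metis
  qed
  then obtain B p where B: "\<And>n. finite (B n)" and p: "\<And>n h. p n h \<in> simplex_on (B n)"
    "\<And>n h s. s \<in> S n \<Longrightarrow> gap (B n) s (p n h) (p n (h + s)) \<le> 1 / (real n + 1)" by metis
  \<comment> \<open>A point of \<open>Z\<close> is a sequence of kernels, the \<open>n\<close>-th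
    satisfying the \<open>n\<close>-th bound. The conditions are closed, they are unaffected by left
    translation of the argument \<open>h\<close>, and the given witnesses show that \<open>Z\<close>
    is nonempty.\<close>
  define Z :: "(nat \<Rightarrow> 'a \<Rightarrow> 'a \<Rightarrow> real) set" where
    "Z = Pi UNIV (\<lambda>n. Pi UNIV (\<lambda>h. simplex_on (B n))) \<inter>
      {x. \<forall>n h s. s \<in> S n \<longrightarrow> gap (B n) s (x n h) (x n (h + s)) \<le> 1 / (real n + 1)}"
  have coord: "continuous_on UNIV (\<lambda>x :: nat \<Rightarrow> 'a \<Rightarrow> 'a \<Rightarrow> real. x n h k)" for n h k
    by (intro continuous_on_product_then_coordinatewise [of _ "\<lambda>x. x n h"]
        continuous_on_product_then_coordinatewise [of _ "\<lambda>x. x n"] continuous_on_product_coordinates)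
  have cZ: "compact Z"
    unfolding Z_def
    by (intro compact_Int_closed compact_Pi_UNIV compact_simplex_on B closed_Collect_all closed_Collect_imp
        closed_Collect_le continuous_on_gap coord continuous_on_const) auto
  have pZ: "p \<in> Z" using p by (auto simp: Z_def)
  define X where "X = top_of_set Z"
  have Xs [simp]: "topspace X = Z" by (simp add: X_def)
  define act where "act g x = (\<lambda>n h. x n (- g + h))" for g :: 'a and x :: "nat \<Rightarrow> 'a \<Rightarrow> 'a \<Rightarrow> real"
  have act_Z: "act g x \<in> Z" if "x \<in> Z" for g x
    using that unfolding Z_def act_def by (auto simp: add.assoc [symmetric] Pi_iff)
  have act_cont: "continuous_map X X (act g)" for g
  proof -
    have "continuous_on UNIV (act g)"
      unfolding act_def by (intro continuous_on_coordinatewise_then_product coord)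
    then show ?thesis
      unfolding X_def using act_Z by (auto simp: continuous_map_in_subtopology intro: continuous_on_subset)
  qed
  have act_act: "act g (act h x) = act (g + h) x" for g h x
    by (simp only: act_def minus_add add.assoc)
  have act_0: "act 0 x = x" for x by (simp add: act_def)
  have "homeomorphic_maps X X (act g) (act (- g))" for g
    unfolding homeomorphic_maps_def using act_cont by (simp add: act_act act_0)
  then have homeo: "homeo_action act X"
    unfolding homeo_action_def homeomorphic_map_maps by (auto simp: act_act act_0)
  \<comment> \<open>Evaluation at the identity. Acting by \<open>g\<close> moves the evaluation to
    \<open>- g\<close>, so the failure of equivariance is exactly the gap along the edge from
    \<open>- g\<close> to the identity.\<close>
  define \<eta> where "\<eta> n x = to_pmf (x n 0)" for n and x :: "nat \<Rightarrow> 'a \<Rightarrow> 'a \<Rightarrow> real"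
  have simp_Z: "x n h \<in> simplex_on (B n)" if "x \<in> Z" for x n h using that by (auto simp: Z_def)
  have \<eta>_cont: "continuous_map X Prob_topology (\<eta> n)" for n
    unfolding continuous_map_Prob_topology
  proof
    fix k
    have "continuous_map X euclideanreal (\<lambda>x. x n 0 k)"
      unfolding X_def using continuous_on_subset [OF coord] by auto
    then show "continuous_map X euclideanreal (\<lambda>x. pmf (\<eta> n x) k)"
      by (rule continuous_map_eq) (simp add: \<eta>_def pmf_simplex(1) [OF B simp_Z])
  qed
  have bound: "l1_dist (translate g (\<eta> n x)) (\<eta> n (act g x)) \<le> 1 / (real n + 1)" if x: "x \<in> Z" and g: "g \<in> S n" for g n x
  proof -
    have "gap (B n) g (x n (- g)) (x n (- g + g)) \<le> 1 / (real n + 1)" using x g unfolding Z_def by blast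
    then have "l1_dist (to_pmf (x n (- g))) (translate g (to_pmf (x n 0))) \<le> 1 / (real n + 1)"
      by (simp add: gap_eq_l1_dist [OF B simp_Z simp_Z] x)
    then show ?thesis by (simp add: \<eta>_def act_def l1_dist_commute)
  qed
  have "(\<lambda>n. SUP x\<in>topspace X. l1_dist (translate g (\<eta> n x)) (\<eta> n (act g x))) \<longlonglongrightarrow> 0" for g
  proof (rule Lim_null_comparison)
    show "(\<lambda>n. 1 / (real n + 1)) \<longlonglongrightarrow> 0" by real_asymp
    show "\<forall>\<^sub>F n in sequentially. norm (SUP x\<in>topspace X. l1_dist (translate g (\<eta> n x)) (\<eta> n (act g x))) \<le> 1 / (real n + 1)"
      using eventually_gt_at_top [of "to_nat g"]
    proof eventually_elim
      case (elim n)
      have "g \<in> S n" unfolding S_def using elim by (intro image_eqI [of _ _ "to_nat g"]) auto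
      then have "(SUP x\<in>topspace X. l1_dist (translate g (\<eta> n x)) (\<eta> n (act g x))) \<le> 1 / (real n + 1)"
        using pZ bound [of _ g n] by (intro cSUP_least) (auto simp: add.commute)
      moreover have "0 \<le> (SUP x\<in>topspace X. l1_dist (translate g (\<eta> n x)) (\<eta> n (act g x)))"
        using pZ by (intro cSUP_upper2 [of _ _ p]) (auto intro!: bdd_aboveI [of _ 2] l1_dist_le_2)
      ultimately show ?case by simp
    qed
  qed
  then have "topologically_amenable act X"
    unfolding topologically_amenable_def using \<eta>_cont by blast
  then show ?thesis
    using homeo cZ pZ
    by (intro exact_groupI [of X act]) (auto simp: X_def compact_space_subtopology metrizable_space_subtopology metrizable_space_euclidean)
qed

section \<open>From weighted averages to uniform bounds\<close>

definition kernels :: "'a set \<Rightarrow> ('a \<Rightarrow> 'a \<Rightarrow> real) set" where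
  "kernels B = Pi UNIV (\<lambda>_. simplex_on B)"

text \<open>A pair \<open>e\<close> stands for the edge from \<open>fst e\<close> to
  \<open>fst e + snd e\<close> of the Cayley graph.\<close>

definition cost :: "'a::group_add set \<Rightarrow> ('a \<Rightarrow> 'a \<Rightarrow> real) \<Rightarrow> 'a \<times> 'a \<Rightarrow> real" where
  "cost B p e = gap B (snd e) (p (fst e)) (p (fst e + snd e))"

lemma kernels_iff: "p \<in> kernels B \<longleftrightarrow> (\<forall>h. p h \<in> simplex_on B)"
  by (auto simp: kernels_def)

lemma compact_kernels: "finite B \<Longrightarrow> compact (kernels B)"
  unfolding kernels_def by (intro compact_Pi_UNIV compact_simplex_on)

lemma continuous_on_cost:
  fixes B :: "'a::group_add set"
  shows "continuous_on A (\<lambda>p. cost B p e)"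
proof -
  have "continuous_on UNIV (\<lambda>p :: 'a \<Rightarrow> 'a \<Rightarrow> real. p h k)" for h k
    by (rule continuous_on_product_then_coordinatewise [OF continuous_on_product_coordinates])
  from continuous_on_gap [OF this this] have "continuous_on UNIV (\<lambda>p. cost B p e)"
    unfolding cost_def .
  then show ?thesis by (rule continuous_on_subset) simp
qed

lemma cost_nonneg: "0 \<le> cost B p e"
  by (simp add: cost_def gap_nonneg)

lemma cost_le_2: "finite B \<Longrightarrow> p \<in> kernels B \<Longrightarrow> cost B p e \<le> 2"
  by (simp add: cost_def gap_le_2 kernels_iff)

lemma kernels_convex:
  assumes "p \<in> kernels B" "q \<in> kernels B" "0 \<le> t" "t \<le> 1"
  shows "(\<lambda>h k. (1 - t) * p h k + t * q h k) \<in> kernels B"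
  using assms by (auto simp: kernels_iff simplex_on_def sum.distrib simp flip: sum_distrib_left)

lemma cost_convex:
  assumes "0 \<le> t" "t \<le> 1"
  shows "cost B (\<lambda>h k. (1 - t) * p h k + t * q h k) e \<le> (1 - t) * cost B p e + t * cost B q e"
  unfolding cost_def gap_def sum_distrib_left sum.distrib [symmetric]
proof (rule sum_mono)
  fix k
  define x y where "x = p (fst e) k - p (fst e + snd e) (- snd e + k)" and "y = q (fst e) k - q (fst e + snd e) (- snd e + k)"
  have "\<bar>(1 - t) * x + t * y\<bar> \<le> \<bar>(1 - t) * x\<bar> + \<bar>t * y\<bar>" by (rule abs_triangle_ineq)
  also have "\<dots> = (1 - t) * \<bar>x\<bar> + t * \<bar>y\<bar>" using assms by (simp add: abs_mult)
  also have "(1 - t) * x + t * y = (1 - t) * p (fst e) k + t * q (fst e) k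
      - ((1 - t) * p (fst e + snd e) (- snd e + k) + t * q (fst e + snd e) (- snd e + k))"
    by (simp add: x_def y_def algebra_simps)
  finally show "\<bar>(1 - t) * p (fst e) k + t * q (fst e) k
      - ((1 - t) * p (fst e + snd e) (- snd e + k) + t * q (fst e + snd e) (- snd e + k))\<bar>
    \<le> (1 - t) * \<bar>p (fst e) k - p (fst e + snd e) (- snd e + k)\<bar> + t * \<bar>q (fst e) k - q (fst e + snd e) (- snd e + k)\<bar>"
    by (simp add: x_def y_def)
qed

text \<open>A minimax argument without separation theorems: at a minimizer of \<open>\<Sum>e. (cost e - 2\<epsilon>)\<^sub>+\<^sup>2\<close>, the
  weights \<open>(cost e - 2\<epsilon>)\<^sub>+\<close> contradict the hypothesis unless they all vanish.\<close>

lemma weighted_to_uniform: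
  fixes B :: "'a::group_add set"
  assumes B: "finite B" and E: "finite E" and \<epsilon>: "\<epsilon> > 0"
    and W: "\<And>w. (\<And>e. 0 \<le> w e) \<Longrightarrow> \<exists>p\<in>kernels B. (\<Sum>e\<in>E. w e * cost B p e) \<le> \<epsilon> * (\<Sum>e\<in>E. w e)"
  shows "\<exists>p\<in>kernels B. \<forall>e\<in>E. cost B p e \<le> 2 * \<epsilon>"
proof -
  define F where "F p = (\<Sum>e\<in>E. (max 0 (cost B p e - 2 * \<epsilon>))\<^sup>2)" for p
  have "continuous_on (kernels B) F"
    unfolding F_def by (intro continuous_intros continuous_on_cost)
  moreover have "kernels B \<noteq> {}" using W [of "\<lambda>_. 0"] by auto
  ultimately obtain p where p: "p \<in> kernels B" and min: "\<And>q. q \<in> kernels B \<Longrightarrow> F p \<le> F q"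
    using continuous_attains_inf [OF compact_kernels [OF B]] by blast
  define w where "w e = max 0 (cost B p e - 2 * \<epsilon>)" for e
  obtain q where q: "q \<in> kernels B" "(\<Sum>e\<in>E. w e * cost B q e) \<le> \<epsilon> * (\<Sum>e\<in>E. w e)"
    using W [of w] by (auto simp: w_def)
  define d where "d e = cost B q e - cost B p e" for e
  \<comment> \<open>First-order condition at the minimizer without derivatives: moving a proportion
    \<open>t\<close> towards \<open>q\<close> cannot decrease \<open>F\<close>. After division by
    \<open>t\<close>, letting \<open>t\<close> tend to 0 leaves the linear term.\<close>
  have var: "0 \<le> 2 * (\<Sum>e\<in>E. w e * d e) + t * (\<Sum>e\<in>E. (d e)\<^sup>2)" if t: "0 < t" "t \<le> 1" for t
  proof -
    let ?q = "\<lambda>h k. (1 - t) * p h k + t * q h k"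
    have "(\<Sum>e\<in>E. (w e)\<^sup>2) \<le> F ?q"
      using min [OF kernels_convex [OF p q(1)], of t] t by (simp add: F_def w_def)
    also have "\<dots> \<le> (\<Sum>e\<in>E. (w e + t * d e)\<^sup>2)"
      unfolding F_def
    proof (rule sum_mono)
      fix e
      have "cost B ?q e - 2 * \<epsilon> \<le> w e + t * d e"
        using cost_convex [of t B p q e] t by (simp add: w_def d_def algebra_simps)
      then have "max 0 (cost B ?q e - 2 * \<epsilon>) \<le> \<bar>w e + t * d e\<bar>" by linarith
      then show "(max 0 (cost B ?q e - 2 * \<epsilon>))\<^sup>2 \<le> (w e + t * d e)\<^sup>2"
        using power_mono [of "max 0 (cost B ?q e - 2 * \<epsilon>)" "\<bar>w e + t * d e\<bar>" 2] by simp
    qed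
    also have "\<dots> = (\<Sum>e\<in>E. (w e)\<^sup>2) + t * (2 * (\<Sum>e\<in>E. w e * d e) + t * (\<Sum>e\<in>E. (d e)\<^sup>2))"
      by (simp add: power2_eq_square algebra_simps sum.distrib sum_distrib_left)
    finally have "0 \<le> t * (2 * (\<Sum>e\<in>E. w e * d e) + t * (\<Sum>e\<in>E. (d e)\<^sup>2))" by simp
    then show ?thesis using t(1) by (simp add: zero_le_mult_iff)
  qed
  have "0 \<le> 2 * (\<Sum>e\<in>E. w e * d e)"
  proof (rule LIMSEQ_le_const)
    have "(\<lambda>n. 1 / real (Suc n)) \<longlonglongrightarrow> 0" by (rule LIMSEQ_Suc [OF lim_1_over_n])
    then have "(\<lambda>n. 2 * (\<Sum>e\<in>E. w e * d e) + (1 / real (Suc n)) * (\<Sum>e\<in>E. (d e)\<^sup>2))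
        \<longlonglongrightarrow> 2 * (\<Sum>e\<in>E. w e * d e) + 0 * (\<Sum>e\<in>E. (d e)\<^sup>2)"
      by (intro tendsto_intros)
    then show "(\<lambda>n. 2 * (\<Sum>e\<in>E. w e * d e) + (1 / real (Suc n)) * (\<Sum>e\<in>E. (d e)\<^sup>2)) \<longlonglongrightarrow> 2 * (\<Sum>e\<in>E. w e * d e)"
      by simp
    show "\<exists>N. \<forall>n\<ge>N. 0 \<le> 2 * (\<Sum>e\<in>E. w e * d e) + (1 / real (Suc n)) * (\<Sum>e\<in>E. (d e)\<^sup>2)"
      by (intro exI allI impI var) auto
  qed
  then have "(\<Sum>e\<in>E. w e * cost B p e) \<le> (\<Sum>e\<in>E. w e * cost B q e)"
    by (simp add: d_def right_diff_distrib sum_subtractf)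
  also have "\<dots> \<le> \<epsilon> * (\<Sum>e\<in>E. w e)" by (rule q)
  \<comment> \<open>A positive weight means a cost above \<open>2 * \<epsilon>\<close>. The factor 2
    between this threshold and the hypothesis forces all weights to vanish.\<close>
  also have "(\<Sum>e\<in>E. w e * cost B p e) \<ge> (\<Sum>e\<in>E. w e * (2 * \<epsilon>))"
  proof (rule sum_mono)
    fix e show "w e * (2 * \<epsilon>) \<le> w e * cost B p e"
      by (cases "cost B p e \<le> 2 * \<epsilon>") (auto simp: w_def max_def intro!: mult_left_mono)
  qed
  finally have "(\<Sum>e\<in>E. w e) * (2 * \<epsilon>) \<le> \<epsilon> * (\<Sum>e\<in>E. w e)"
    unfolding sum_distrib_right .
  then have "\<epsilon> * (\<Sum>e\<in>E. w e) \<le> 0" by simp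
  then have "(\<Sum>e\<in>E. w e) \<le> 0" using \<epsilon> by (simp add: mult_le_0_iff)
  moreover have "0 \<le> w e" for e by (simp add: w_def)
  ultimately have "\<forall>e\<in>E. w e = 0"
    using E by (metis antisym sum_nonneg sum_nonneg_eq_0_iff)
  then have "cost B p e \<le> 2 * \<epsilon>" if "e \<in> E" for e
    using that max.cobounded2 [of "cost B p e - 2 * \<epsilon>" 0] by (auto simp: w_def)
  then show ?thesis using p by blast
qed

text \<open>Minimax handles finitely many edges. Kernels for growing finite sets of edges accumulate
  at some point of the compact space \<open>kernels B\<close>, and each individual bound is a closed
  condition.\<close>

lemma property_A_if_weighted:
  assumes W: "\<And>(S :: 'a::{group_add, countable} set) \<epsilon>. finite S \<Longrightarrow> \<epsilon> > 0 \<Longrightarrow> \<exists>B. finite B \<and> (\<forall>E w. finite E \<longrightarrow> E \<subseteq> UNIV \<times> S \<longrightarrow> (\<forall>e. 0 \<le> w e) \<longrightarrow>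
    (\<exists>p\<in>kernels B. (\<Sum>e\<in>E. w e * cost B p e) \<le> \<epsilon> * (\<Sum>e\<in>E. w e)))"
  shows "property_A TYPE('a)"
  unfolding property_A_def
proof (intro allI impI)
  fix S :: "'a set" and \<epsilon> :: real assume S: "finite S" and \<epsilon>: "\<epsilon> > 0"
  then have "\<epsilon> / 2 > 0" by simp
  then obtain B where B: "finite B" and BW: "\<And>E w. finite E \<Longrightarrow> E \<subseteq> UNIV \<times> S \<Longrightarrow> (\<And>e. 0 \<le> w e) \<Longrightarrow>
    \<exists>p\<in>kernels B. (\<Sum>e\<in>E. w e * cost B p e) \<le> \<epsilon> / 2 * (\<Sum>e\<in>E. w e)"
    using W [OF S] by meson
  define E where "E n = (from_nat ` {..<n} :: 'a set) \<times> S" for n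
  have "\<exists>p\<in>kernels B. \<forall>e\<in>E n. cost B p e \<le> \<epsilon>" for n
  proof -
    have "finite (E n)" "E n \<subseteq> UNIV \<times> S" using S by (auto simp: E_def)
    then show ?thesis
      using weighted_to_uniform [OF B _ \<open>\<epsilon> / 2 > 0\<close> BW, of "E n"] by simp
  qed
  then have "\<forall>n. \<exists>p. p \<in> kernels B \<and> (\<forall>e\<in>E n. cost B p e \<le> \<epsilon>)" by blast
  from choice [OF this] obtain P where P: "\<And>n. P n \<in> kernels B" "\<And>n e. e \<in> E n \<Longrightarrow> cost B (P n) e \<le> \<epsilon>" by blast
  obtain p r where p: "p \<in> kernels B" and r: "strict_mono (r :: nat \<Rightarrow> nat)" and lim: "(P \<circ> r) \<longlonglongrightarrow> p"
    using compact_kernels [OF B] P(1) unfolding compact_def by meson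
  have "cost B p (h, s) \<le> \<epsilon>" if s: "s \<in> S" for h s
  proof (rule LIMSEQ_le_const2)
    have "isCont (\<lambda>p. cost B p (h, s)) p"
      using continuous_on_eq_continuous_at [OF open_UNIV] continuous_on_cost [of UNIV B "(h, s)"] by blast
    from isCont_tendsto_compose [OF this lim]
    show "(\<lambda>n. cost B (P (r n)) (h, s)) \<longlonglongrightarrow> cost B p (h, s)" by (simp add: o_def)
    show "\<exists>N. \<forall>n\<ge>N. cost B (P (r n)) (h, s) \<le> \<epsilon>"
    proof (intro exI allI impI P(2))
      fix n assume "n \<ge> Suc (to_nat h)"
      then have "to_nat h < r n" using seq_suble [OF r, of n] by linarith
      then have "h \<in> from_nat ` {..<r n}" by (intro image_eqI [of _ _ "to_nat h"]) auto
      with s show "(h, s) \<in> E (r n)" by (simp add: E_def)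
    qed
  qed
  then show "\<exists>B p. finite B \<and> (\<forall>h. p h \<in> simplex_on B) \<and> (\<forall>h. \<forall>s\<in>S. gap B s (p h) (p (h + s)) \<le> \<epsilon>)"
    using B p by (intro exI [of _ B] exI [of _ p]) (simp add: cost_def kernels_iff)
qed

section \<open>From counting measure to weights through layers\<close>

text \<open>The offset \<open>u\<close> moves the partition of the integers into blocks of length
  \<open>m\<close>. Neighbours are separated only if a block starts at the larger one, which
  determines \<open>u\<close> modulo \<open>m\<close>.\<close>

lemma card_cut_offsets_le_1:
  fixes x y :: int and m :: nat
  assumes m: "m > 0" and xy: "\<bar>x - y\<bar> \<le> 1"
  shows "card {u \<in> {0..<m}. (x + int u) div int m \<noteq> (y + int u) div int m} \<le> 1"
proof -
  have *: "card {u \<in> {0..<m}. (x + int u) div int m \<noteq> (x + 1 + int u) div int m} \<le> 1" for x :: int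
  proof -
    have dvd: "int m dvd x + 1 + int u" if "(x + int u) div int m \<noteq> (x + 1 + int u) div int m" for u
    proof (rule ccontr)
      assume "\<not> int m dvd x + 1 + int u"
      then have r: "(x + 1 + int u) mod int m \<noteq> 0" by (simp add: dvd_eq_mod_eq_0)
      have "0 \<le> (x + 1 + int u) mod int m" "(x + 1 + int u) mod int m < int m" using m by simp_all
      with r have r': "0 \<le> (x + 1 + int u) mod int m - 1" "(x + 1 + int u) mod int m - 1 < int m" by linarith+
      have eq: "x + int u = int m * ((x + 1 + int u) div int m) + ((x + 1 + int u) mod int m - 1)"
        using mult_div_mod_eq [of "int m" "x + 1 + int u"] by linarith
      have "(x + int u) div int m = (x + 1 + int u) div int m"
        by (subst eq) (use r' in simp)
      with that show False by simp
    qed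
    have "u = v" if u: "u < m" "(x + int u) div int m \<noteq> (x + 1 + int u) div int m"
      and v: "v < m" "(x + int v) div int m \<noteq> (x + 1 + int v) div int m" for u v
    proof -
      have "int m dvd (x + 1 + int u) - (x + 1 + int v)" by (intro dvd_diff dvd u v)
      then have "int m dvd int u - int v" by simp
      moreover have "\<bar>int u - int v\<bar> < int m" using u v by linarith
      ultimately show ?thesis using dvd_imp_le_int [of "int u - int v" "int m"] by (cases "u = v") auto
    qed
    then show ?thesis by (auto simp: card_le_Suc0_iff_eq)
  qed
  consider "x = y" | "y = x + 1" | "x = y + 1" using xy by linarith
  then show ?thesis
  proof cases
    case 2 then show ?thesis using * [of x] by simp
  next
    case 3
    then have "{u \<in> {0..<m}. (x + int u) div int m \<noteq> (y + int u) div int m}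
        = {u \<in> {0..<m}. (y + int u) div int m \<noteq> (y + 1 + int u) div int m}" by auto
    then show ?thesis using * [of y] by (simp only:)
  qed simp
qed

text \<open>Averaging over the \<open>m\<close> offsets: every edge is cut by at most one of
  them.\<close>

lemma exists_cheap_offset:
  fixes j j' :: "'e \<Rightarrow> int" and w :: "'e \<Rightarrow> real"
  assumes E: "finite E" and w: "\<And>e. e \<in> E \<Longrightarrow> 0 \<le> w e" and m: "m > 0"
    and j: "\<And>e. e \<in> E \<Longrightarrow> \<bar>j e - j' e\<bar> \<le> 1"
  obtains u where "u < m" "(\<Sum>e\<in>{e \<in> E. (j e + int u) div int m \<noteq> (j' e + int u) div int m}. w e) \<le> (\<Sum>e\<in>E. w e) / real m"
proof -
  let ?cut = "\<lambda>u e. (j e + int u) div int m \<noteq> (j' e + int u) div int m"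
  have "(\<Sum>u\<in>{0..<m}. \<Sum>e\<in>{e \<in> E. ?cut u e}. w e) = (\<Sum>u\<in>{0..<m}. \<Sum>e\<in>E. if ?cut u e then w e else 0)"
    using E by (intro sum.cong refl sum.inter_filter)
  also have "\<dots> = (\<Sum>e\<in>E. \<Sum>u\<in>{0..<m}. if ?cut u e then w e else 0)" by (rule sum.swap)
  also have "\<dots> = (\<Sum>e\<in>E. card {u \<in> {0..<m}. ?cut u e} * w e)"
    by (intro sum.cong refl) (simp add: sum.inter_filter [symmetric])
  also have "\<dots> \<le> (\<Sum>e\<in>E. 1 * w e)"
  proof (rule sum_mono)
    fix e assume e: "e \<in> E"
    have "real (card {u \<in> {0..<m}. ?cut u e}) \<le> 1"
      using card_cut_offsets_le_1 [OF m j [OF e]] by simp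
    then show "card {u \<in> {0..<m}. ?cut u e} * w e \<le> 1 * w e" using w [OF e] by (rule mult_right_mono)
  qed
  finally have le: "(\<Sum>u\<in>{0..<m}. \<Sum>e\<in>{e \<in> E. ?cut u e}. w e) \<le> (\<Sum>e\<in>E. w e)" by simp
  have "\<exists>u<m. (\<Sum>e\<in>{e \<in> E. ?cut u e}. w e) \<le> (\<Sum>e\<in>E. w e) / real m"
  proof (rule ccontr)
    assume "\<not> ?thesis"
    then have "(\<Sum>u\<in>{0..<m}. (\<Sum>e\<in>E. w e) / real m) < (\<Sum>u\<in>{0..<m}. \<Sum>e\<in>{e \<in> E. ?cut u e}. w e)"
      using m by (intro sum_strict_mono) (auto simp: not_le)
    then show False using le m by simp
  qed
  then show ?thesis using that by blast
qed

definition inner_edges :: "'a::group_add set \<Rightarrow> 'a set \<Rightarrow> ('a \<times> 'a) set" where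
  "inner_edges S V = {e \<in> V \<times> S. fst e + snd e \<in> V}"

lemma finite_inner_edges: "finite S \<Longrightarrow> finite V \<Longrightarrow> finite (inner_edges S V)"
  unfolding inner_edges_def by simp

text \<open>Passing from counting measure to arbitrary weights: vertices are grouped into layers on which
  the weight varies by a bounded factor, and the layers are offset so that few edges are cut.\<close>

lemma unweighted_to_weighted:
  fixes S :: "'a::group_add set" and w :: "'a \<times> 'a \<Rightarrow> real" and b :: real
  assumes S: "finite S" and B: "finite B" and m: "m > 0" and b: "b > 1" and \<delta>: "0 < \<delta>"
    and U: "\<And>V. finite V \<Longrightarrow> \<exists>p\<in>kernels B. (\<Sum>e\<in>inner_edges S V. cost B p e) \<le> \<delta> / b ^ m * card V"
    and E: "finite E" "E \<subseteq> UNIV \<times> S" and w: "\<And>e. e \<in> E \<Longrightarrow> 0 < w e"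
  shows "\<exists>p\<in>kernels B. (\<Sum>e\<in>E. w e * cost B p e) \<le> (2 * \<delta> + 2 / m + 8 * card S / b) * (\<Sum>e\<in>E. w e)"
proof -
  define tgt :: "'a \<times> 'a \<Rightarrow> 'a" where "tgt e = fst e + snd e" for e
  define X where "X = fst ` E \<union> tgt ` E"
  have X: "finite X" using E(1) by (simp add: X_def)
  have EX: "fst e \<in> X" "tgt e \<in> X" "snd e \<in> S" if "e \<in> E" for e using that E(2) by (auto simp: X_def)
  \<comment> \<open>Total weight of the edges at \<open>v\<close>, a loop counting twice, so that
    the vertex weights always add up to twice the edge weight.\<close>
  define W where "W v = (\<Sum>e\<in>E. w e * ((if fst e = v then 1 else 0) + (if tgt e = v then 1 else 0)))" for v
  have W_ge: "w e \<le> W (fst e)" "w e \<le> W (tgt e)" if e: "e \<in> E" for e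
  proof -
    let ?f = "\<lambda>v e. w e * ((if fst e = v then 1 else 0) + (if tgt e = v then 1 else 0))"
    have "?f v e \<le> W v" for v
      unfolding W_def using e E(1) less_imp_le [OF w] by (intro member_le_sum) auto
    from this [of "fst e"] this [of "tgt e"] w [OF e] show "w e \<le> W (fst e)" "w e \<le> W (tgt e)"
      by (auto split: if_splits)
  qed
  have W_sum: "(\<Sum>v\<in>X. W v) = 2 * (\<Sum>e\<in>E. w e)"
  proof -
    have "(\<Sum>v\<in>X. W v) = (\<Sum>e\<in>E. \<Sum>v\<in>X. w e * ((if fst e = v then 1 else 0) + (if tgt e = v then 1 else 0)))"
      unfolding W_def by (rule sum.swap)
    also have "\<dots> = (\<Sum>e\<in>E. w e * 2)"
      using X EX by (intro sum.cong refl) (simp add: sum_distrib_left [symmetric] sum.distrib)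
    finally show ?thesis by (simp add: sum_distrib_right mult.commute)
  qed
  have W_pos: "0 < W v" if "v \<in> X" for v
  proof -
    from that obtain e where e: "e \<in> E" "v = fst e \<or> v = tgt e" unfolding X_def by blast
    then show ?thesis using W_ge [OF e(1)] w [OF e(1)] by auto
  qed
  \<comment> \<open>The order of magnitude of the vertex weight to base \<open>b\<close>. Edges
    whose ends differ by two orders or more are treated separately as negligible.\<close>
  define j where "j v = \<lfloor>log b (W v)\<rfloor>" for v
  have j_le: "b powr j v \<le> W v" and j_gt: "W v < b powr (j v + 1)" if "v \<in> X" for v
  proof -
    have "b powr j v \<le> b powr (log b (W v))" "b powr (log b (W v)) < b powr (j v + 1)"
      using b by (auto simp: j_def powr_mono intro: powr_less_mono)
    moreover have "b powr (log b (W v)) = W v" using b W_pos [OF that] by simp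
    ultimately show "b powr j v \<le> W v" "W v < b powr (j v + 1)" by simp_all
  qed
  define far where "far = {e \<in> E. \<bar>j (fst e) - j (tgt e)\<bar> > 1}"
  define near where "near = {e \<in> E. \<bar>j (fst e) - j (tgt e)\<bar> \<le> 1}"
  have fin: "finite far" "finite near" using E(1) by (auto simp: far_def near_def)
  have wnn: "0 \<le> w e" if "e \<in> E" for e using w [OF that] by simp
  have near_sum: "(\<Sum>e\<in>near. w e) \<le> (\<Sum>e\<in>E. w e)"
    using E(1) wnn by (intro sum_mono2) (auto simp: near_def)
  \<comment> \<open>An edge weighs at most as much as its lighter end, which is at most
    \<open>1 / b\<close> of the heavier one. Each vertex starts at most \<open>card S\<close> edges
    and ends at most \<open>card S\<close>; with the total vertex weight this gives the constant
    4.\<close>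
  have far_sum: "(\<Sum>e\<in>far. w e) \<le> 4 * card S / b * (\<Sum>e\<in>E. w e)"
  proof -
    have drop: "W x \<le> W y / b" if x: "x \<in> X" and y: "y \<in> X" and xy: "j x + 2 \<le> j y" for x y
    proof -
      have "W x \<le> b powr (j x + 1)" using j_gt [OF x] by simp
      also have "\<dots> \<le> b powr (j y - 1)" using b xy by (intro powr_mono) auto
      also have "\<dots> = b powr j y / b" using b by (simp add: powr_diff)
      also have "\<dots> \<le> W y / b" using b j_le [OF y] by (intro divide_right_mono) auto
      finally show ?thesis .
    qed
    have "(\<Sum>e\<in>far. w e) \<le> (\<Sum>e\<in>far. (W (fst e) + W (tgt e)) / b)"
    proof (rule sum_mono)
      fix e assume "e \<in> far"
      then have e: "e \<in> E" and f: "\<bar>j (fst e) - j (tgt e)\<bar> > 1" by (auto simp: far_def)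
      have pos: "0 \<le> W (fst e) / b" "0 \<le> W (tgt e) / b"
        using b W_pos EX [OF e] by (auto intro: less_imp_le)
      from f consider "j (fst e) + 2 \<le> j (tgt e)" | "j (tgt e) + 2 \<le> j (fst e)" by linarith
      then have "w e \<le> W (fst e) / b + W (tgt e) / b"
      proof cases
        case 1
        then have "w e \<le> W (tgt e) / b" using drop [of "fst e" "tgt e"] EX [OF e] W_ge [OF e] by linarith
        then show ?thesis using pos by linarith
      next
        case 2
        then have "w e \<le> W (fst e) / b" using drop [of "tgt e" "fst e"] EX [OF e] W_ge [OF e] by linarith
        then show ?thesis using pos by linarith
      qed
      then show "w e \<le> (W (fst e) + W (tgt e)) / b" by (simp add: add_divide_distrib)
    qed
    also have "\<dots> \<le> (\<Sum>e\<in>E. (W (fst e) + W (tgt e)) / b)"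
    proof (rule sum_mono2 [OF E(1)])
      show "far \<subseteq> E" by (auto simp: far_def)
      fix e assume "e \<in> E - far"
      then show "0 \<le> (W (fst e) + W (tgt e)) / b"
        using b W_pos [OF EX(1), of e] W_pos [OF EX(2), of e] by simp
    qed
    also have "\<dots> = ((\<Sum>e\<in>E. W (fst e)) + (\<Sum>e\<in>E. W (tgt e))) / b"
      by (simp add: sum_divide_distrib [symmetric] sum.distrib)
    also have "\<dots> \<le> (card S * (\<Sum>v\<in>X. W v) + card S * (\<Sum>v\<in>X. W v)) / b"
    proof (intro divide_right_mono add_mono)
      have prod: "(\<Sum>e\<in>X \<times> S. W (fst e)) = card S * (\<Sum>v\<in>X. W v)"
      proof -
        have "(\<Sum>e\<in>X \<times> S. W (fst e)) = (\<Sum>x\<in>X. \<Sum>s\<in>S. W x)"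
          unfolding sum.cartesian_product by (simp add: case_prod_beta)
        then show ?thesis by (simp add: sum_distrib_left)
      qed
      have sub: "(\<Sum>e\<in>E'. W (fst e)) \<le> (\<Sum>e\<in>X \<times> S. W (fst e))" if "E' \<subseteq> X \<times> S" for E'
        using that X S W_pos by (intro sum_mono2) (auto intro: less_imp_le)
      have "E \<subseteq> X \<times> S" using EX by (metis mem_Times_iff subsetI)
      then show "(\<Sum>e\<in>E. W (fst e)) \<le> card S * (\<Sum>v\<in>X. W v)" using sub [of E] prod by simp
      have inj: "inj_on (\<lambda>e. (tgt e, snd e)) E" by (auto simp: inj_on_def tgt_def)
      have "(\<Sum>e\<in>E. W (tgt e)) = (\<Sum>e\<in>(\<lambda>e. (tgt e, snd e)) ` E. W (fst e))"
        by (subst sum.reindex [OF inj]) simp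
      also have "\<dots> \<le> card S * (\<Sum>v\<in>X. W v)"
      proof -
        have "(\<lambda>e. (tgt e, snd e)) ` E \<subseteq> X \<times> S"
          using EX(2,3) by (intro image_subsetI) (simp only: mem_Times_iff fst_conv snd_conv simp_thms)
        from sub [OF this] show ?thesis unfolding prod .
      qed
      finally show "(\<Sum>e\<in>E. W (tgt e)) \<le> card S * (\<Sum>v\<in>X. W v)" .
    qed (use b in simp)
    also have "\<dots> = 4 * card S / b * (\<Sum>e\<in>E. w e)" by (simp add: W_sum)
    finally show ?thesis .
  qed
  obtain u where u: "u < m" and cut: "(\<Sum>e\<in>{e \<in> near. (j (fst e) + int u) div int m \<noteq> (j (tgt e) + int u) div int m}. w e)
      \<le> (\<Sum>e\<in>near. w e) / real m"
    by (rule exists_cheap_offset [OF fin(2) _ m, of w "\<lambda>e. j (fst e)" "\<lambda>e. j (tgt e)"])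
       (use wnn in \<open>auto simp: near_def\<close>)
  define q where "q v = (j v + int u) div int m" for v
  define cutE where "cutE = {e \<in> near. q (fst e) \<noteq> q (tgt e)}"
  define good where "good = {e \<in> near. q (fst e) = q (tgt e)}"
  have cut_sum: "(\<Sum>e\<in>cutE. w e) \<le> (\<Sum>e\<in>E. w e) / m"
    using cut near_sum divide_right_mono [OF near_sum, of "real m"] by (simp add: cutE_def q_def)
  have E_split: "E = far \<union> (cutE \<union> good)" "far \<inter> (cutE \<union> good) = {}" "cutE \<inter> good = {}"
    by (auto simp: far_def near_def cutE_def good_def)
  have fin2: "finite cutE" "finite good" using fin by (auto simp: cutE_def good_def)
  \<comment> \<open>A layer consists of \<open>m\<close> consecutive orders of magnitude. Weights in
    it vary by at most a factor \<open>b ^ m\<close>, which is why the hypothesis \<open>U\<close>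
    has this denominator.\<close>
  define V where "V i = {v \<in> X. q v = i}" for i
  have finV: "finite (V i)" for i using X by (simp add: V_def)
  have "\<forall>i. \<exists>p. p \<in> kernels B \<and> (\<Sum>e\<in>inner_edges S (V i). cost B p e) \<le> \<delta> / b ^ m * card (V i)"
    using U [OF finV] by blast
  from choice [OF this] obtain P where P: "\<And>i. P i \<in> kernels B"
    "\<And>i. (\<Sum>e\<in>inner_edges S (V i). cost B (P i) e) \<le> \<delta> / b ^ m * card (V i)" by blast
  \<comment> \<open>The kernels of different layers are chosen independently; edges joining two
    layers are far or cut, and are paid for with the trivial cost 2.\<close>
  define p where "p h = P (q h) h" for h
  have p: "p \<in> kernels B" using P(1) by (auto simp: kernels_iff p_def)
  define Q where "Q = q ` X"
  \<comment> \<open>An upper bound for the weights in layer \<open>i\<close>: the orders of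
    magnitude in it are smaller than \<open>(i + 1) * m - u\<close>.\<close>
  define Mx where "Mx i = b powr ((i + 1) * int m - int u)" for i :: int
  have Mx_gt: "W v \<le> Mx (q v)" and Mx_le: "Mx (q v) \<le> b ^ m * W v" if v: "v \<in> X" for v
  proof -
    have m': "0 < int m" using m by simp
    have "j v + int u = q v * int m + (j v + int u) mod int m"
      unfolding q_def by (rule div_mult_mod_eq [symmetric])
    moreover have "0 \<le> (j v + int u) mod int m" "(j v + int u) mod int m < int m" using m' by simp_all
    moreover have "(q v + 1) * int m = q v * int m + int m" by (simp add: distrib_right)
    ultimately have 1: "q v * int m \<le> j v + int u" "j v + int u < (q v + 1) * int m" by linarith+
    have "j v + 1 \<le> (q v + 1) * int m - int u" using 1 by linarith
    then have "real_of_int (j v + 1) \<le> real_of_int ((q v + 1) * int m - int u)" by (simp only: of_int_le_iff)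
    then have "b powr (j v + 1) \<le> Mx (q v)" unfolding Mx_def using b by (intro powr_mono) simp_all
    then show "W v \<le> Mx (q v)" using j_gt [OF v] by simp
    have "Mx (q v) = b powr (real m + real_of_int (q v * int m - int u))"
      unfolding Mx_def by (simp add: algebra_simps)
    also have "\<dots> = b ^ m * b powr real_of_int (q v * int m - int u)"
      using b by (simp add: powr_add powr_realpow)
    also have "\<dots> \<le> b ^ m * b powr real_of_int (j v)"
    proof (intro mult_left_mono powr_mono)
      have "q v * int m - int u \<le> j v" using 1 by linarith
      then show "real_of_int (q v * int m - int u) \<le> real_of_int (j v)" by (simp only: of_int_le_iff)
    qed (use b in auto)
    also have "\<dots> \<le> b ^ m * W v" using b j_le [OF v] by (intro mult_left_mono) auto
    finally show "Mx (q v) \<le> b ^ m * W v" .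
  qed
  have good_sum: "(\<Sum>e\<in>good. w e * cost B p e) \<le> 2 * \<delta> * (\<Sum>e\<in>E. w e)"
  proof -
    have good_E: "e \<in> E" "q (fst e) = q (tgt e)" if "e \<in> good" for e
      using that by (auto simp: good_def near_def)
    have "(\<Sum>e\<in>good. w e * cost B p e) = (\<Sum>i\<in>Q. \<Sum>e\<in>{e \<in> good. q (fst e) = i}. w e * cost B p e)"
      using fin2 X EX good_E by (intro sum.group [symmetric]) (auto simp: Q_def)
    also have "\<dots> \<le> (\<Sum>i\<in>Q. \<delta> * (\<Sum>v\<in>V i. W v))"
    proof (rule sum_mono)
      fix i assume i: "i \<in> Q"
      have sub: "{e \<in> good. q (fst e) = i} \<subseteq> inner_edges S (V i)"
      proof
        fix e assume "e \<in> {e \<in> good. q (fst e) = i}"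
        then have "e \<in> E" "q (fst e) = i" "q (tgt e) = i" using good_E [of e] by auto
        then show "e \<in> inner_edges S (V i)"
          using EX [of e] by (simp add: inner_edges_def V_def mem_Times_iff tgt_def)
      qed
      have Mnn: "0 \<le> Mx i" by (simp add: Mx_def)
      have "(\<Sum>e\<in>{e \<in> good. q (fst e) = i}. w e * cost B p e) \<le> (\<Sum>e\<in>{e \<in> good. q (fst e) = i}. Mx i * cost B (P i) e)"
      proof (rule sum_mono)
        fix e assume "e \<in> {e \<in> good. q (fst e) = i}"
        then have e: "e \<in> E" "q (fst e) = i" "q (tgt e) = i" using good_E [of e] by auto
        have "cost B p e = cost B (P i) e" using e by (simp add: cost_def p_def tgt_def)
        moreover have "w e \<le> Mx i" using W_ge(1) [OF e(1)] Mx_gt [OF EX(1) [OF e(1)]] e(2) by simp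
        ultimately show "w e * cost B p e \<le> Mx i * cost B (P i) e"
          by (simp add: mult_right_mono cost_nonneg)
      qed
      also have "\<dots> = Mx i * (\<Sum>e\<in>{e \<in> good. q (fst e) = i}. cost B (P i) e)" by (simp add: sum_distrib_left)
      also have "\<dots> \<le> Mx i * (\<Sum>e\<in>inner_edges S (V i). cost B (P i) e)"
        using finV S by (intro mult_left_mono Mnn sum_mono2 sub finite_inner_edges cost_nonneg)
      also have "\<dots> \<le> Mx i * (\<delta> / b ^ m * card (V i))"
        by (intro mult_left_mono Mnn P)
      also have "\<dots> = \<delta> * (\<Sum>v\<in>V i. Mx i / b ^ m)" by simp
      also have "\<dots> \<le> \<delta> * (\<Sum>v\<in>V i. W v)"
      proof (intro mult_left_mono sum_mono)
        fix v assume "v \<in> V i"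
        then have "v \<in> X" "q v = i" by (auto simp: V_def)
        with Mx_le [of v] show "Mx i / b ^ m \<le> W v" using b by (simp add: divide_le_eq mult.commute)
      qed (use \<delta> in simp)
      finally show "(\<Sum>e\<in>{e \<in> good. q (fst e) = i}. w e * cost B p e) \<le> \<delta> * (\<Sum>v\<in>V i. W v)" .
    qed
    also have "\<dots> = \<delta> * (\<Sum>i\<in>Q. \<Sum>v\<in>{v \<in> X. q v = i}. W v)" by (simp add: sum_distrib_left V_def)
    also have "(\<Sum>i\<in>Q. \<Sum>v\<in>{v \<in> X. q v = i}. W v) = (\<Sum>v\<in>X. W v)"
      using X by (intro sum.group) (auto simp: Q_def)
    finally show ?thesis by (simp add: W_sum)
  qed
  have two: "(\<Sum>e\<in>A. w e * cost B p e) \<le> 2 * (\<Sum>e\<in>A. w e)" if "A \<subseteq> E" for A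
    unfolding sum_distrib_left
  proof (rule sum_mono)
    fix e assume "e \<in> A"
    then have "0 \<le> w e" using that wnn by blast
    from mult_left_mono [OF cost_le_2 [OF B p, of e] this] show "w e * cost B p e \<le> 2 * w e" by simp
  qed
  have "(\<Sum>e\<in>E. w e * cost B p e) = (\<Sum>e\<in>far. w e * cost B p e) + ((\<Sum>e\<in>cutE. w e * cost B p e) + (\<Sum>e\<in>good. w e * cost B p e))"
    using E_split(2,3) fin fin2 by (subst E_split(1)) (simp add: sum.union_disjoint)
  also have "\<dots> \<le> 2 * (4 * card S / b * (\<Sum>e\<in>E. w e)) + (2 * ((\<Sum>e\<in>E. w e) / m) + 2 * \<delta> * (\<Sum>e\<in>E. w e))"
    using two [of far] two [of cutE] far_sum cut_sum good_sum E_split(1) by (smt (verit) Un_upper1 Un_upper2 le_sup_iff)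
  also have "\<dots> = (2 * \<delta> + 2 / m + 8 * card S / b) * (\<Sum>e\<in>E. w e)" by (simp add: algebra_simps)
  finally show ?thesis using p by blast
qed

lemma property_A_if_unweighted:
  assumes U: "\<And>(S :: 'a::{group_add, countable} set) (\<epsilon> :: real). finite S \<Longrightarrow> \<epsilon> > 0 \<Longrightarrow>
    \<exists>B. finite B \<and> (\<forall>V. finite V \<longrightarrow> (\<exists>p\<in>kernels B. (\<Sum>e\<in>inner_edges S V. cost B p e) \<le> \<epsilon> * card V))"
  shows "property_A TYPE('a)"
proof (rule property_A_if_weighted)
  fix S :: "'a set" and \<epsilon> :: real assume S: "finite S" and \<epsilon>: "\<epsilon> > 0"
  \<comment> \<open>With \<open>\<delta> = \<epsilon> / 8\<close> the three errors
    \<open>2 * \<delta>\<close>, \<open>2 / m\<close> and \<open>8 * card S / b\<close> are each at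
    most \<open>\<epsilon> / 4\<close>. The summand 2 in \<open>b\<close> keeps it above 1 even for
    empty \<open>S\<close>.\<close>
  define m where "m = nat \<lceil>8 / \<epsilon>\<rceil> + 1"
  define b where "b = 32 * card S / \<epsilon> + 2"
  have m: "m > 0" "2 / m \<le> \<epsilon> / 4"
  proof -
    have *: "2 / x \<le> \<epsilon> / 4" if "8 / \<epsilon> \<le> x" "0 < x" for x
      using that \<epsilon> by (simp add: field_simps)
    have "8 / \<epsilon> \<le> m" unfolding m_def by linarith
    then show "2 / m \<le> \<epsilon> / 4" by (rule *) (simp add: m_def)
  qed (simp add: m_def)
  have "0 \<le> 32 * card S / \<epsilon>" using \<epsilon> by simp
  then have b: "b > 1" unfolding b_def by linarith
  have b2: "8 * card S / b \<le> \<epsilon> / 4"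
  proof -
    have "32 * card S \<le> \<epsilon> * b" using \<epsilon> by (simp add: b_def field_simps)
    then show ?thesis using b by (simp add: field_simps)
  qed
  have "\<epsilon> / 8 / b ^ m > 0" using \<epsilon> b by simp
  then obtain B where B: "finite B" and BU: "\<And>V. finite V \<Longrightarrow> \<exists>p\<in>kernels B. (\<Sum>e\<in>inner_edges S V. cost B p e) \<le> \<epsilon> / 8 / b ^ m * card V"
    using U [OF S] by meson
  have "\<exists>p\<in>kernels B. (\<Sum>e\<in>E. w e * cost B p e) \<le> \<epsilon> * (\<Sum>e\<in>E. w e)"
    if E: "finite E" "E \<subseteq> UNIV \<times> S" and w: "\<forall>e. 0 \<le> w e" for E w
  proof -
    \<comment> \<open>Edges of weight 0 are dropped because the layers use logarithms of vertex
      weights.\<close>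
    define E0 where "E0 = {e \<in> E. 0 < w e}"
    have E0: "finite E0" "E0 \<subseteq> UNIV \<times> S" using E by (auto simp: E0_def)
    obtain p where p: "p \<in> kernels B" "(\<Sum>e\<in>E0. w e * cost B p e) \<le> (2 * (\<epsilon> / 8) + 2 / m + 8 * card S / b) * (\<Sum>e\<in>E0. w e)"
      using unweighted_to_weighted [OF S B m(1) b _ BU E0, of w] \<epsilon> by (auto simp: E0_def)
    have zero: "w e = 0" if "e \<in> E - E0" for e using that spec [OF w, of e] unfolding E0_def by force
    have 1: "(\<Sum>e\<in>E. w e * cost B p e) = (\<Sum>e\<in>E0. w e * cost B p e)"
      using E zero by (intro sum.mono_neutral_right) (auto simp: E0_def)
    have 2: "(\<Sum>e\<in>E. w e) = (\<Sum>e\<in>E0. w e)"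
      using E zero by (intro sum.mono_neutral_right) (auto simp: E0_def)
    have "0 \<le> (\<Sum>e\<in>E0. w e)" by (rule sum_nonneg) (rule spec [OF w])
    moreover have "2 * (\<epsilon> / 8) + 2 / m + 8 * card S / b \<le> \<epsilon>" using m(2) b2 \<epsilon> by linarith
    ultimately have "(2 * (\<epsilon> / 8) + 2 / m + 8 * card S / b) * (\<Sum>e\<in>E0. w e) \<le> \<epsilon> * (\<Sum>e\<in>E0. w e)"
      by (rule mult_right_mono [rotated])
    then show ?thesis using p 1 2 by (intro bexI [of _ p]) auto
  qed
  then show "\<exists>B. finite B \<and> (\<forall>E w. finite E \<longrightarrow> E \<subseteq> UNIV \<times> S \<longrightarrow> (\<forall>e. 0 \<le> w e) \<longrightarrow>
    (\<exists>p\<in>kernels B. (\<Sum>e\<in>E. w e * cost B p e) \<le> \<epsilon> * (\<Sum>e\<in>E. w e)))"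
    using B by blast
qed

subsection \<open>Random translates of a finite set\<close>

locale random_translates =
  fixes V :: "'a::{group_add, countable} set" and pr :: real
  assumes V: "finite V" and pr: "0 \<le> pr" "pr \<le> 1"
begin

text \<open>The selected centres \<open>g\<close> are those with label at most \<open>pr\<close>;
  \<open>- g + h \<in> V\<close> says that the translate of \<open>V\<close> by \<open>g\<close>
  contains \<open>h\<close>.\<close>

definition cov :: "('a \<Rightarrow> real) \<Rightarrow> 'a \<Rightarrow> 'a set" where
  "cov U h = {g. U g \<le> pr \<and> - g + h \<in> V}"

definition tiles :: "('a \<Rightarrow> real) \<Rightarrow> 'a \<Rightarrow> 'a \<Rightarrow> bool" where
  "tiles U = (\<lambda>h h'. h = h' \<or> (\<exists>g. cov U h = {g} \<and> cov U h' = {g}))"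

lemma tiles_Eqrel: "tiles U \<in> Eqrel"
  unfolding Eqrel_def mem_Collect_eq
  by (intro equivpI reflpI sympI transpI) (auto simp: tiles_def)

lemma measurable_cov_single [measurable]: "Measurable.pred labels (\<lambda>U. cov U h = {g})"
proof -
  have "cov U h = {g} \<longleftrightarrow> (\<forall>k. (U k \<le> pr \<and> - k + h \<in> V) \<longleftrightarrow> k = g)" for U
    by (auto simp: cov_def)
  then show ?thesis by simp
qed

lemma measurable_tiles: "tiles \<in> measurable labels Eqrel_borel"
  by (rule measurable_Eqrel_borelI [OF tiles_Eqrel]) (unfold tiles_def, measurable)

lemma cov_shift: "cov (shift_labels a U) h = (+) a ` cov U (- a + h)"
proof (intro set_eqI iffI)
  fix g assume g: "g \<in> cov (shift_labels a U) h"
  have "- (- a + g) + (- a + h) = - g + h"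
    by (simp only: minus_add minus_minus add.assoc) (simp add: add.assoc [symmetric])
  then have "- a + g \<in> cov U (- a + h)" using g by (simp add: cov_def shift_labels_def)
  then show "g \<in> (+) a ` cov U (- a + h)"
    by (rule image_eqI [rotated]) (simp add: add.assoc [symmetric])
next
  fix g assume "g \<in> (+) a ` cov U (- a + h)"
  then obtain g' where g': "g = a + g'" "U g' \<le> pr" "- g' + (- a + h) \<in> V" by (auto simp: cov_def)
  then show "g \<in> cov (shift_labels a U) h"
    by (simp add: cov_def shift_labels_def minus_add add.assoc [symmetric])
qed

lemma cov_shift_single: "cov (shift_labels a U) h = {a + g} \<longleftrightarrow> cov U (- a + h) = {g}"
  unfolding cov_shift by (auto simp: inj_image_eq_iff [of "(+) a", OF _, of _ "{g}", simplified])

lemma tiles_shift: "tiles (shift_labels a U) = shift a (tiles U)"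
proof (intro ext)
  fix h h'
  have "(\<exists>g. cov (shift_labels a U) h = {g} \<and> cov (shift_labels a U) h' = {g}) \<longleftrightarrow>
      (\<exists>g. cov (shift_labels a U) h = {a + g} \<and> cov (shift_labels a U) h' = {a + g})"
  proof
    assume "\<exists>g. cov (shift_labels a U) h = {g} \<and> cov (shift_labels a U) h' = {g}"
    then obtain g where "cov (shift_labels a U) h = {g} \<and> cov (shift_labels a U) h' = {g}" by blast
    then have "cov (shift_labels a U) h = {a + (- a + g)} \<and> cov (shift_labels a U) h' = {a + (- a + g)}"
      by (simp add: add.assoc [symmetric])
    then show "\<exists>g. cov (shift_labels a U) h = {a + g} \<and> cov (shift_labels a U) h' = {a + g}" by blast
  qed blast
  then show "tiles (shift_labels a U) h h' = shift a (tiles U) h h'"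
    by (simp add: tiles_def shift_def cov_shift_single)
qed

abbreviation "law \<equiv> distr labels Eqrel_borel tiles"

lemma law_FIRE: "law \<in> FIRE"
proof (rule distr_FIRE [OF measurable_tiles])
  show "law \<in> IRE"
    by (rule distr_IRE [OF prob_space_labels measurable_tiles measurable_shift_labels distr_shift_labels])
       (rule tiles_shift)
  show "AE U in labels. \<forall>g. finite (eqclass (tiles U) g)"
  proof (intro AE_I2 allI)
    fix U :: "'a \<Rightarrow> real" and h
    show "finite (eqclass (tiles U) h)"
    proof (cases "\<exists>g. cov U h = {g}")
      case True
      then obtain g where g: "cov U h = {g}" by blast
      have "eqclass (tiles U) h \<subseteq> insert h ((+) g ` V)"
      proof
        fix h' assume "h' \<in> eqclass (tiles U) h"
        then consider "h' = h" | "cov U h' = {g}" using g by (auto simp: eqclass_def tiles_def)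
        then show "h' \<in> insert h ((+) g ` V)"
        proof cases
          case 2
          then have "- g + h' \<in> V" by (auto simp: cov_def)
          moreover have "h' = g + (- g + h')" by (simp add: add.assoc [symmetric])
          ultimately show ?thesis by blast
        qed simp
      qed
      then show ?thesis by (rule finite_subset) (use V in simp)
    next
      case False
      then have "eqclass (tiles U) h \<subseteq> {h}" by (auto simp: eqclass_def tiles_def)
      then show ?thesis by (rule finite_subset) simp
    qed
  qed
qed

lemma prob_pair:
  assumes "g \<noteq> 0" shows "measure labels {U. U 0 \<le> pr \<and> U g \<le> pr} = pr * pr"
proof -
  have "emeasure labels {U. \<forall>k\<in>{0, g}. U k \<in> {..pr}} = (\<Prod>k\<in>{0, g}. emeasure uniform01 {..pr})"
    by (rule emeasure_labels_Collect) auto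
  also have "\<dots> = ennreal (pr * pr)"
    using assms pr by (simp add: emeasure_uniform01_le min_def ennreal_mult)
  finally show ?thesis using pr by (simp add: measure_def)
qed

lemma prob_single: "measure labels {U :: 'a \<Rightarrow> real. U 0 \<le> pr} = pr"
  using emeasure_label_le [OF pr(1), where k = "0 :: 'a"] pr by (simp add: measure_def min_def)

text \<open>A second centre covering \<open>v\<close> must have the form \<open>v - w\<close> with
  \<open>w \<in> V\<close>. This leaves at most \<open>card V\<close> candidates, each selected
  together with the identity with probability \<open>pr * pr\<close>.\<close>

lemma prob_overlap:
  assumes v: "v \<in> V"
  shows "measure labels {U. U 0 \<le> pr \<and> cov U v \<noteq> {0}} \<le> card V * (pr * pr)"
proof -
  interpret prob_space "labels :: ('a \<Rightarrow> real) measure" by (rule prob_space_labels)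
  let ?G = "(\<lambda>w. v - w) ` V - {0}"
  have sets: "{U. U 0 \<le> pr \<and> U g \<le> pr} \<in> sets labels" for g
  proof -
    have "{U \<in> space labels. U 0 \<le> pr \<and> U g \<le> pr} \<in> sets labels" by measurable
    then show ?thesis by simp
  qed
  have "{U. U 0 \<le> pr \<and> cov U v \<noteq> {0}} \<subseteq> (\<Union>g\<in>?G. {U. U 0 \<le> pr \<and> U g \<le> pr})"
  proof
    fix U assume U: "U \<in> {U. U 0 \<le> pr \<and> cov U v \<noteq> {0}}"
    then have "0 \<in> cov U v" using v by (simp add: cov_def)
    then obtain g where g: "g \<noteq> 0" "g \<in> cov U v" using U by auto
    then have "U g \<le> pr" "- g + v \<in> V" by (auto simp: cov_def)
    moreover have "g = v - (- g + v)" by (simp add: diff_conv_add_uminus minus_add add.assoc [symmetric] del: add_uminus_conv_diff)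
    ultimately show "U \<in> (\<Union>g\<in>?G. {U. U 0 \<le> pr \<and> U g \<le> pr})" using g(1) U by blast
  qed
  then have "measure labels {U. U 0 \<le> pr \<and> cov U v \<noteq> {0}} \<le> measure labels (\<Union>g\<in>?G. {U. U 0 \<le> pr \<and> U g \<le> pr})"
    using sets V by (intro finite_measure_mono) auto
  also have "\<dots> \<le> (\<Sum>g\<in>?G. measure labels {U. U 0 \<le> pr \<and> U g \<le> pr})"
    using sets V by (intro measure_UNION_le) auto
  also have "\<dots> = (\<Sum>g\<in>?G. pr * pr)" by (intro sum.cong refl prob_pair) simp
  also have "\<dots> = card ?G * (pr * pr)" by simp
  also have "\<dots> \<le> card V * (pr * pr)"
  proof (intro mult_right_mono)
    have "card ?G \<le> card ((\<lambda>w. v - w) ` V)" by (rule card_mono) (use V in auto)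
    also have "\<dots> \<le> card V" by (rule card_image_le [OF V])
    finally show "real (card ?G) \<le> real (card V)" by simp
  qed simp
  finally show ?thesis .
qed

text \<open>Deleting a point removes at most \<open>card S\<close> edges starting there and
  \<open>card S\<close> edges ending there, each of cost at most 2.\<close>

lemma inner_edges_cost_ge:
  assumes S: "finite S" and B: "finite B" and p: "p \<in> kernels B" and G: "G \<subseteq> V"
  shows "(\<Sum>e\<in>inner_edges S V. cost B p e) - 4 * card S * card (V - G) \<le> (\<Sum>e\<in>inner_edges S G. cost B p e)"
proof -
  let ?A = "(V - G) \<times> S" and ?C = "(\<lambda>(v, s). (v - s, s)) ` ((V - G) \<times> S)"
  have fin: "finite ?A" "finite ?C" using V S by auto
  have finG: "finite G" using G V by (rule finite_subset)
  have "inner_edges S V \<subseteq> inner_edges S G \<union> (?A \<union> ?C)"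
  proof
    fix e assume e: "e \<in> inner_edges S V"
    obtain v s where vs: "e = (v, s)" by (cases e)
    with e have *: "v \<in> V" "s \<in> S" "v + s \<in> V" by (auto simp: inner_edges_def)
    show "e \<in> inner_edges S G \<union> (?A \<union> ?C)"
    proof (cases "v \<in> G \<and> v + s \<in> G")
      case True then show ?thesis using * vs by (simp add: inner_edges_def)
    next
      case False
      then consider "v \<in> V - G" | "v + s \<in> V - G" using * by blast
      then show ?thesis
      proof cases
        case 2
        then have "(v + s - s, s) \<in> ?C"
          by (intro image_eqI [of _ _ "(v + s, s)"]) (use * in auto)
        then show ?thesis using vs by simp
      qed (use * vs in simp)
    qed
  qed
  then have "(\<Sum>e\<in>inner_edges S V. cost B p e) \<le> (\<Sum>e\<in>inner_edges S G \<union> (?A \<union> ?C). cost B p e)"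
    using fin finite_inner_edges [OF S finG] by (intro sum_mono2) (auto simp: cost_nonneg)
  also have "\<dots> \<le> (\<Sum>e\<in>inner_edges S G. cost B p e) + (\<Sum>e\<in>?A \<union> ?C. cost B p e)"
    using fin finite_inner_edges [OF S finG] by (subst sum_Un) (auto intro!: sum_nonneg cost_nonneg)
  also have "(\<Sum>e\<in>?A \<union> ?C. cost B p e) \<le> (\<Sum>e\<in>?A. cost B p e) + (\<Sum>e\<in>?C. cost B p e)"
    using fin by (subst sum_Un) (auto intro!: sum_nonneg cost_nonneg)
  also have "(\<Sum>e\<in>?A. cost B p e) \<le> (\<Sum>e\<in>?A. 2)" by (intro sum_mono cost_le_2 B p)
  also have "(\<Sum>e\<in>?C. cost B p e) \<le> (\<Sum>e\<in>?C. 2)" by (intro sum_mono cost_le_2 B p)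
  also have "(\<Sum>e\<in>?C. 2 :: real) \<le> 2 * card ?A" using card_image_le [OF fin(1), of "\<lambda>(v, s). (v - s, s)"] by simp
  also have "(\<Sum>e\<in>?A. 2 :: real) = 2 * card ?A" by simp
  finally show ?thesis by (simp add: card_cartesian_product mult_ac)
qed

end

section \<open>Asymmetry of local kernels on random tilings\<close>

lemma gap_kernels: "p \<in> kernels B \<Longrightarrow> finite B \<Longrightarrow>
    cost B p (v, s) = l1_dist (to_pmf (p v)) (translate s (to_pmf (p (v + s))))"
  by (simp add: cost_def gap_eq_l1_dist kernels_iff)

lemma asymmetry_eq: "asymmetry q s r = (if r 0 s then l1_dist (q r) (translate s (q (shift (- s) r))) else 0)"
  by (simp add: asymmetry_def l1_dist_translate_left)

lemma local_on_asymmetry: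
  fixes q :: "('a::{group_add, countable} \<Rightarrow> 'a \<Rightarrow> bool) \<Rightarrow> 'a pmf"
  assumes "finite F" "local_on F q"
  shows "\<exists>G. finite G \<and> local_on G (asymmetry q s)"
proof -
  let ?F' = "(\<lambda>(a, b). (- (- s) + a, - (- s) + b)) ` F"
  have "local_on (F \<union> (\<lambda>(a, b). (- (- s) + a, - (- s) + b)) ` F) (\<lambda>r. l1_dist (translate (- s) (q r)) (q (shift (- s) r)))"
    by (rule local_on_comp2 [where h = "\<lambda>x y. l1_dist (translate (- s) x) y", OF assms(2) local_on_shift [OF assms(2)]])
  from local_on_comp2 [where h = "\<lambda>x y. if x then y else 0", OF local_on_coordinate [of 0 s] this]
  have "local_on ({(0, s)} \<union> (F \<union> ?F')) (asymmetry q s)"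
    unfolding asymmetry_def [abs_def] .
  then show ?thesis using assms(1) by (intro exI [of _ "{(0, s)} \<union> (F \<union> ?F')"]) simp
qed

context random_translates
begin

text \<open>By mass transport, the asymmetry at the identity, in whatever position of a tile it
  lies, is collected at the centre of the tile. The identity is a centre with probability
  \<open>pr\<close>, and then \<open>q\<close> read along the tile is a kernel to which
  \<open>bad\<close> applies. Each point of \<open>V\<close> is lost to overlaps with probability at
  most \<open>card V * pr * pr\<close>, and each lost point costs at most
  \<open>4 * card S\<close>.\<close>

lemma integral_asymmetry_ge:
  fixes q :: "('a \<Rightarrow> 'a \<Rightarrow> bool) \<Rightarrow> 'a pmf" and u :: "('a \<Rightarrow> 'a \<Rightarrow> bool) \<Rightarrow> 'a \<Rightarrow> real"
    and \<epsilon> :: real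
  assumes S: "finite S" and B: "finite B" and u: "\<And>r. u r \<in> simplex_on B" and q: "\<And>r. q r = to_pmf (u r)"
    and F: "finite F" "local_on F q"
    and bad: "\<And>p. p \<in> kernels B \<Longrightarrow> \<epsilon> * card V \<le> (\<Sum>e\<in>inner_edges S V. cost B p e)"
  shows "pr * \<epsilon> * card V - 4 * card S * (card V)\<^sup>2 * pr\<^sup>2 \<le> (\<integral>r. (\<Sum>s\<in>S. asymmetry q s r) \<partial>law)"
proof -
  interpret prob_space "labels :: ('a \<Rightarrow> real) measure" by (rule prob_space_labels)
  define \<eta> where "\<eta> U h = q (shift (- h) (tiles U))" for U h
  \<comment> \<open>\<open>T\<close> looks at the edge from \<open>v\<close> to \<open>v + s\<close>
    in the tile centred at the identity. \<open>T0\<close> looks at the same edge moved so that it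
    starts at the identity, the tile being centred at \<open>- v\<close>.\<close>
  define T where "T v s U = (if cov U v = {0} \<and> cov U (v + s) = {0} then l1_dist (\<eta> U v) (translate s (\<eta> U (v + s))) else 0)" for v s U
  define T0 where "T0 v s U = (if cov U 0 = {- v} \<and> cov U s = {- v} then l1_dist (\<eta> U 0) (translate s (\<eta> U s)) else 0)" for v s U
  have q_meas: "q \<in> measurable Eqrel_borel Prob_borel"
    unfolding measurable_Prob_borel_iff
    using local_on_borel_measurable [OF F(1) local_on_comp [OF F(2), of "\<lambda>p. pmf p k" for k] refl] by blast
  have [measurable]: "(\<lambda>U. \<eta> U h) \<in> measurable labels Prob_borel" for h
    unfolding \<eta>_def by (intro measurable_compose [OF measurable_tiles] measurable_compose [OF shift_measurable q_meas])
  have [measurable]: "(\<lambda>U. l1_dist (\<eta> U h) (translate s (\<eta> U h'))) \<in> borel_measurable labels" for s h h'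
    by (intro borel_measurable_l1_dist measurable_translate) measurable
  have T_meas [measurable]: "T v s \<in> borel_measurable labels" "T0 v s \<in> borel_measurable labels" for v s
    unfolding T_def [abs_def] T0_def [abs_def] by measurable
  have T_int: "integrable labels (T v s)" "integrable labels (T0 v s)" for v s
    by (intro integrable_const_bound [where B = 2] AE_I2 T_meas; simp add: T_def T0_def l1_dist_le_2)+
  have asym: "asymmetry q s (tiles U) = (if tiles U 0 s then l1_dist (\<eta> U 0) (translate s (\<eta> U s)) else 0)" for s U
    by (simp add: asymmetry_eq \<eta>_def)
  have asym_meas: "asymmetry q s \<in> borel_measurable Eqrel_borel" for s
    by (rule measurable_asymmetry [OF q_meas])
  have asym_int: "integrable labels (\<lambda>U. asymmetry q s (tiles U))" for s
    by (intro integrable_const_bound [where B = 2] AE_I2 measurable_compose [OF measurable_tiles asym_meas])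
       (simp add: asymmetry_bounds)
  \<comment> \<open>The identity has at most one position in a tile, so at most one summand is
    nonzero.\<close>
  have T0_le: "(\<Sum>v\<in>V. T0 v s U) \<le> asymmetry q s (tiles U)" for s U
  proof (cases "\<exists>v\<in>V. cov U 0 = {- v} \<and> cov U s = {- v}")
    case True
    then obtain v where v: "v \<in> V" "cov U 0 = {- v}" "cov U s = {- v}" by blast
    have "(\<Sum>v\<in>V. T0 v s U) = (\<Sum>w\<in>V. if w = v then l1_dist (\<eta> U 0) (translate s (\<eta> U s)) else 0)"
      using v by (intro sum.cong) (auto simp: T0_def)
    also have "\<dots> = l1_dist (\<eta> U 0) (translate s (\<eta> U s))" using V v(1) by simp
    also have "\<dots> = asymmetry q s (tiles U)"
    proof -
      have "tiles U 0 s" using v by (auto simp: tiles_def)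
      then show ?thesis by (simp add: asym)
    qed
    finally show ?thesis by simp
  next
    case False
    then have "(\<Sum>v\<in>V. T0 v s U) = 0" by (intro sum.neutral) (auto simp: T0_def)
    then show ?thesis by (simp add: asymmetry_bounds)
  qed
  have T_shift: "T0 v s (shift_labels (- v) U) = T v s U" for v s U
  proof -
    have c: "cov (shift_labels (- v) U) h = {- v} \<longleftrightarrow> cov U (v + h) = {0}" for h
      using cov_shift_single [of "- v" U h 0] by simp
    have "\<eta> (shift_labels (- v) U) h = \<eta> U (v + h)" for h
      by (simp only: \<eta>_def tiles_shift shift_shift minus_add)
    then show ?thesis by (simp add: T0_def T_def c)
  qed
  have T_eq: "(\<integral>U. T0 v s U \<partial>labels) = (\<integral>U. T v s U \<partial>labels)" for v s
  proof -
    have "(\<integral>U. T0 v s U \<partial>labels) = (\<integral>U. T0 v s U \<partial>distr labels labels (shift_labels (- v)))"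
      by (simp only: distr_shift_labels)
    also have "\<dots> = (\<integral>U. T0 v s (shift_labels (- v) U) \<partial>labels)"
      by (rule integral_distr [OF measurable_shift_labels T_meas(2)])
    finally show ?thesis by (simp add: T_shift)
  qed
  define bad_set where "bad_set v = {U. U 0 \<le> pr \<and> cov U v \<noteq> {0}}" for v
  have bad_sets: "bad_set v \<in> sets labels" and A_sets: "{U. U 0 \<le> pr} \<in> sets (labels :: ('a \<Rightarrow> real) measure)" for v
  proof -
    have "{U \<in> space labels. U 0 \<le> pr \<and> cov U v \<noteq> {0}} \<in> sets labels" 
      "{U \<in> space (labels :: ('a \<Rightarrow> real) measure). U 0 \<le> pr} \<in> sets labels" by measurable
    then show "bad_set v \<in> sets labels" "{U. U 0 \<le> pr} \<in> sets (labels :: ('a \<Rightarrow> real) measure)"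
      by (simp_all add: bad_set_def)
  qed
  have T_ge: "\<epsilon> * card V * indicator {U. U 0 \<le> pr} U - 4 * card S * (\<Sum>v\<in>V. indicat_real (bad_set v) U)
      \<le> (\<Sum>s\<in>S. \<Sum>v\<in>V. T v s U)" for U
  proof (cases "U 0 \<le> pr")
    case True
    define G where "G = {v \<in> V. cov U v = {0}}"
    \<comment> \<open>For fixed labels the values of \<open>q\<close> seen from all points form a
      single element of \<open>kernels B\<close>, as \<open>bad\<close> requires. The set
      \<open>G\<close> contains the points of \<open>V\<close> that the tile really keeps.\<close>
    define p where "p h = u (shift (- h) (tiles U))" for h
    have p: "p \<in> kernels B" using u by (simp add: kernels_iff p_def)
    have pq: "to_pmf (p h) = \<eta> U h" for h by (simp add: p_def \<eta>_def q)
    have "(\<Sum>v\<in>V. indicator (bad_set v) U :: real) = (\<Sum>v\<in>V. if v \<in> V - G then 1 else 0)"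
      using True by (intro sum.cong) (auto simp: G_def bad_set_def)
    also have "\<dots> = card (V - G)" using V by (simp add: sum.If_cases set_diff_eq Int_def)
    finally have 1: "(\<Sum>v\<in>V. indicator (bad_set v) U :: real) = card (V - G)" .
    have "(\<Sum>e\<in>inner_edges S G. cost B p e) \<le> (\<Sum>e\<in>S \<times> V. T (snd e) (fst e) U)"
    proof -
      have "(\<Sum>e\<in>inner_edges S G. cost B p e) = (\<Sum>e\<in>inner_edges S G. T (fst e) (snd e) U)"
      proof (rule sum.cong)
        fix e assume "e \<in> inner_edges S G"
        then have "fst e \<in> G" "fst e + snd e \<in> G" by (simp_all add: inner_edges_def mem_Times_iff)
        then have "cov U (fst e) = {0}" "cov U (fst e + snd e) = {0}" by (simp_all add: G_def)
        then show "cost B p e = T (fst e) (snd e) U"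
          using gap_kernels [OF p B, of "fst e" "snd e"] by (simp add: T_def pq)
      qed simp
      also have "\<dots> \<le> (\<Sum>e\<in>V \<times> S. T (fst e) (snd e) U)"
      proof (rule sum_mono2)
        show "inner_edges S G \<subseteq> V \<times> S" by (auto simp: inner_edges_def G_def)
        show "0 \<le> T (fst e) (snd e) U" for e by (simp add: T_def)
      qed (use V S in simp)
      also have "\<dots> = (\<Sum>e\<in>S \<times> V. T (snd e) (fst e) U)"
        by (rule sum.reindex_bij_witness [of _ prod.swap prod.swap]) auto
      finally show ?thesis .
    qed
    also have "\<dots> = (\<Sum>s\<in>S. \<Sum>v\<in>V. T v s U)"
      unfolding sum.cartesian_product by (simp add: case_prod_beta)
    finally have 2: "(\<Sum>e\<in>inner_edges S G. cost B p e) \<le> (\<Sum>s\<in>S. \<Sum>v\<in>V. T v s U)" .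
    have "G \<subseteq> V" by (auto simp: G_def)
    from inner_edges_cost_ge [OF S B p this] bad [OF p] 2
    show ?thesis using True by (simp add: 1)
  next
    case False
    then have "\<epsilon> * card V * indicator {U. U 0 \<le> pr} U - 4 * card S * (\<Sum>v\<in>V. indicat_real (bad_set v) U) = (0::real)"
      by (simp add: bad_set_def)
    also have "0 \<le> (\<Sum>s\<in>S. \<Sum>v\<in>V. T v s U)" by (intro sum_nonneg) (simp add: T_def)
    finally show ?thesis .
  qed
  have ind_int: "integrable labels (indicator A :: _ \<Rightarrow> real)" if "A \<in> sets labels" for A :: "('a \<Rightarrow> real) set"
    using that by (simp add: less_top [symmetric] emeasure_eq_measure)
  have "pr * \<epsilon> * card V - 4 * card S * (card V)\<^sup>2 * pr\<^sup>2
      = \<epsilon> * card V * pr - 4 * card S * (\<Sum>v\<in>V. card V * (pr * pr))"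
    by (simp add: power2_eq_square mult_ac)
  also have "\<dots> \<le> \<epsilon> * card V * measure labels {U :: 'a \<Rightarrow> real. U 0 \<le> pr} - 4 * card S * (\<Sum>v\<in>V. measure labels (bad_set v))"
    unfolding prob_single bad_set_def by (intro diff_left_mono mult_left_mono sum_mono prob_overlap) auto
  also have "\<dots> = (\<integral>U. \<epsilon> * card V * indicator {U. U 0 \<le> pr} U - 4 * card S * (\<Sum>v\<in>V. indicat_real (bad_set v) U) \<partial>labels)"
    using ind_int [OF A_sets] ind_int [OF bad_sets]
    by (subst Bochner_Integration.integral_diff) (auto simp: Bochner_Integration.integral_sum)
  also have "\<dots> \<le> (\<integral>U. (\<Sum>s\<in>S. \<Sum>v\<in>V. T v s U) \<partial>labels)"
    using ind_int [OF A_sets] ind_int [OF bad_sets] T_int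
    by (intro integral_mono T_ge Bochner_Integration.integrable_diff Bochner_Integration.integrable_sum integrable_mult_right)
  also have "\<dots> = (\<Sum>s\<in>S. \<Sum>v\<in>V. \<integral>U. T v s U \<partial>labels)"
    using T_int by (simp add: Bochner_Integration.integral_sum)
  also have "\<dots> = (\<Sum>s\<in>S. \<integral>U. (\<Sum>v\<in>V. T0 v s U) \<partial>labels)"
    using T_int by (simp add: Bochner_Integration.integral_sum T_eq)
  also have "\<dots> \<le> (\<Sum>s\<in>S. \<integral>U. asymmetry q s (tiles U) \<partial>labels)"
    using T_int asym_int T0_le by (intro sum_mono integral_mono Bochner_Integration.integrable_sum)
  also have "\<dots> = (\<integral>U. (\<Sum>s\<in>S. asymmetry q s (tiles U)) \<partial>labels)"
    using asym_int by (simp add: Bochner_Integration.integral_sum)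
  also have "\<dots> = (\<integral>r. (\<Sum>s\<in>S. asymmetry q s r) \<partial>law)"
    by (rule integral_distr [OF measurable_tiles, symmetric]) (use asym_meas in measurable)
  finally show ?thesis .
qed

end

section \<open>Approximation of measurable kernels by local ones\<close>

text \<open>Approximate coordinates on \<open>B\<close> need not add up to 1 and may all vanish;
  then a point mass at \<open>b0\<close> is used. Normalizing changes them by exactly
  \<open>\<bar>1 - A\<bar>\<close>, which is at most the approximation error plus the mass of
  \<open>p\<close> outside \<open>B\<close>.\<close>

lemma l1_dist_truncate_normalize:
  fixes a :: "'a \<Rightarrow> real" and p :: "'a pmf"
  assumes B: "finite B" "b0 \<in> B" and a: "\<And>k. 0 \<le> a k"
  defines "A \<equiv> \<Sum>k\<in>B. a k"
  defines "u \<equiv> \<lambda>k. if k \<in> B then (if A = 0 then (if k = b0 then 1 else 0) else a k / A) else 0"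
  shows "u \<in> simplex_on B"
    "l1_dist p (to_pmf u) \<le> 4 * (\<Sum>k\<in>B. \<bar>pmf p k - a k\<bar>) + 4 * (1 - (\<Sum>k\<in>B. pmf p k))"
proof -
  have A: "0 \<le> A" unfolding A_def using a by (simp add: sum_nonneg)
  show u: "u \<in> simplex_on B"
  proof (cases "A = 0")
    case True
    then show ?thesis using B by (auto simp: simplex_on_def u_def)
  next
    case False
    then have "(\<Sum>k\<in>B. a k / A) = 1" by (simp add: A_def flip: sum_divide_distrib)
    then show ?thesis using False A a B by (auto simp: simplex_on_def u_def)
  qed
  have au: "(\<Sum>k\<in>B. \<bar>a k - u k\<bar>) = \<bar>1 - A\<bar>"
  proof (cases "A = 0")
    case True
    then have "a k = 0" if "k \<in> B" for k
      using that B(1) a unfolding A_def by (simp add: sum_nonneg_eq_0_iff)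
    then have "(\<Sum>k\<in>B. \<bar>a k - u k\<bar>) = (\<Sum>k\<in>B. if k = b0 then 1 else 0)"
      using True by (intro sum.cong) (auto simp: u_def)
    then show ?thesis using True B by simp
  next
    case False
    then have "(\<Sum>k\<in>B. \<bar>a k - u k\<bar>) = (\<Sum>k\<in>B. a k * (\<bar>1 - A\<bar> / A))"
    proof (intro sum.cong refl)
      fix k assume k: "k \<in> B"
      have "a k - u k = a k * ((A - 1) / A)" using False k by (simp add: u_def field_simps)
      then show "\<bar>a k - u k\<bar> = a k * (\<bar>1 - A\<bar> / A)"
        using a [of k] A by (simp add: abs_mult abs_minus_commute)
    qed
    also have "\<dots> = A * (\<bar>1 - A\<bar> / A)" by (simp only: sum_distrib_right [symmetric] A_def [symmetric])
    finally show ?thesis using False by simp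
  qed
  have arith: "x \<le> 4 * w + 4 * z" if "v \<le> z + w" "y \<le> w + v" "x \<le> 2 * y + 2 * z" for v w x y z :: real
    using that by linarith
  have "\<bar>1 - A\<bar> \<le> (1 - (\<Sum>k\<in>B. pmf p k)) + (\<Sum>k\<in>B. \<bar>pmf p k - a k\<bar>)"
  proof -
    have "\<bar>(\<Sum>k\<in>B. pmf p k) - A\<bar> \<le> (\<Sum>k\<in>B. \<bar>pmf p k - a k\<bar>)"
      unfolding A_def sum_subtractf [symmetric] by (rule sum_abs)
    then show ?thesis using sum_pmf_le_1 [OF B(1), of p] by linarith
  qed
  moreover have "(\<Sum>k\<in>B. \<bar>pmf p k - u k\<bar>) \<le> (\<Sum>k\<in>B. \<bar>pmf p k - a k\<bar>) + (\<Sum>k\<in>B. \<bar>a k - u k\<bar>)"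
    unfolding sum.distrib [symmetric] by (intro sum_mono) linarith
  moreover have "l1_dist p (to_pmf u) \<le> 2 * (\<Sum>k\<in>B. \<bar>pmf p k - u k\<bar>) + 2 * (1 - (\<Sum>k\<in>B. pmf p k))"
    using l1_dist_le_truncated [OF B(1), of p "to_pmf u"] by (simp only: pmf_simplex(1) [OF B(1) u])
  ultimately show "l1_dist p (to_pmf u) \<le> 4 * (\<Sum>k\<in>B. \<bar>pmf p k - a k\<bar>) + 4 * (1 - (\<Sum>k\<in>B. pmf p k))"
    unfolding au by (rule arith)
qed

text \<open>Up to \<open>1 / N\<close>, \<open>f\<close> is the average of the indicators of its
  \<open>N\<close> superlevel sets at heights \<open>(i + 1) / N\<close>. Each set is replaced by a
  cylinder with error below \<open>1 / N\<close> in measure; since the indicators are averaged,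
  these errors contribute only \<open>1 / N\<close> in total.\<close>

lemma local_step_approx:
  fixes f :: "('a::countable \<Rightarrow> 'a \<Rightarrow> bool) \<Rightarrow> real"
  assumes \<rho>: "\<rho> \<in> Prob_Eqrel" and f: "f \<in> borel_measurable Eqrel_borel" "\<And>r. 0 \<le> f r" "\<And>r. f r \<le> 1" and \<epsilon>: "\<epsilon> > 0"
  obtains F a where "finite F" "local_on F a" "\<And>r. (0::real) \<le> a r" "\<And>r. a r \<le> 1" "(\<integral>r. \<bar>f r - a r\<bar> \<partial>\<rho>) \<le> \<epsilon>"
proof -
  note P = Prob_EqrelD [OF \<rho>]
  interpret prob_space \<rho> by (rule P)
  obtain N :: nat where N: "2 / \<epsilon> < real N" using reals_Archimedean2 by blast
  have N0: "N > 0" using N \<epsilon> by (metis divide_pos_pos less_irrefl less_trans of_nat_0_less_iff zero_less_numeral)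
  define A where "A i = {r \<in> Eqrel. real (Suc i) / N \<le> f r}" for i
  have A: "A i \<in> sets Eqrel_borel" for i
  proof -
    have "{r \<in> space Eqrel_borel. real (Suc i) / N \<le> f r} \<in> sets Eqrel_borel"
      using f(1) by measurable
    then show ?thesis by (simp add: A_def)
  qed
  have "\<exists>C. C \<in> cylinders \<and> measure \<rho> (sym_diff (A i) C) < 1 / N" for i
    using Eqrel_measure_approx [OF P(2) P(2) finite_measure_axioms finite_measure_axioms A, of "1 / N"] N0
    by (metis of_nat_0_less_iff zero_less_divide_1_iff)
  then obtain C where C: "\<And>i. C i \<in> cylinders" "\<And>i. measure \<rho> (sym_diff (A i) (C i)) < 1 / N" by metis
  have "\<forall>i. \<exists>F. finite F \<and> local_on F (\<lambda>r. r \<in> C i)" using C(1) cylindersE by metis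
  then obtain F where F: "\<And>i. finite (F i)" "\<And>i. local_on (F i) (\<lambda>r. r \<in> C i)" by metis
  define a :: "('a \<Rightarrow> 'a \<Rightarrow> bool) \<Rightarrow> real" where "a r = (\<Sum>i<N. of_bool (r \<in> C i)) / N" for r
  have cs: "C i \<in> sets \<rho>" "A i \<in> sets \<rho>" for i
    using C(1) cylinders_subset_sets A by (auto simp: P)
  have D: "sym_diff (A i) (C i) \<in> sets \<rho>" for i using cs by auto
  have step: "\<bar>f r - (\<Sum>i<N. of_bool (r \<in> A i)) / N\<bar> \<le> 1 / N" if r: "r \<in> Eqrel" for r
  proof -
    define n where "n = nat \<lfloor>N * f r\<rfloor>"
    have Nf: "0 \<le> N * f r" "N * f r \<le> N" using f(2,3) [of r] N0 by (simp_all add: mult_left_le)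
    have n: "real n \<le> N * f r" "N * f r < real n + 1"
      using Nf(1) by (simp_all add: n_def of_nat_floor)
    then have nN: "n \<le> N" using Nf(2) by linarith
    have "r \<in> A i \<longleftrightarrow> i < n" for i
    proof -
      have "r \<in> A i \<longleftrightarrow> real (Suc i) \<le> N * f r" using r N0 by (simp add: A_def field_simps)
      also have "\<dots> \<longleftrightarrow> i < n"
      proof
        assume "real (Suc i) \<le> N * f r"
        then have "real (Suc i) < real (Suc n)" using n by simp
        then show "i < n" by simp
      next
        assume "i < n"
        then have "real (Suc i) \<le> real n" by simp
        then show "real (Suc i) \<le> N * f r" using n by linarith
      qed
      finally show ?thesis .
    qed
    then have "(\<Sum>i<N. of_bool (r \<in> A i)) = (\<Sum>i<N. if i < n then 1 else (0::real))" by (simp add: of_bool_def)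
    also have "\<dots> = (\<Sum>i\<in>{..<n}. 1)"
      by (rule sum.mono_neutral_cong_right) (use nN in auto)
    also have "\<dots> = real n" by simp
    finally have s: "(\<Sum>i<N. of_bool (r \<in> A i)) = real n" .
    have "\<bar>N * f r - n\<bar> \<le> 1" using n by linarith
    then have "\<bar>N * f r - n\<bar> / N \<le> 1 / N" by (rule divide_right_mono) simp
    moreover have "f r - real n / N = (N * f r - n) / N" using N0 by (simp add: field_simps)
    ultimately show ?thesis unfolding s by (simp add: abs_divide)
  qed
  have diff: "\<bar>f r - a r\<bar> \<le> 1 / N + (\<Sum>i<N. indicator (sym_diff (A i) (C i)) r) / N" if r: "r \<in> Eqrel" for r
  proof -
    have "\<bar>(\<Sum>i<N. of_bool (r \<in> A i)) - (\<Sum>i<N. of_bool (r \<in> C i))\<bar> \<le> (\<Sum>i<N. \<bar>of_bool (r \<in> A i) - of_bool (r \<in> C i)\<bar> :: real)"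
      unfolding sum_subtractf [symmetric] by (rule sum_abs)
    also have "\<dots> = (\<Sum>i<N. indicator (sym_diff (A i) (C i)) r)"
      by (intro sum.cong) (auto simp: indicator_def)
    finally have "\<bar>(\<Sum>i<N. of_bool (r \<in> A i)) / N - a r\<bar> \<le> (\<Sum>i<N. indicator (sym_diff (A i) (C i)) r) / N"
      unfolding a_def diff_divide_distrib [symmetric] abs_divide by (simp add: divide_right_mono)
    then show ?thesis using step [OF r] by linarith
  qed
  have aF: "finite (\<Union>i<N. F i)" "local_on (\<Union>i<N. F i) a"
  proof -
    have "local_on (\<Union>i<N. F i) (\<lambda>r. \<Sum>i<N. of_bool (r \<in> C i) :: real)"
    proof (rule local_on_sum)
      fix i assume "i \<in> {..<N}"
      then show "local_on (\<Union>i<N. F i) (\<lambda>r. of_bool (r \<in> C i) :: real)"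
        by (intro local_on_mono [OF local_on_comp [OF F(2)]]) auto
    qed
    then show "local_on (\<Union>i<N. F i) a" unfolding a_def by (rule local_on_comp)
  qed (use F in auto)
  have a_bounds: "0 \<le> a r" "a r \<le> 1" for r
  proof -
    show "0 \<le> a r" by (simp add: a_def sum_nonneg)
    have "(\<Sum>i<N. of_bool (r \<in> C i) :: real) \<le> (\<Sum>i<N. 1)" by (rule sum_mono) simp
    then show "a r \<le> 1" using N0 by (simp add: a_def)
  qed
  have ind_int: "integrable \<rho> (indicator (sym_diff (A i) (C i)) :: _ \<Rightarrow> real)" for i
    using D [of i] by (simp add: less_top [symmetric] emeasure_eq_measure)
  have "f \<in> borel_measurable \<rho>" "a \<in> borel_measurable \<rho>"
    using f(1) measurable_cong_sets [OF P(2) refl] local_on_borel_measurable [OF aF P(2)] by blast+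
  then have "(\<lambda>r. \<bar>f r - a r\<bar>) \<in> borel_measurable \<rho>"
    by (intro borel_measurable_abs borel_measurable_diff)
  moreover have "norm \<bar>f r - a r\<bar> \<le> 1" for r using f(2,3) [of r] a_bounds [of r] by simp
  ultimately have int: "integrable \<rho> (\<lambda>r. \<bar>f r - a r\<bar>)"
    by (intro integrable_const_bound [where B = 1] AE_I2)
  have "(\<integral>r. \<bar>f r - a r\<bar> \<partial>\<rho>) \<le> (\<integral>r. 1 / N + (\<Sum>i<N. indicator (sym_diff (A i) (C i)) r) / N \<partial>\<rho>)"
    using ind_int int diff by (intro integral_mono) (auto simp: P)
  also have "\<dots> = 1 / N + (\<Sum>i<N. measure \<rho> (sym_diff (A i) (C i))) / N"
    using ind_int D sets.sets_into_space [OF D] by (simp add: prob_space Bochner_Integration.integral_sum Int_absorb2)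
  also have "\<dots> \<le> 1 / N + (\<Sum>i<N. 1 / N) / N"
    using C(2) by (intro add_left_mono divide_right_mono sum_mono) (auto intro: less_imp_le)
  also have "\<dots> = 2 / N" using N0 by (simp add: field_simps)
  also have "\<dots> \<le> \<epsilon>" using N N0 \<epsilon> by (simp add: field_simps)
  finally show ?thesis using that [OF aF a_bounds] by blast
qed

text \<open>The index range includes \<open>n\<close>, so every stage is nonempty and carries
  probability measures.\<close>

definition exhaustion :: "nat \<Rightarrow> 'a::countable set" where
  "exhaustion n = from_nat ` {..n}"

lemma exhaustion: "finite (exhaustion n)" "exhaustion n \<noteq> {}" "m \<le> n \<Longrightarrow> exhaustion m \<subseteq> exhaustion n"
  by (auto simp: exhaustion_def)

lemma finite_subset_exhaustion:
  assumes "finite F" obtains n where "F \<subseteq> exhaustion n"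
proof
  show "F \<subseteq> exhaustion (Max (insert 0 (to_nat ` F)))"
  proof
    fix x assume "x \<in> F"
    then have "to_nat x \<le> Max (insert 0 (to_nat ` F))" using assms by (intro Max_ge) auto
    then show "x \<in> exhaustion (Max (insert 0 (to_nat ` F)))"
      unfolding exhaustion_def by (intro image_eqI [of _ _ "to_nat x"]) auto
  qed
qed

lemma sum_exhaustion_tendsto: "(\<lambda>n. \<Sum>k\<in>exhaustion n. pmf p k) \<longlonglongrightarrow> 1"
proof (rule order_tendstoI)
  fix y :: real assume "y < 1"
  then have "1 - y > 0" by simp
  then obtain F where F: "finite F" "1 - (1 - y) < (\<Sum>k\<in>F. pmf p k)" by (rule pmf_finite_mass)
  obtain m where m: "F \<subseteq> exhaustion m" using finite_subset_exhaustion [OF F(1)] .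
  show "\<forall>\<^sub>F n in sequentially. y < (\<Sum>k\<in>exhaustion n. pmf p k)"
    using eventually_ge_at_top [of m]
  proof eventually_elim
    case (elim n)
    have "(\<Sum>k\<in>F. pmf p k) \<le> (\<Sum>k\<in>exhaustion n. pmf p k)"
      using m exhaustion(3) [OF elim] by (intro sum_mono2 exhaustion) auto
    then show ?case using F(2) by simp
  qed
next
  fix y :: real assume "1 < y"
  then show "\<forall>\<^sub>F n in sequentially. (\<Sum>k\<in>exhaustion n. pmf p k) < y"
    using sum_pmf_le_1 [OF exhaustion(1), of p] by (intro always_eventually allI) (rule le_less_trans)
qed

lemma local_kernel_approx:
  fixes lam :: "('a::countable \<Rightarrow> 'a \<Rightarrow> bool) \<Rightarrow> 'a pmf"
  assumes \<rho>: "\<rho> \<in> Prob_Eqrel" and lam: "lam \<in> measurable Eqrel_borel Prob_borel" and \<epsilon>: "\<epsilon> > 0"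
  obtains F n u where "finite F" "local_on F u" "\<And>r. u r \<in> simplex_on (exhaustion n)"
    "(\<integral>r. l1_dist (lam r) (to_pmf (u r)) \<partial>\<rho>) \<le> \<epsilon>"
proof -
  note P = Prob_EqrelD [OF \<rho>]
  interpret prob_space \<rho> by (rule P)
  have pm: "(\<lambda>r. pmf (lam r) k) \<in> borel_measurable Eqrel_borel" for k
    using lam by (simp add: measurable_Prob_borel_iff)
  have pm\<rho> [measurable]: "(\<lambda>r. pmf (lam r) k) \<in> borel_measurable \<rho>" for k
    using pm measurable_cong_sets [OF P(2) refl] by blast
  have "(\<lambda>n. \<integral>r. (\<Sum>k\<in>exhaustion n. pmf (lam r) k) \<partial>\<rho>) \<longlonglongrightarrow> (\<integral>r. 1 \<partial>\<rho>)"
    by (rule integral_dominated_convergence [where w = "\<lambda>_. 1"])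
       (auto intro!: AE_I2 sum_exhaustion_tendsto sum_pmf_le_1 exhaustion simp: abs_of_nonneg sum_nonneg)
  then have "(\<lambda>n. \<integral>r. (\<Sum>k\<in>exhaustion n. pmf (lam r) k) \<partial>\<rho>) \<longlonglongrightarrow> 1" by (simp add: prob_space)
  then have "\<forall>\<^sub>F n in sequentially. 1 - \<epsilon> / 8 < (\<integral>r. (\<Sum>k\<in>exhaustion n. pmf (lam r) k) \<partial>\<rho>)"
    using \<epsilon> by (intro order_tendstoD) auto
  then obtain n where n: "1 - \<epsilon> / 8 < (\<integral>r. (\<Sum>k\<in>exhaustion n. pmf (lam r) k) \<partial>\<rho>)"
    using eventually_happens' [OF sequentially_bot] by blast
  let ?B = "exhaustion n :: 'a set"
  have B: "finite ?B" "card ?B > 0" using exhaustion [of n] by (auto simp: card_gt_0_iff)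
  \<comment> \<open>With the factors 4 from \<open>l1_dist_truncate_normalize\<close>, the
    coordinate errors contribute \<open>\<epsilon> / 2\<close>, and so does the mass outside the
    finite set, whose mean is below \<open>\<epsilon> / 8\<close>.\<close>
  define \<delta> where "\<delta> = \<epsilon> / (8 * real (card ?B))"
  have \<delta>: "\<delta> > 0" using \<epsilon> B by (simp add: \<delta>_def)
  have "\<forall>k. \<exists>x. finite (fst x) \<and> local_on (fst x) (snd x) \<and> (\<forall>r. (0::real) \<le> snd x r) \<and> (\<forall>r. snd x r \<le> 1) \<and>
      (\<integral>r. \<bar>pmf (lam r) k - snd x r\<bar> \<partial>\<rho>) \<le> \<delta>"
  proof
    fix k
    obtain F a where "finite F" "local_on F a" "\<And>r. (0::real) \<le> a r" "\<And>r. a r \<le> 1" "(\<integral>r. \<bar>pmf (lam r) k - a r\<bar> \<partial>\<rho>) \<le> \<delta>"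
      using local_step_approx [OF \<rho> pm pmf_nonneg pmf_le_1 \<delta>] by blast
    then show "\<exists>x. finite (fst x) \<and> local_on (fst x) (snd x) \<and> (\<forall>r. (0::real) \<le> snd x r) \<and> (\<forall>r. snd x r \<le> 1) \<and>
      (\<integral>r. \<bar>pmf (lam r) k - snd x r\<bar> \<partial>\<rho>) \<le> \<delta>"
      by (intro exI [of _ "(F, a)"]) simp
  qed
  from choice [OF this] obtain x where x: "\<forall>k. finite (fst (x k)) \<and> local_on (fst (x k)) (snd (x k)) \<and>
      (\<forall>r. (0::real) \<le> snd (x k) r) \<and> (\<forall>r. snd (x k) r \<le> 1) \<and> (\<integral>r. \<bar>pmf (lam r) k - snd (x k) r\<bar> \<partial>\<rho>) \<le> \<delta>" ..
  define F a where "F k = fst (x k)" and "a k = snd (x k)" for k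
  have F: "finite (F k)" "local_on (F k) (a k)" and a: "0 \<le> a k r" "a k r \<le> 1"
    and ai: "(\<integral>r. \<bar>pmf (lam r) k - a k r\<bar> \<partial>\<rho>) \<le> \<delta>" for k r
    using spec [OF x, of k] by (simp_all add: F_def a_def)
  obtain b0 where b0: "b0 \<in> ?B" using exhaustion(2) by blast
  define u where "u r = (\<lambda>k. if k \<in> ?B then (if (\<Sum>k\<in>?B. a k r) = 0 then (if k = b0 then 1 else 0) else a k r / (\<Sum>k\<in>?B. a k r)) else (0::real))" for r
  define G where "G = (\<Union>k\<in>?B. F k)"
  have G: "finite G" unfolding G_def using B F by blast
  have u: "u r \<in> simplex_on ?B" "l1_dist (lam r) (to_pmf (u r)) \<le> 4 * (\<Sum>k\<in>?B. \<bar>pmf (lam r) k - a k r\<bar>) + 4 * (1 - (\<Sum>k\<in>?B. pmf (lam r) k))" for r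
    unfolding u_def
    by (rule l1_dist_truncate_normalize [OF B(1) b0, where a = "\<lambda>k. a k r"], rule a)+
  have ul: "local_on G u"
    unfolding local_on_def
  proof (intro ballI impI)
    fix r r' :: "'a \<Rightarrow> 'a \<Rightarrow> bool" assume r: "r \<in> Eqrel" "r' \<in> Eqrel" "window G r = window G r'"
    have eq: "a k r = a k r'" if "k \<in> ?B" for k
      using local_onD [OF F(2) r(1,2)] window_subset [OF r(3), of "F k"] that by (auto simp: G_def)
    then have "(\<Sum>k\<in>?B. a k r) = (\<Sum>k\<in>?B. a k r')" by (intro sum.cong) auto
    then show "u r = u r'" using eq by (auto simp: u_def fun_eq_iff)
  qed
  have am [measurable]: "a k \<in> borel_measurable \<rho>" for k by (rule local_on_borel_measurable [OF F P(2)])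
  have um: "(\<lambda>r. l1_dist (lam r) (to_pmf (u r))) \<in> borel_measurable \<rho>"
  proof (rule borel_measurable_l1_dist)
    show "lam \<in> measurable \<rho> Prob_borel" using lam measurable_cong_sets [OF P(2) refl] by blast
    show "(\<lambda>r. to_pmf (u r)) \<in> measurable \<rho> Prob_borel"
      unfolding measurable_Prob_borel_iff
      by (intro allI local_on_borel_measurable [OF G _ P(2)] local_on_comp [OF ul])
  qed
  have i1: "integrable \<rho> (\<lambda>r. \<bar>pmf (lam r) k - a k r\<bar>)" for k
  proof -
    have "(\<lambda>r. \<bar>pmf (lam r) k - a k r\<bar>) \<in> borel_measurable \<rho>"
      by (intro borel_measurable_abs borel_measurable_diff pm\<rho> am)
    moreover have "norm \<bar>pmf (lam r) k - a k r\<bar> \<le> 1" for r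
      using pmf_nonneg [of "lam r" k] pmf_le_1 [of "lam r" k] a(1) [of k r] a(2) [of k r]
      unfolding real_norm_def by linarith
    ultimately show ?thesis by (intro integrable_const_bound [where B = 1] AE_I2)
  qed
  have i2: "integrable \<rho> (\<lambda>r. pmf (lam r) k)" for k
    by (intro integrable_const_bound [where B = 1] AE_I2 pm\<rho>) (simp add: pmf_le_1)
  have "(\<integral>r. l1_dist (lam r) (to_pmf (u r)) \<partial>\<rho>) \<le> (\<integral>r. 4 * (\<Sum>k\<in>?B. \<bar>pmf (lam r) k - a k r\<bar>) + 4 * (1 - (\<Sum>k\<in>?B. pmf (lam r) k)) \<partial>\<rho>)"
  proof (rule integral_mono)
    show "integrable \<rho> (\<lambda>r. l1_dist (lam r) (to_pmf (u r)))"
      by (intro integrable_const_bound [where B = 2] AE_I2 um) (simp add: l1_dist_le_2)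
    show "integrable \<rho> (\<lambda>r. 4 * (\<Sum>k\<in>?B. \<bar>pmf (lam r) k - a k r\<bar>) + 4 * (1 - (\<Sum>k\<in>?B. pmf (lam r) k)))"
      using i1 i2 by (intro Bochner_Integration.integrable_add integrable_mult_right Bochner_Integration.integrable_diff Bochner_Integration.integrable_sum integrable_const)
  qed (rule u)
  also have "\<dots> = 4 * (\<Sum>k\<in>?B. \<integral>r. \<bar>pmf (lam r) k - a k r\<bar> \<partial>\<rho>) + 4 * (1 - (\<integral>r. (\<Sum>k\<in>?B. pmf (lam r) k) \<partial>\<rho>))"
    using i1 i2 by (simp add: Bochner_Integration.integral_sum prob_space)
  also have "\<dots> \<le> 4 * (\<Sum>k\<in>?B. \<delta>) + 4 * (\<epsilon> / 8)"
    using n ai by (intro add_mono mult_left_mono sum_mono) auto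
  also have "\<dots> = \<epsilon>" using B b0 by (auto simp: \<delta>_def)
  finally show ?thesis using that [OF G ul u(1)] by blast
qed

section \<open>Exactness from amenability of all limits\<close>

lemma simplex_on_mono:
  assumes "u \<in> simplex_on B" "B \<subseteq> C" "finite C"
  shows "u \<in> simplex_on C"
proof -
  have "(\<Sum>k\<in>C. u k) = (\<Sum>k\<in>B. u k)"
    using assms by (intro sum.mono_neutral_right) (auto simp: simplex_on_def)
  then show ?thesis using assms by (auto simp: simplex_on_def)
qed

lemma asymmetry_perturb:
  "asymmetry q s r \<le> asymmetry lam s r + l1_dist (lam r) (q r) + l1_dist (lam (shift (- s) r)) (q (shift (- s) r))"
proof (cases "r 0 s")
  case True
  have "l1_dist (q r) (translate s (q (shift (- s) r))) \<le> l1_dist (q r) (lam r) +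
      (l1_dist (lam r) (translate s (lam (shift (- s) r))) + l1_dist (translate s (lam (shift (- s) r))) (translate s (q (shift (- s) r))))"
    using l1_dist_triangle [of "q r" "translate s (q (shift (- s) r))" "lam r"]
      l1_dist_triangle [of "lam r" "translate s (q (shift (- s) r))" "translate s (lam (shift (- s) r))"] by linarith
  then show ?thesis using True
    by (simp add: asymmetry_eq l1_dist_translate l1_dist_commute [of "q r"])
qed (simp add: asymmetry_eq)

text \<open>The contradiction comes from one fixed kernel \<open>q\<close>. Locality transfers its
  small asymmetry from the limit to late members of the sequence, while its values live on one
  finite set \<open>exhaustion m\<close>; hence every \<open>V k\<close> with
  \<open>k \<ge> m\<close> forces a large asymmetry.\<close>

theorem closure_FIRE_subset_AIRE_exact:
  assumes "IRE_topology closure_of FIRE \<subseteq> (AIRE :: ('a::{group_add, countable} \<Rightarrow> 'a \<Rightarrow> bool) measure set)"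
  shows "exact_group TYPE('a)"
proof (rule property_A_exact, rule property_A_if_unweighted, rule ccontr)
  fix S :: "'a set" and \<epsilon> :: real assume S: "finite S" and \<epsilon>: "\<epsilon> > 0"
    and neg: "\<nexists>B. finite B \<and> (\<forall>V. finite V \<longrightarrow> (\<exists>p\<in>kernels B. (\<Sum>e\<in>inner_edges S V. cost B p e) \<le> \<epsilon> * card V))"
  let ?B = "\<lambda>k. exhaustion k :: 'a set"
  have "\<forall>k. \<exists>V. finite V \<and> (\<forall>p\<in>kernels (?B k). \<epsilon> * card V < (\<Sum>e\<in>inner_edges S V. cost (?B k) p e))"
  proof
    fix k
    have "finite (?B k)" by (rule exhaustion)
    with neg have "\<not> (\<forall>V. finite V \<longrightarrow> (\<exists>p\<in>kernels (?B k). (\<Sum>e\<in>inner_edges S V. cost (?B k) p e) \<le> \<epsilon> * card V))" by blast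
    then show "\<exists>V. finite V \<and> (\<forall>p\<in>kernels (?B k). \<epsilon> * card V < (\<Sum>e\<in>inner_edges S V. cost (?B k) p e))"
      by (simp add: not_le) 
  qed
  from choice [OF this] obtain V where V': "\<forall>k. finite (V k) \<and> (\<forall>p\<in>kernels (?B k). \<epsilon> * card (V k) < (\<Sum>e\<in>inner_edges S (V k). cost (?B k) p e))" ..
  then have V: "finite (V k)" and bad: "p \<in> kernels (?B k) \<Longrightarrow> \<epsilon> * card (V k) < (\<Sum>e\<in>inner_edges S (V k). cost (?B k) p e)" for k p
    by blast+
  \<comment> \<open>Without points there are no edges, so the strict inequality in
    \<open>bad\<close> would fail; \<open>card (V k)\<close> is about to become a
    denominator.\<close>
  have V_ne: "card (V k) > 0" for k
  proof (rule ccontr)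
    assume "\<not> ?thesis"
    then have Vk: "V k = {}" using V [of k] by (simp add: card_gt_0_iff)
    obtain b where b: "b \<in> ?B k" using exhaustion(2) by blast
    have "finite (?B k)" by (rule exhaustion)
    then have "(\<lambda>h x. if x = b then 1 else 0) \<in> kernels (?B k)"
      using b by (auto simp: kernels_iff simplex_on_def)
    from bad [OF this] show False by (simp add: Vk inner_edges_def)
  qed
  \<comment> \<open>The bound 1 makes \<open>pr k\<close> a probability. The other bound keeps the
    overlap loss \<open>4 * card S * \<delta> * \<delta>\<close> below half of the gain
    \<open>\<delta> * \<epsilon>\<close>; the added 1 avoids a zero denominator.\<close>
  define \<delta> where "\<delta> = min 1 (\<epsilon> / (8 * (real (card S) + 1)))"
  have \<delta>: "0 < \<delta>" "\<delta> \<le> 1" using \<epsilon> by (auto simp: \<delta>_def)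
  have "\<delta> * (8 * (real (card S) + 1)) \<le> \<epsilon>"
  proof -
    have "\<delta> \<le> \<epsilon> / (8 * (real (card S) + 1))" unfolding \<delta>_def by (rule min.cobounded2)
    then show ?thesis by (simp add: pos_le_divide_eq)
  qed
  then have \<delta>\<epsilon>: "4 * card S * \<delta> \<le> \<epsilon> / 2" using \<delta> by (simp add: algebra_simps)
  define pr where "pr k = \<delta> / card (V k)" for k
  have pr: "0 \<le> pr k" "pr k \<le> 1" for k
  proof -
    have "1 \<le> real (card (V k))" using V_ne [of k] by linarith
    then show "0 \<le> pr k" "pr k \<le> 1" using \<delta> by (auto simp: pr_def divide_le_eq)
  qed
  have rt: "random_translates (V k) (pr k)" for k
    by (rule random_translates.intro) (use V pr in auto)
  define \<rho>s where "\<rho>s k = distr labels Eqrel_borel (random_translates.tiles (V k) (pr k))" for k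
  have \<rho>s: "\<rho>s k \<in> FIRE" for k unfolding \<rho>s_def by (rule random_translates.law_FIRE [OF rt])
  then have \<rho>sI: "\<rho>s k \<in> IRE" for k by (simp add: FIRE_def)
  obtain s \<rho> where s: "strict_mono s" and \<rho>: "\<rho> \<in> IRE" and ct: "cyl_tendsto (\<lambda>n. \<rho>s (s n)) \<rho>"
    by (rule IRE_convergent_subsequence [OF \<rho>sI])
  have "\<rho> \<in> IRE_topology closure_of FIRE"
    by (rule cyl_tendsto_closure [OF ct \<rho>]) (use \<rho>s in \<open>auto simp: FIRE_def\<close>)
  then have AIRE: "\<rho> \<in> AIRE" by (rule subsetD [OF assms])
  obtain lam where lam: "\<And>n. lam n \<in> measurable Eqrel_borel Prob_borel"
    and lim: "\<And>g. (\<lambda>n. \<integral>r. asymmetry (lam n) g r \<partial>\<rho>) \<longlonglongrightarrow> 0"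
    using AIRE_asymmetry_tendsto [OF AIRE] by metis
  \<comment> \<open>The total asymmetry of \<open>q\<close> in the limit will be below
    \<open>\<theta> + 2 * card S * \<theta>\<close>: one \<open>\<theta>\<close> for
    \<open>lam n\<close>, and for each element of \<open>S\<close> two for replacing
    \<open>lam n\<close> by \<open>q\<close> at a relation and at its shift. This is at most
    \<open>\<delta> * \<epsilon> / 4\<close>, while the tilings force
    \<open>\<delta> * \<epsilon> / 2\<close>.\<close>
  define \<theta> where "\<theta> = \<delta> * \<epsilon> / (4 * (2 * card S + 2))"
  have \<theta>: "\<theta> > 0" using \<delta> \<epsilon> by (simp add: \<theta>_def)
  have "(\<lambda>n. \<Sum>g\<in>S. \<integral>r. asymmetry (lam n) g r \<partial>\<rho>) \<longlonglongrightarrow> (\<Sum>g\<in>S. 0)"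
    by (intro tendsto_sum lim)
  then have "\<forall>\<^sub>F n in sequentially. (\<Sum>g\<in>S. \<integral>r. asymmetry (lam n) g r \<partial>\<rho>) < \<theta>"
    using \<theta> by (intro order_tendstoD(2)) auto
  then obtain n where n: "(\<Sum>g\<in>S. \<integral>r. asymmetry (lam n) g r \<partial>\<rho>) < \<theta>"
    using eventually_happens' [OF sequentially_bot] by blast
  note P = Prob_EqrelD [OF IRE_Prob_Eqrel [OF \<rho>]]
  interpret prob_space \<rho> by (rule P)
  obtain F m u where F: "finite F" "local_on F u" and u: "\<And>r. u r \<in> simplex_on (?B m)"
    and near: "(\<integral>r. l1_dist (lam n r) (to_pmf (u r)) \<partial>\<rho>) \<le> \<theta>"
    using local_kernel_approx [OF IRE_Prob_Eqrel [OF \<rho>] lam [of n] \<theta>] by metis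
  define q where "q r = to_pmf (u r)" for r
  have ql: "local_on F q" unfolding q_def by (rule local_on_comp [OF F(2)])
  have q_meas: "q \<in> measurable Eqrel_borel Prob_borel"
    unfolding measurable_Prob_borel_iff
    using local_on_borel_measurable [OF F(1) local_on_comp [OF ql, of "\<lambda>p. pmf p k" for k] refl] by blast
  have dist_meas: "(\<lambda>r. l1_dist (lam n r) (q r)) \<in> borel_measurable \<rho>"
    unfolding measurable_cong_sets [OF P(2) refl] by (intro borel_measurable_l1_dist lam q_meas)
  have dist_int: "integrable \<rho> (\<lambda>r. l1_dist (lam n r) (q r))"
    by (intro integrable_const_bound [where B = 2] AE_I2 dist_meas) (simp add: l1_dist_le_2)
  have dist_shift: "integrable \<rho> (\<lambda>r. l1_dist (lam n (shift (- g) r)) (q (shift (- g) r)))" for g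
    by (intro integrable_const_bound [where B = 2] AE_I2
        measurable_compose [OF Prob_Eqrel_measurable_shift [OF IRE_Prob_Eqrel [OF \<rho>]] dist_meas]) (simp add: l1_dist_le_2)
  have asym_int: "integrable \<rho> (asymmetry l g)" if "l \<in> measurable Eqrel_borel Prob_borel" for l g
  proof -
    have "asymmetry l g \<in> borel_measurable \<rho>"
      using measurable_asymmetry [OF that, of g] measurable_cong_sets [OF P(2) refl] by blast
    then show ?thesis by (intro integrable_const_bound [where B = 2] AE_I2) (simp_all add: asymmetry_bounds)
  qed
  have "(\<integral>r. (\<Sum>g\<in>S. asymmetry q g r) \<partial>\<rho>) = (\<Sum>g\<in>S. \<integral>r. asymmetry q g r \<partial>\<rho>)"
    using asym_int [OF q_meas] by (rule Bochner_Integration.integral_sum)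
  also have "\<dots> \<le> (\<Sum>g\<in>S. (\<integral>r. asymmetry (lam n) g r \<partial>\<rho>) + 2 * \<theta>)"
  proof (rule sum_mono)
    fix g
    have "(\<integral>r. asymmetry q g r \<partial>\<rho>) \<le> (\<integral>r. asymmetry (lam n) g r + l1_dist (lam n r) (q r)
        + l1_dist (lam n (shift (- g) r)) (q (shift (- g) r)) \<partial>\<rho>)"
      by (intro integral_mono asymmetry_perturb asym_int q_meas lam Bochner_Integration.integrable_add dist_int dist_shift)
    also have "\<dots> = (\<integral>r. asymmetry (lam n) g r \<partial>\<rho>) + (\<integral>r. l1_dist (lam n r) (q r) \<partial>\<rho>)
        + (\<integral>r. l1_dist (lam n (shift (- g) r)) (q (shift (- g) r)) \<partial>\<rho>)"
      using asym_int [OF lam] dist_int dist_shift by simp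
    also have "(\<integral>r. l1_dist (lam n (shift (- g) r)) (q (shift (- g) r)) \<partial>\<rho>) = (\<integral>r. l1_dist (lam n r) (q r) \<partial>\<rho>)"
      by (rule IRE_integral_shift [OF \<rho> dist_meas])
    also have "(\<integral>r. l1_dist (lam n r) (q r) \<partial>\<rho>) \<le> \<theta>" using near by (simp add: q_def)
    finally show "(\<integral>r. asymmetry q g r \<partial>\<rho>) \<le> (\<integral>r. asymmetry (lam n) g r \<partial>\<rho>) + 2 * \<theta>" by simp
  qed
  also have "\<dots> < \<theta> + 2 * card S * \<theta>" using n by (simp add: sum.distrib)
  finally have small: "(\<integral>r. (\<Sum>g\<in>S. asymmetry q g r) \<partial>\<rho>) < \<theta> + 2 * card S * \<theta>" .
  have "\<forall>g. \<exists>G. finite G \<and> local_on G (asymmetry q g)" using local_on_asymmetry [OF F(1) ql] by blast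
  from choice [OF this] obtain G where G: "\<And>g. finite (G g)" "\<And>g. local_on (G g) (asymmetry q g)" by blast
  have "local_on (\<Union>g\<in>S. G g) (\<lambda>r. \<Sum>g\<in>S. asymmetry q g r)"
    by (rule local_on_sum) (rule local_on_mono [OF G(2)], blast)
  then have "(\<lambda>k. \<integral>r. (\<Sum>g\<in>S. asymmetry q g r) \<partial>\<rho>s (s k)) \<longlonglongrightarrow> (\<integral>r. (\<Sum>g\<in>S. asymmetry q g r) \<partial>\<rho>)"
    using S G(1) by (intro cyl_tendsto_integral_local [OF ct]) (auto intro: IRE_Prob_Eqrel \<rho> \<rho>sI)
  then have "\<forall>\<^sub>F k in sequentially. (\<integral>r. (\<Sum>g\<in>S. asymmetry q g r) \<partial>\<rho>s (s k)) < \<theta> + 2 * card S * \<theta>"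
    using small by (rule order_tendstoD(2))
  then have "\<forall>\<^sub>F k in sequentially. (\<integral>r. (\<Sum>g\<in>S. asymmetry q g r) \<partial>\<rho>s (s k)) < \<theta> + 2 * card S * \<theta> \<and> m \<le> k"
    by (intro eventually_conj eventually_ge_at_top)
  then have "\<exists>k. (\<integral>r. (\<Sum>g\<in>S. asymmetry q g r) \<partial>\<rho>s (s k)) < \<theta> + 2 * card S * \<theta> \<and> m \<le> k"
    by (rule eventually_happens' [OF sequentially_bot])
  then obtain k where k: "(\<integral>r. (\<Sum>g\<in>S. asymmetry q g r) \<partial>\<rho>s (s k)) < \<theta> + 2 * card S * \<theta>" "m \<le> k" by blast
  define K where "K = s k"
  have mK: "m \<le> K" using k(2) seq_suble [OF s, of k] by (simp add: K_def)
  \<comment> \<open>The index \<open>K\<close> grows beyond \<open>m\<close>, so the fixed kernel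
    becomes admissible for the finite set against which \<open>V K\<close> was chosen.\<close>
  have uK: "u r \<in> simplex_on (?B K)" for r
    by (rule simplex_on_mono [OF u exhaustion(3) [OF mK] exhaustion(1)])
  have "pr K * \<epsilon> * card (V K) - 4 * card S * (card (V K))\<^sup>2 * (pr K)\<^sup>2 \<le> (\<integral>r. (\<Sum>g\<in>S. asymmetry q g r) \<partial>\<rho>s K)"
    unfolding \<rho>s_def
    by (rule random_translates.integral_asymmetry_ge [OF rt S exhaustion(1) uK q_def F(1) ql less_imp_le [OF bad]])
  also have "pr K * \<epsilon> * card (V K) - 4 * card S * (card (V K))\<^sup>2 * (pr K)\<^sup>2 = \<delta> * \<epsilon> - (4 * card S * \<delta>) * \<delta>"
    using V_ne [of K] by (simp add: pr_def power2_eq_square)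
  finally have "\<delta> * \<epsilon> - (4 * card S * \<delta>) * \<delta> < \<theta> + 2 * card S * \<theta>" using k(1) by (simp add: K_def)
  moreover have "(4 * card S * \<delta>) * \<delta> \<le> \<epsilon> / 2 * \<delta>" using \<delta>\<epsilon> \<delta> by (intro mult_right_mono) auto
  moreover have "\<theta> + 2 * card S * \<theta> \<le> \<delta> * \<epsilon> / 4"
  proof -
    have "\<theta> * (2 * card S + 2) = \<delta> * \<epsilon> / 4" by (simp add: \<theta>_def field_simps)
    moreover have "\<theta> + 2 * card S * \<theta> \<le> \<theta> * (2 * card S + 2)" using \<theta> by (simp add: algebra_simps)
    ultimately show ?thesis by simp
  qed
  moreover have "\<delta> * \<epsilon> > 0" using \<delta> \<epsilon> by simp
  ultimately show False by (simp add: mult.commute)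
qed

theorem corollary1p3:
  shows "exact_group TYPE('a::{group_add, countable}) \<longleftrightarrow>
    IRE_topology closure_of FIRE = (AIRE :: ('a \<Rightarrow> 'a \<Rightarrow> bool) measure set)"
  using exact_closure_FIRE_subset_AIRE AIRE_subset_closure_FIRE closure_FIRE_subset_AIRE_exact
  by (metis order_antisym order_refl)

end
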